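(* Let $d\le p$, let $R$ be a unitarily invariant norm on $\mathbb{R}^{d\times p}$ with symmetric gauge $f$, let $\Theta^*$ have rank $r\ge1$, and let $\theta^*\in\mathbb{R}^d$ be any subgradient of $f$ at $\sigma(\Theta^* )$ with nonnegative entries sorted in descending order; set $\rho=\theta^*_{\max}/\theta^*_{\min}$ (with $\rho=+\infty$ if $\theta^*_{\min}=0$). Then $$w(\mathcal{A}_R(\Theta^* )) \leq \min\Big\{ \sqrt{d p},\ \sqrt{ ( 2 \rho^2 + 1 ) ( d + p - r ) r} \Big\},$$ where $\mathcal{A}_R(\Theta^* )=\mathcal{E}_R(\Theta^* )\cap\mathbb{S}^{dp-1}$.
   Context: A norm $R$ on $\mathbb{R}^{d\times p}$ is unitarily invariant if $R(U\Theta V)=R(\Theta)$ for all orthogonal $U,V$ of appropriate sizes; then $R(\Theta)=f(\sigma(\Theta))$ for a symmetric gauge function $f$ on $\mathbb{R}^d$ (a permutation- and sign-invariant norm), and $R^*(\Theta)=f^*(\sigma(\Theta))$; $\sigma(\Theta)\in\mathbb{R}^d$ is the vector of singular values sorted in descending order. $\theta^*_{\max}$, $\theta^*_{\min}$ are the largest and smallest entries of $\theta^*$. $\mathcal{E}_R(\Theta^* ) = \mathrm{cone}\{ \Delta : R(\Delta + \Theta^* ) \leq R(\Theta^* ) \}$; $\mathbb{S}^{dp-1}$ is the Frobenius unit sphere. The Gaussian width is $w(\mathcal{A})=\mathbb{E}\sup_{Z\in\mathcal{A}}\mathrm{tr}(G^TZ)$ with $G\in\mathbb{R}^{d\times p}$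 having i.i.d. $N(0,1)$ entries. *)

theory Defs
  imports "HOL-Probability.Probability" "Jordan_Normal_Form.DL_Rank"
begin

definition orth_mat :: "nat \<Rightarrow> real mat \<Rightarrow> bool" where
  "orth_mat n U \<longleftrightarrow> U \<in> carrier_mat n n \<and> transpose_mat U * U = 1\<^sub>m n"

definition rect_diag :: "nat \<Rightarrow> nat \<Rightarrow> real vec \<Rightarrow> real mat" where
  "rect_diag d p s = mat d p (\<lambda>(i,j). if i = j then s $ i else 0)"

definition sing_vals :: "nat \<Rightarrow> nat \<Rightarrow> real mat \<Rightarrow> real vec" where
  "sing_vals d p A = (SOME s. s \<in> carrier_vec d \<and> (\<forall>i<d. 0 \<le> s $ i) \<and>
      (\<forall>i j. i \<le> j \<and> j < d \<longrightarrow> s $ j \<le> s $ i) \<and>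
      (\<exists>U V. orth_mat d U \<and> orth_mat p V \<and> A = U * rect_diag d p s * V))"

definition is_vec_norm :: "nat \<Rightarrow> (real vec \<Rightarrow> real) \<Rightarrow> bool" where
  "is_vec_norm d f \<longleftrightarrow>
     (\<forall>x\<in>carrier_vec d. 0 \<le> f x \<and> (f x = 0 \<longleftrightarrow> x = 0\<^sub>v d)) \<and>
     (\<forall>x\<in>carrier_vec d. \<forall>c. f (c \<cdot>\<^sub>v x) = \<bar>c\<bar> * f x) \<and>
     (\<forall>x\<in>carrier_vec d. \<forall>y\<in>carrier_vec d. f (x + y) \<le> f x + f y)"

definition symmetric_gauge :: "nat \<Rightarrow> (real vec \<Rightarrow> real) \<Rightarrow> bool" where
  "symmetric_gauge d f \<longleftrightarrow> is_vec_norm d f \<and>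
     (\<forall>x\<in>carrier_vec d. \<forall>\<pi>. \<pi> permutes {..<d} \<longrightarrow> f (vec d (\<lambda>i. x $ \<pi> i)) = f x) \<and>
     (\<forall>x\<in>carrier_vec d. \<forall>\<epsilon>. (\<forall>i<d. \<epsilon> i = 1 \<or> \<epsilon> i = -1) \<longrightarrow>
        f (vec d (\<lambda>i. \<epsilon> i * x $ i)) = f x)"

definition is_mat_norm :: "nat \<Rightarrow> nat \<Rightarrow> (real mat \<Rightarrow> real) \<Rightarrow> bool" where
  "is_mat_norm d p R \<longleftrightarrow>
     (\<forall>A\<in>carrier_mat d p. 0 \<le> R A \<and> (R A = 0 \<longleftrightarrow> A = 0\<^sub>m d p)) \<and>
     (\<forall>A\<in>carrier_mat d p. \<forall>c. R (c \<cdot>\<^sub>m A) = \<bar>c\<bar> * R A) \<and>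
     (\<forall>A\<in>carrier_mat d p. \<forall>B\<in>carrier_mat d p. R (A + B) \<le> R A + R B)"

definition unitarily_invariant :: "nat \<Rightarrow> nat \<Rightarrow> (real mat \<Rightarrow> real) \<Rightarrow> bool" where
  "unitarily_invariant d p R \<longleftrightarrow> is_mat_norm d p R \<and>
     (\<forall>U V A. orth_mat d U \<longrightarrow> orth_mat p V \<longrightarrow> A \<in> carrier_mat d p \<longrightarrow> R (U * A * V) = R A)"

definition is_subgradient :: "nat \<Rightarrow> (real vec \<Rightarrow> real) \<Rightarrow> real vec \<Rightarrow> real vec \<Rightarrow> bool" where
  "is_subgradient d f x \<theta> \<longleftrightarrow> \<theta> \<in> carrier_vec d \<and>
     (\<forall>y\<in>carrier_vec d. f y \<ge> f x + \<theta> \<bullet> (y - x))"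

definition frob_norm :: "real mat \<Rightarrow> real" where
  "frob_norm A = sqrt (\<Sum>i<dim_row A. \<Sum>j<dim_col A. (A $$ (i,j))\<^sup>2)"

definition err_cone :: "nat \<Rightarrow> nat \<Rightarrow> (real mat \<Rightarrow> real) \<Rightarrow> real mat \<Rightarrow> real mat set" where
  "err_cone d p R \<Theta> = {t \<cdot>\<^sub>m D | t D. t \<ge> 0 \<and> D \<in> carrier_mat d p \<and> R (D + \<Theta>) \<le> R \<Theta>}"

definition A_set :: "nat \<Rightarrow> nat \<Rightarrow> (real mat \<Rightarrow> real) \<Rightarrow> real mat \<Rightarrow> real mat set" where
  "A_set d p R \<Theta> = err_cone d p R \<Theta> \<inter> {Z \<in> carrier_mat d p. frob_norm Z = 1}"

definition gauss_mat :: "nat \<Rightarrow> nat \<Rightarrow> (nat \<times> nat \<Rightarrow> real) measure" where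
  "gauss_mat d p = PiM ({..<d} \<times> {..<p}) (\<lambda>_. density lborel std_normal_density)"

definition gaussian_width :: "nat \<Rightarrow> nat \<Rightarrow> real mat set \<Rightarrow> real" where
  "gaussian_width d p S =
     (\<integral>G. (SUP Z\<in>S. \<Sum>i<d. \<Sum>j<p. G (i,j) * Z $$ (i,j)) \<partial>gauss_mat d p)"

end

theory Submission
  imports Defs "HOL-Real_Asymp.Real_Asymp" "Jordan_Normal_Form.Char_Poly"
begin

text \<open>
  Rotate so that \<open>\<Theta> = diag(\<sigma>)\<close>. For every \<open>G\<close>, the matrix \<open>\<Gamma>\<close> that agrees with \<open>G\<close> on the lower
  right \<open>(d - r) \<times> (p - r)\<close> block and whose only other entries are \<open>(\<tau> / \<theta>\<^sub>m\<^sub>i\<^sub>n) \<theta>\<^sub>i\<close> on the first \<open>r\<close>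
  diagonal places, where \<open>\<tau>\<close> is the operator norm of that block, is a nonnegative multiple of a subgradient
  of \<open>R\<close> at \<open>\<Theta>\<close>: this follows by pinching \<open>R\<close> to the diagonal after a singular value
  decomposition of the lower right block. Hence \<open>\<langle>\<Gamma>, Z\<rangle> \<le> 0\<close> on the error cone and the
  supremum is at most \<open>\<parallel>G - \<Gamma>\<parallel>\<close>. Its second moment is
  \<open>r (d + p - r) + (\<Sum>\<^sub>i \<theta>\<^sub>i\<^sup>2 / \<theta>\<^sub>m\<^sub>i\<^sub>n\<^sup>2) E \<tau>\<^sup>2\<close>, the cross term vanishing by Gaussian integration by parts.

  The sharp bound \<open>E \<tau>\<^sup>2 \<le> 2 ((d - r) + (p - r))\<close> is Chevet's inequality for second moments. Since
  \<open>\<tau>\<^sup>2 = sup (2 u\<^sup>T G v - |u|\<^sup>2 |v|\<^sup>2)\<close> over all vectors \<open>u\<close>, \<open>v\<close>, it follows from a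
  Sudakov--Fernique comparison with deterministic offsets, proved by interpolating between the two
  processes in the log-sum-exp function.
\<close>

no_notation inner (infix "\<bullet>" 70)
no_notation vec_nth (infixl "$" 90)

section \<open>Singular value decomposition\<close>

text \<open>Bounding E \<tau> and squaring would leave the variance of \<tau> unaccounted for,
  whereas \<tau> enters through the square of a norm. Hence \<tau>^2 itself is written as the
  supremum of a Gaussian process; the price is deterministic offsets, which are the same in both
  processes of the comparison and constant along the interpolation. The constant 2 is that of (x +
  y)^2 <= 2 (x^2 + y^2), applied to the norms of two independent Gaussian vectors of lengths d - r
  and p - r. The cross term couples the first r diagonal entries of the rotated G with \<tau>, which
  depends on the block alone. Only the matrices are rotated, not the measure: rotated entries are
  linear forms in G with orthonormal coefficients, so independence appears as orthogonality of
  coefficients. To integrate by parts, \<tau> is approximated by finite maxima of linear forms, and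
  these by log-sum-exp. As \<open>sing_vals\<close> is a choice, singular values must be shown to
  exist, and to be unique up to order and sign, before R can be evaluated on a diagonal
  matrix.\<close>

lemma orth_matD:
  assumes "orth_mat n U"
  shows "U \<in> carrier_mat n n" "U\<^sup>T * U = 1\<^sub>m n" "U * U\<^sup>T = 1\<^sub>m n"
  using assms mat_mult_left_right_inverse[of "U\<^sup>T" n U] by (auto simp: orth_mat_def)

lemma orth_mat_transpose: "orth_mat n U \<Longrightarrow> orth_mat n U\<^sup>T"
  unfolding orth_mat_def[of n "U\<^sup>T"] by (metis orth_matD(1,3) transpose_carrier_mat transpose_transpose)

lemma orth_mat_one: "orth_mat n (1\<^sub>m n)"
  by (simp add: orth_mat_def)

lemma orth_mat_mult:
  assumes "orth_mat n U" "orth_mat n V" shows "orth_mat n (U * V)"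
proof -
  note U = orth_matD[OF assms(1)] and V = orth_matD[OF assms(2)]
  have "(U * V)\<^sup>T * (U * V) = V\<^sup>T * (U\<^sup>T * U) * V"
    using U(1) V(1) by (simp add: transpose_mult[OF U(1) V(1)] assoc_mult_mat[of _ n n _ n _ n])
  then show ?thesis using U V by (simp add: orth_mat_def)
qed

text \<open>Lets a rotation of the trailing block act on the whole matrix. It assembles the SVD by
  induction, and later diagonalises a lower right block without moving the leading diagonal
  entries.\<close>

lemma orth_mat_block:
  assumes "orth_mat n U" shows "orth_mat (m + n) (four_block_mat (1\<^sub>m m) (0\<^sub>m m n) (0\<^sub>m n m) U)"
proof -
  note U = orth_matD[OF assms]
  show ?thesis unfolding orth_mat_def
    using U by (subst transpose_four_block_mat[of _ m m _ n _ n])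
      (auto simp: mult_four_block_mat[of _ m m _ n _ n _ _ m _ n] intro!: four_block_one_mat)
qed

lemma orth_mat_isometry:
  assumes "orth_mat n U" "x \<in> carrier_vec n" "y \<in> carrier_vec n"
  shows "(U *\<^sub>v x) \<bullet> (U *\<^sub>v y) = x \<bullet> y"
proof -
  note U = orth_matD[OF assms(1)]
  have "(U *\<^sub>v x) \<bullet> (U *\<^sub>v y) = x \<bullet> (U\<^sup>T *\<^sub>v (U *\<^sub>v y))"
    using transpose_vec_mult_scalar[of "U\<^sup>T" n n "U *\<^sub>v y" x] U assms
    by (metis comm_scalar_prod mult_mat_vec_carrier transpose_carrier_mat transpose_transpose)
  also have "U\<^sup>T *\<^sub>v (U *\<^sub>v y) = y"
    using U assms by (simp flip: assoc_mult_mat_vec[of _ n n _ n])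
  finally show ?thesis .
qed

lemma scalar_prod_self_nonneg: "0 \<le> (x :: real vec) \<bullet> x"
  by (simp add: scalar_prod_def sum_nonneg)

lemma orth_mat_first_col:
  fixes u :: "real vec"
  assumes u: "u \<in> carrier_vec n" "u \<bullet> u = (1::real)" and n: "0 < n"
  shows "\<exists>P. orth_mat n P \<and> P *\<^sub>v unit_vec n 0 = u"
proof (cases "u = unit_vec n 0")
  case True
  then show ?thesis using orth_mat_one[of n] by (intro exI[of _ "1\<^sub>m n"]) auto
next
  case False
  \<comment> \<open>the Householder reflection exchanging \<open>u\<close> and the first unit vector\<close>
  define w where "w i = u $ i - (if i = 0 then 1 else 0)" for i
  define q where "q = (\<Sum>i<n. (w i)\<^sup>2)"
  have uu: "(\<Sum>i<n. (u $ i)\<^sup>2) = 1"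
    using u by (simp add: scalar_prod_def power2_eq_square atLeast0LessThan)
  have "q = (\<Sum>i<n. (u $ i)\<^sup>2 + (if i = 0 then 1 - 2 * u $ i else 0))"
    unfolding q_def w_def by (intro sum.cong) (auto simp: power2_eq_square algebra_simps)
  also have "\<dots> = 2 - 2 * u $ 0" using n by (simp add: sum.distrib uu)
  \<comment> \<open>Since \<open>u\<close> is a unit vector, |u - e_0|^2 = 2 - 2 u_0. This identity
    makes the reflection along \<open>w\<close> send e_0 exactly to e_0 + w = u.\<close>
  finally have q: "q = - 2 * w 0" by (simp add: w_def)
  have "q \<noteq> 0"
  proof
    assume "q = 0"
    then have "\<forall>i<n. w i = 0" by (simp add: q_def sum_nonneg_eq_0_iff)
    then have "u = unit_vec n 0" using u n by (intro eq_vecI) (auto simp: w_def split: if_splits)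
    with False show False by simp
  qed
  define P where "P = mat n n (\<lambda>(i,j). (if i = j then 1 else 0) - 2 / q * (w i * w j))"
  have "(P\<^sup>T * P) $$ (i,j) = (if i = j then 1 else 0)" if "i < n" "j < n" for i j
  proof -
    have "(P\<^sup>T * P) $$ (i,j) = (\<Sum>k<n. ((if k = i then 1 else 0) - 2 / q * (w k * w i)) * ((if k = j then 1 else 0) - 2 / q * (w k * w j)))"
      using that by (simp add: P_def scalar_prod_def atLeast0LessThan)
    also have "\<dots> = (\<Sum>k<n. (if k = i then if i = j then 1 else 0 else 0) - (if k = i then 2 / q * (w i * w j) else 0)
        - (if k = j then 2 / q * (w i * w j) else 0) + 4 / q\<^sup>2 * (w i * w j) * (w k)\<^sup>2)"
      by (intro sum.cong) (auto simp: algebra_simps power2_eq_square)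
    also have "\<dots> = (if i = j then 1 else 0) - 4 / q * (w i * w j) + 4 / q\<^sup>2 * (w i * w j) * q"
    proof -
      have "(\<Sum>k<n. 4 / q\<^sup>2 * (w i * w j) * (w k)\<^sup>2) = 4 / q\<^sup>2 * (w i * w j) * q"
        unfolding q_def by (rule sum_distrib_left[symmetric])
      then show ?thesis using that by (simp only: sum.distrib sum_subtractf) simp
    qed
    also have "\<dots> = (if i = j then 1 else 0)" using \<open>q \<noteq> 0\<close> by (simp add: field_simps power2_eq_square)
    finally show ?thesis .
  qed
  then have "orth_mat n P" unfolding orth_mat_def by (auto simp: P_def intro!: eq_matI)
  moreover have "P *\<^sub>v unit_vec n 0 = u"
  proof (rule eq_vecI)
    fix i assume "i < dim_vec u"
    then have i: "i < n" using u by simp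
    have "(P *\<^sub>v unit_vec n 0) $ i = (if i = 0 then 1 else 0) - 2 / q * (w i * w 0)"
      using i n by (simp add: P_def)
    also have "\<dots> = (if i = 0 then 1 else 0) + w i" using q \<open>q \<noteq> 0\<close> by (simp add: field_simps)
    finally show "(P *\<^sub>v unit_vec n 0) $ i = u $ i" by (simp add: w_def)
  qed (use u in \<open>simp add: P_def\<close>)
  ultimately show ?thesis by blast
qed

section \<open>Maximising a bilinear form over two unit spheres\<close>

lemma compact_unit_sphere_fun:
  "compact {u :: nat \<Rightarrow> real. (\<forall>i. i \<ge> n \<longrightarrow> u i = 0) \<and> (\<Sum>i<n. (u i)\<^sup>2) = 1}" (is "compact ?S")
proof -
  \<comment> \<open>Vectors are encoded as functions vanishing from \<open>n\<close> on, so that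
    compactness comes from Tychonoff's theorem: the sphere is a closed subset of this product of
    intervals and singletons.\<close>
  let ?B = "PiE UNIV (\<lambda>i. if i < n then {-1..1} else {0::real})"
  have "compact ?B"
    using compactin_PiE[of "\<lambda>_::nat. euclidean :: real topology" UNIV]
    by (auto simp: euclidean_product_topology)
  moreover have "closed ?S"
    by (intro closed_Collect_conj closed_Collect_all closed_Collect_imp closed_Collect_eq open_Collect_const continuous_intros
        continuous_on_product_coordinates)
  moreover have "?S \<subseteq> ?B"
  proof
    fix u assume u: "u \<in> ?S"
    have "\<bar>u i\<bar> \<le> 1" if "i < n" for i
    proof -
      have "(u i)\<^sup>2 \<le> (\<Sum>i<n. (u i)\<^sup>2)" using that by (intro member_le_sum) auto
      then show ?thesis using u by (simp add: abs_square_le_1)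
    qed
    then show "u \<in> ?B" using u by (auto simp: abs_le_iff)
  qed
  ultimately show ?thesis using compact_Int_closed[of ?B ?S] by (simp only: Int_absorb1)
qed

text \<open>The value at the maximiser is the largest singular value. Compactness gives a maximum
  over unit vectors; homogeneity extends the inequality to all \<open>x\<close>, \<open>y\<close>,
  the form in which test vectors of arbitrary length are inserted later.\<close>

lemma max_bilinear_exists:
  assumes A: "(A :: real mat) \<in> carrier_mat d p" and d: "0 < d" "0 < p"
  shows "\<exists>u v. u \<in> carrier_vec d \<and> v \<in> carrier_vec p \<and> u \<bullet> u = 1 \<and> v \<bullet> v = 1 \<and>
     (\<forall>x\<in>carrier_vec d. \<forall>y\<in>carrier_vec p. x \<bullet> (A *\<^sub>v y) \<le> u \<bullet> (A *\<^sub>v v) * (sqrt (x \<bullet> x) * sqrt (y \<bullet> y)))"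
proof -
  let ?S = "\<lambda>n. {u :: nat \<Rightarrow> real. (\<forall>i. i \<ge> n \<longrightarrow> u i = 0) \<and> (\<Sum>i<n. (u i)\<^sup>2) = 1}"
  let ?f = "\<lambda>w :: (nat \<Rightarrow> real) \<times> (nat \<Rightarrow> real). \<Sum>i<d. \<Sum>j<p. fst w i * A $$ (i,j) * snd w j"
  have ne: "(\<lambda>i. if i = 0 then 1 else 0) \<in> ?S n" if "0 < n" for n
  proof -
    have "(\<Sum>i<n. (if i = 0 then 1 else 0 :: real)\<^sup>2) = (\<Sum>i<n. if i = 0 then 1 else 0)"
      by (intro sum.cong) auto
    also have "\<dots> = 1" using that by simp
    finally show ?thesis using that by simp
  qed
  have cont: "continuous_on (?S d \<times> ?S p) ?f"
  proof -
    have "continuous_on (?S d \<times> ?S p) (\<lambda>w. fst w i)" "continuous_on (?S d \<times> ?S p) (\<lambda>w. snd w i)" for i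
      by (rule continuous_on_product_then_coordinatewise, intro continuous_intros)+
    then show ?thesis by (intro continuous_intros) auto
  qed
  have "?S d \<times> ?S p \<noteq> {}"
    using SigmaI[OF ne[OF d(1)] ne[OF d(2)]] by (rule ex_in_conv[THEN iffD1, OF exI])
  from continuous_attains_sup[OF compact_Times[OF compact_unit_sphere_fun compact_unit_sphere_fun] this cont]
  obtain w where w: "w \<in> ?S d \<times> ?S p" "\<forall>z\<in>?S d \<times> ?S p. ?f z \<le> ?f w"
    by (elim bexE)
  define u0 v0 where "u0 = fst w" and "v0 = snd w"
  have uv: "u0 \<in> ?S d" "v0 \<in> ?S p"
    unfolding u0_def v0_def by (rule SigmaE[OF w(1)], simp only: fst_conv snd_conv)+
  have max: "?f (x, y) \<le> ?f (u0, v0)" if "x \<in> ?S d" "y \<in> ?S p" for x y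
    using w(2)[rule_format, OF SigmaI[OF that]] by (simp only: u0_def v0_def prod.collapse)
  define u v where "u = vec d u0" and "v = vec p v0"
  have bil: "vec d x \<bullet> (A *\<^sub>v vec p y) = ?f (x, y)" for x y
    using A by (simp add: scalar_prod_def sum_distrib_left mult_ac atLeast0LessThan)
  have unit: "u \<bullet> u = 1" "v \<bullet> v = 1"
    using uv by (auto simp: u_def v_def scalar_prod_def power2_eq_square atLeast0LessThan)
  have le: "x \<bullet> (A *\<^sub>v y) \<le> u \<bullet> (A *\<^sub>v v)" if x: "x \<in> carrier_vec d" "y \<in> carrier_vec p" "x \<bullet> x = 1" "y \<bullet> y = 1" for x y
  proof -
    let ?x = "\<lambda>i. if i < d then x $ i else 0" and ?y = "\<lambda>i. if i < p then y $ i else 0"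
    have "?x \<in> ?S d" "?y \<in> ?S p"
      using x by (auto simp: scalar_prod_def power2_eq_square atLeast0LessThan)
    from max[OF this] have "vec d ?x \<bullet> (A *\<^sub>v vec p ?y) \<le> u \<bullet> (A *\<^sub>v v)"
      unfolding bil u_def v_def .
    moreover have "vec d ?x = x" "vec p ?y = y" using x by (auto intro!: eq_vecI)
    ultimately show ?thesis by simp
  qed
  have "x \<bullet> (A *\<^sub>v y) \<le> u \<bullet> (A *\<^sub>v v) * (sqrt (x \<bullet> x) * sqrt (y \<bullet> y))"
    if x: "x \<in> carrier_vec d" "y \<in> carrier_vec p" for x y
  proof (cases "x \<bullet> x = 0 \<or> y \<bullet> y = 0")
    case True
    then have "x = 0\<^sub>v d \<or> y = 0\<^sub>v p"
      using x by (auto simp: scalar_prod_def sum_nonneg_eq_0_iff intro!: eq_vecI)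
    moreover have "A *\<^sub>v 0\<^sub>v p = 0\<^sub>v d" using A by (intro eq_vecI) auto
    ultimately have "x \<bullet> (A *\<^sub>v y) = 0" using x A by auto
    with True show ?thesis by auto
  next
    case False
    then have pos: "0 < sqrt (x \<bullet> x)" "0 < sqrt (y \<bullet> y)"
      using scalar_prod_self_nonneg[of x] scalar_prod_self_nonneg[of y] by auto
    let ?a = "sqrt (x \<bullet> x)" and ?b = "sqrt (y \<bullet> y)"
    have "(1/?a \<cdot>\<^sub>v x) \<bullet> (A *\<^sub>v (1/?b \<cdot>\<^sub>v y)) \<le> u \<bullet> (A *\<^sub>v v)"
    proof (rule le)
      show "(1/?a \<cdot>\<^sub>v x) \<bullet> (1/?a \<cdot>\<^sub>v x) = 1" using x pos scalar_prod_self_nonneg[of x] False by simp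
      show "(1/?b \<cdot>\<^sub>v y) \<bullet> (1/?b \<cdot>\<^sub>v y) = 1" using x pos scalar_prod_self_nonneg[of y] False by simp
    qed (use x in auto)
    moreover have "(1/?a \<cdot>\<^sub>v x) \<bullet> (A *\<^sub>v (1/?b \<cdot>\<^sub>v y)) = (x \<bullet> (A *\<^sub>v y)) / (?a * ?b)"
      using x A by (simp add: mult_mat_vec[of _ d p])
    ultimately show ?thesis using pos by (simp add: divide_le_eq)
  qed
  then show ?thesis using unit by (intro exI[of _ u] exI[of _ v]) (auto simp: u_def v_def)
qed

lemma orth_cancel:
  assumes U: "orth_mat n U" and V: "orth_mat m V" and D: "D \<in> carrier_mat n m"
  shows "U\<^sup>T * (U * D * V) * V\<^sup>T = D"
proof -
  note u = orth_matD[OF U] and v = orth_matD[OF V]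
  have c: "U\<^sup>T \<in> carrier_mat n n" "V\<^sup>T \<in> carrier_mat m m" "U * D \<in> carrier_mat n m" using u v D by auto
  have "U\<^sup>T * (U * D * V) * V\<^sup>T = U\<^sup>T * (U * D * V * V\<^sup>T)"
    using assoc_mult_mat[OF c(1) mult_carrier_mat[OF c(3) v(1)] c(2)] .
  also have "U * D * V * V\<^sup>T = U * D"
    using assoc_mult_mat[OF c(3) v(1) c(2)] right_mult_one_mat[OF c(3)] by (simp only: v)
  also have "U\<^sup>T * (U * D) = D"
    using assoc_mult_mat[OF c(1) u(1) D] left_mult_one_mat[OF D] by (simp only: u)
  finally show ?thesis .
qed

lemma orth_cancel':
  assumes U: "orth_mat n U" and V: "orth_mat m V" and D: "D \<in> carrier_mat n m"
  shows "U * (U\<^sup>T * D * V) * V\<^sup>T = D"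
  using orth_cancel[OF orth_mat_transpose[OF U] V D] by simp

lemma bilinear_mult:
  fixes A :: "real mat"
  assumes A: "A \<in> carrier_mat n m" and P: "P \<in> carrier_mat n k" and Q: "Q \<in> carrier_mat m l"
    and x: "x \<in> carrier_vec k" and y: "y \<in> carrier_vec l"
  shows "x \<bullet> ((P\<^sup>T * A * Q) *\<^sub>v y) = (P *\<^sub>v x) \<bullet> (A *\<^sub>v (Q *\<^sub>v y))"
proof -
  let ?z = "A *\<^sub>v (Q *\<^sub>v y)"
  have z: "?z \<in> carrier_vec n" using A Q y by auto
  have "(P\<^sup>T * A * Q) *\<^sub>v y = P\<^sup>T *\<^sub>v ?z"
    using assoc_mult_mat_vec[of "P\<^sup>T * A" k m Q l y] assoc_mult_mat_vec[of "P\<^sup>T" k n A m "Q *\<^sub>v y"] A P Q y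
    by (simp only: transpose_carrier_mat mult_carrier_mat[of _ k n] mult_mat_vec_carrier)
  then have "x \<bullet> ((P\<^sup>T * A * Q) *\<^sub>v y) = (P\<^sup>T *\<^sub>v ?z) \<bullet> x"
    using comm_scalar_prod[OF x, of "P\<^sup>T *\<^sub>v ?z"] P z by (simp add: mult_mat_vec_carrier[of _ k n])
  also have "\<dots> = ?z \<bullet> (P *\<^sub>v x)" by (rule transpose_vec_mult_scalar[OF P x z])
  also have "\<dots> = (P *\<^sub>v x) \<bullet> ?z"
    using P x by (intro comm_scalar_prod[OF z]) auto
  finally show ?thesis .
qed

lemma unit_bilinear:
  fixes A :: "real mat"
  assumes "A \<in> carrier_mat n m" "i < n" "j < m"
  shows "unit_vec n i \<bullet> (A *\<^sub>v unit_vec m j) = A $$ (i,j)"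
  using assms by (simp add: scalar_prod_left_unit[of _ n])

lemma rect_diag_carrier [simp]: "rect_diag d p s \<in> carrier_mat d p"
  by (simp add: rect_diag_def)

text \<open>The variational step of the SVD. With \<open>s\<close> the maximum of the form and
  \<open>c\<close> an entry in the row or column of the corner, a test vector with coordinates
  \<open>s\<close>, \<open>c\<close> has value s^2 + c^2 and length sqrt (s^2 + c^2); unless
  \<open>c\<close> is zero it would beat the maximum.\<close>

lemma eq_zero_of_norm_bound:
  fixes s c :: real
  assumes "s\<^sup>2 + c\<^sup>2 \<le> s * sqrt (s\<^sup>2 + c\<^sup>2)" shows "c = 0"
proof (rule ccontr)
  assume "c \<noteq> 0"
  then have pos: "0 < s\<^sup>2 + c\<^sup>2" by (simp add: add_nonneg_pos)
  then have "sqrt (s\<^sup>2 + c\<^sup>2) * sqrt (s\<^sup>2 + c\<^sup>2) \<le> s * sqrt (s\<^sup>2 + c\<^sup>2)" using assms by simp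
  then have "sqrt (s\<^sup>2 + c\<^sup>2) \<le> s" using pos by (simp only: mult_le_cancel_right) auto
  then have "(sqrt (s\<^sup>2 + c\<^sup>2))\<^sup>2 \<le> s\<^sup>2" using pos by (intro power_mono) auto
  then show False using pos \<open>c \<noteq> 0\<close> by simp
qed

text \<open>Induction on the number of rows, splitting off the largest singular value: rotating a
  maximising pair to the first unit vectors leaves a matrix whose first row and column vanish off
  the corner, and the induction hypothesis treats the remaining block.\<close>

lemma svd_exists:
  fixes A :: "real mat"
  assumes "A \<in> carrier_mat d p" "d \<le> p"
  shows "\<exists>s U V. s \<in> carrier_vec d \<and> (\<forall>i<d. 0 \<le> s $ i) \<and> (\<forall>i j. i \<le> j \<and> j < d \<longrightarrow> s $ j \<le> s $ i)
     \<and> orth_mat d U \<and> orth_mat p V \<and> A = U * rect_diag d p s * V"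
  using assms
proof (induction d arbitrary: p A)
  case 0
  then have "A = 1\<^sub>m 0 * rect_diag 0 p (0\<^sub>v 0) * 1\<^sub>m p" by (intro eq_matI) auto
  moreover have "(0\<^sub>v 0 :: real vec) \<in> carrier_vec 0" by simp
  ultimately show ?case using orth_mat_one[of 0] orth_mat_one[of p] by blast
next
  case (Suc d)
  then obtain q where p: "p = Suc q" and dq: "d \<le> q" by (cases p) auto
  have A: "A \<in> carrier_mat (Suc d) (Suc q)" using Suc p by simp
  from max_bilinear_exists[OF A] obtain u v where
    u: "u \<in> carrier_vec (Suc d)" "u \<bullet> u = 1" and v: "v \<in> carrier_vec (Suc q)" "v \<bullet> v = 1"
    and max: "\<And>x y. x \<in> carrier_vec (Suc d) \<Longrightarrow> y \<in> carrier_vec (Suc q) \<Longrightarrow>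
       x \<bullet> (A *\<^sub>v y) \<le> u \<bullet> (A *\<^sub>v v) * (sqrt (x \<bullet> x) * sqrt (y \<bullet> y))"
    by auto
  define \<sigma> where "\<sigma> = u \<bullet> (A *\<^sub>v v)"
  obtain P where P: "orth_mat (Suc d) P" "P *\<^sub>v unit_vec (Suc d) 0 = u"
    using orth_mat_first_col[OF u] by auto
  obtain Q where Q: "orth_mat (Suc q) Q" "Q *\<^sub>v unit_vec (Suc q) 0 = v"
    using orth_mat_first_col[OF v] by auto
  note Pc = orth_matD(1)[OF P(1)] and Qc = orth_matD(1)[OF Q(1)]
  define C where "C = P\<^sup>T * A * Q"
  have C: "C \<in> carrier_mat (Suc d) (Suc q)" using A Pc Qc by (simp add: C_def)
  have Cmax: "x \<bullet> (C *\<^sub>v y) \<le> \<sigma> * (sqrt (x \<bullet> x) * sqrt (y \<bullet> y))"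
    if x: "x \<in> carrier_vec (Suc d)" and y: "y \<in> carrier_vec (Suc q)" for x y
  proof -
    have "x \<bullet> (C *\<^sub>v y) = (P *\<^sub>v x) \<bullet> (A *\<^sub>v (Q *\<^sub>v y))"
      unfolding C_def by (rule bilinear_mult[OF A Pc Qc x y])
    also have "\<dots> \<le> \<sigma> * (sqrt ((P *\<^sub>v x) \<bullet> (P *\<^sub>v x)) * sqrt ((Q *\<^sub>v y) \<bullet> (Q *\<^sub>v y)))"
      unfolding \<sigma>_def by (rule max) (use Pc Qc x y in auto)
    finally show ?thesis by (simp add: orth_mat_isometry[OF P(1) x x] orth_mat_isometry[OF Q(1) y y])
  qed
  let ?e = "unit_vec (Suc d)" and ?e' = "unit_vec (Suc q)"
  have C00: "C $$ (0,0) = \<sigma>"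
    unfolding unit_bilinear[OF C, of 0 0, simplified, symmetric]
    unfolding C_def bilinear_mult[OF A Pc Qc unit_vec_carrier unit_vec_carrier] by (simp add: P Q \<sigma>_def)
  \<comment> \<open>Maximality tested at the pair - e_0, e_0 reads - \<sigma> <= \<sigma>.\<close>
  have \<sigma>: "0 \<le> \<sigma>"
  proof -
    have "(- ?e 0) \<bullet> (C *\<^sub>v ?e' 0) \<le> \<sigma> * (sqrt ((- ?e 0) \<bullet> (- ?e 0)) * sqrt (?e' 0 \<bullet> ?e' 0))"
      by (rule Cmax) auto
    then show ?thesis using C unit_bilinear[OF C, of 0 0] by (simp add: C00)
  qed
  have row0: "C $$ (0,j) = 0" if j: "0 < j" "j < Suc q" for j
  proof -
    let ?c = "C $$ (0,j)" and ?y = "\<sigma> \<cdot>\<^sub>v ?e' 0 + C $$ (0,j) \<cdot>\<^sub>v ?e' j"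
    have r: "row C 0 \<in> carrier_vec (Suc q)" by (rule row_carrier_vec[OF _ C]) simp
    have "?e 0 \<bullet> (C *\<^sub>v ?y) = row C 0 \<bullet> ?y"
      using C j by (simp add: scalar_prod_left_unit[of _ "Suc d"])
    also have "\<dots> = \<sigma> * (row C 0 \<bullet> ?e' 0) + ?c * (row C 0 \<bullet> ?e' j)"
      using r by (simp add: scalar_prod_add_distrib[OF r])
    also have "\<dots> = \<sigma>\<^sup>2 + ?c\<^sup>2"
      using C j by (simp add: scalar_prod_right_unit C00 power2_eq_square)
    finally have "?e 0 \<bullet> (C *\<^sub>v ?y) = \<sigma>\<^sup>2 + ?c\<^sup>2" .
    moreover have "?y \<bullet> ?y = \<sigma>\<^sup>2 + ?c\<^sup>2"
      using j by (simp add: scalar_prod_add_distrib[of _ "Suc q"] add_scalar_prod_distrib[of _ "Suc q"] power2_eq_square)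
    ultimately show ?thesis using Cmax[of "?e 0" ?y] by (intro eq_zero_of_norm_bound[of \<sigma>]) simp
  qed
  have col0: "C $$ (i,0) = 0" if i: "0 < i" "i < Suc d" for i
  proof -
    let ?c = "C $$ (i,0)" and ?x = "\<sigma> \<cdot>\<^sub>v ?e 0 + C $$ (i,0) \<cdot>\<^sub>v ?e i"
    have r: "C *\<^sub>v ?e' 0 \<in> carrier_vec (Suc d)" using C by auto
    have "?x \<bullet> (C *\<^sub>v ?e' 0) = \<sigma> * (?e 0 \<bullet> (C *\<^sub>v ?e' 0)) + ?c * (?e i \<bullet> (C *\<^sub>v ?e' 0))"
      using r by (simp add: add_scalar_prod_distrib[of _ "Suc d"] smult_scalar_prod_distrib[of _ "Suc d"])
    also have "\<dots> = \<sigma>\<^sup>2 + ?c\<^sup>2"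
      using unit_bilinear[OF C, of 0 0] unit_bilinear[OF C, of i 0] i by (simp add: C00 power2_eq_square)
    finally have "?x \<bullet> (C *\<^sub>v ?e' 0) = \<sigma>\<^sup>2 + ?c\<^sup>2" .
    moreover have "?x \<bullet> ?x = \<sigma>\<^sup>2 + ?c\<^sup>2"
      using i by (simp add: scalar_prod_add_distrib[of _ "Suc d"] add_scalar_prod_distrib[of _ "Suc d"] power2_eq_square)
    ultimately show ?thesis using Cmax[of ?x "?e' 0"] by (intro eq_zero_of_norm_bound[of \<sigma>]) simp
  qed
  define B where "B = mat d q (\<lambda>(i,j). C $$ (Suc i, Suc j))"
  have B: "B \<in> carrier_mat d q" by (simp add: B_def)
  let ?s1 = "mat 1 1 (\<lambda>_. \<sigma>)"
  have CB: "C = four_block_mat ?s1 (0\<^sub>m 1 q) (0\<^sub>m d 1) B"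
  proof (rule eq_matI)
    fix i j assume "i < dim_row (four_block_mat ?s1 (0\<^sub>m 1 q) (0\<^sub>m d 1) B)" "j < dim_col (four_block_mat ?s1 (0\<^sub>m 1 q) (0\<^sub>m d 1) B)"
    then have "i < Suc d" "j < Suc q" by (auto simp: B_def)
    then show "C $$ (i,j) = four_block_mat ?s1 (0\<^sub>m 1 q) (0\<^sub>m d 1) B $$ (i,j)"
      using row0 col0 C00 by (cases i; cases j) (auto simp: B_def)
  qed (use C in \<open>auto simp: B_def\<close>)
  from Suc.IH[OF B dq] obtain s2 U2 V2 where s2: "s2 \<in> carrier_vec d" "\<And>i. i < d \<Longrightarrow> 0 \<le> s2 $ i"
    "\<And>i j. i \<le> j \<Longrightarrow> j < d \<Longrightarrow> s2 $ j \<le> s2 $ i"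
    and U2: "orth_mat d U2" and V2: "orth_mat q V2" and Beq: "B = U2 * rect_diag d q s2 * V2"
    by blast
  define s where "s = vCons \<sigma> s2"
  let ?D = "rect_diag d q s2" and ?R = "rect_diag (Suc d) (Suc q) s"
  have R: "?R = four_block_mat ?s1 (0\<^sub>m 1 q) (0\<^sub>m d 1) ?D"
  proof (rule eq_matI)
    fix i j assume "i < dim_row (four_block_mat ?s1 (0\<^sub>m 1 q) (0\<^sub>m d 1) ?D)" "j < dim_col (four_block_mat ?s1 (0\<^sub>m 1 q) (0\<^sub>m d 1) ?D)"
    then have "i < Suc d" "j < Suc q" by (auto simp: rect_diag_def)
    then show "?R $$ (i,j) = four_block_mat ?s1 (0\<^sub>m 1 q) (0\<^sub>m d 1) ?D $$ (i,j)"
      by (cases i; cases j) (auto simp: rect_diag_def s_def)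
  qed (auto simp: rect_diag_def)
  define U1 where "U1 = four_block_mat (1\<^sub>m 1) (0\<^sub>m 1 d) (0\<^sub>m d 1) U2"
  define V1 where "V1 = four_block_mat (1\<^sub>m 1) (0\<^sub>m 1 q) (0\<^sub>m q 1) V2"
  have U1: "orth_mat (Suc d) U1" and V1: "orth_mat (Suc q) V1"
    using orth_mat_block[OF U2, of 1] orth_mat_block[OF V2, of 1] by (simp_all add: U1_def V1_def)
  note U1c = orth_matD(1)[OF U1] and V1c = orth_matD(1)[OF V1]
  note U2c = orth_matD(1)[OF U2] and V2c = orth_matD(1)[OF V2]
  have D: "?D \<in> carrier_mat d q" by simp
  have z: "0\<^sub>m (Suc 0) d * ?D = 0\<^sub>m (Suc 0) q" "0\<^sub>m (Suc 0) q * V2 = 0\<^sub>m (Suc 0) q"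
    by (rule left_mult_zero_mat, rule D V2c)+
  have UD: "U2 * ?D \<in> carrier_mat d q" by (rule mult_carrier_mat[OF U2c D])
  have z': "U2 * ?D * 0\<^sub>m q (Suc 0) = 0\<^sub>m d (Suc 0)" "0\<^sub>m d q + U2 * ?D * V2 = U2 * ?D * V2"
    by (rule right_mult_zero_mat[OF UD], rule left_add_zero_mat[OF mult_carrier_mat[OF UD V2c]])
  have "U1 * ?R = four_block_mat ?s1 (0\<^sub>m 1 q) (0\<^sub>m d 1) (U2 * ?D)"
    unfolding U1_def R
    by (subst mult_four_block_mat[of _ 1 1 _ d _ d _ _ 1 _ q]) (use U2c D z in auto)
  then have CR: "U1 * ?R * V1 = C"
    unfolding CB Beq V1_def
    by (simp, subst mult_four_block_mat[of _ 1 1 _ q _ d _ _ 1 _ q]) (use U2c V2c D z z' in auto)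
  have Aeq: "A = (P * U1) * ?R * (V1 * Q\<^sup>T)"
  proof -
    have "A = P * C * Q\<^sup>T" unfolding C_def by (rule orth_cancel'[OF P(1) Q(1) A, symmetric])
    also have "\<dots> = P * (U1 * ?R * V1) * Q\<^sup>T" by (simp only: CR)
    also have "\<dots> = (P * U1) * ?R * (V1 * Q\<^sup>T)"
    proof -
      have c: "?R \<in> carrier_mat (Suc d) (Suc q)" "Q\<^sup>T \<in> carrier_mat (Suc q) (Suc q)"
        "U1 * ?R \<in> carrier_mat (Suc d) (Suc q)" "P * (U1 * ?R) \<in> carrier_mat (Suc d) (Suc q)"
        using U1c Qc Pc by auto
      have "P * (U1 * ?R * V1) * Q\<^sup>T = (P * (U1 * ?R)) * V1 * Q\<^sup>T"
        by (simp only: assoc_mult_mat[OF Pc c(3) V1c])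
      also have "\<dots> = (P * (U1 * ?R)) * (V1 * Q\<^sup>T)" by (rule assoc_mult_mat[OF c(4) V1c c(2)])
      also have "P * (U1 * ?R) = (P * U1) * ?R" by (rule assoc_mult_mat[OF Pc U1c c(1), symmetric])
      finally show ?thesis .
    qed
    finally show ?thesis .
  qed
  \<comment> \<open>This gives the descending order: each later singular value is a value of the
    form at two unit vectors, hence at most the maximum \<sigma>.\<close>
  have le: "s2 $ k \<le> \<sigma>" if k: "k < d" for k
  proof -
    have k': "Suc k < Suc d" "Suc k < Suc q" using k dq by auto
    have "s2 $ k = ?R $$ (Suc k, Suc k)" using k dq by (simp add: rect_diag_def s_def)
    also have "?R = U1\<^sup>T * C * V1\<^sup>T"
      unfolding CR[symmetric] by (rule orth_cancel[OF U1 V1 rect_diag_carrier, symmetric])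
    also have "\<dots> $$ (Suc k, Suc k) = ?e (Suc k) \<bullet> ((U1\<^sup>T * C * V1\<^sup>T) *\<^sub>v ?e' (Suc k))"
      by (rule unit_bilinear[OF _ k', symmetric]) (use C U1c V1c in auto)
    also have "\<dots> = (U1 *\<^sub>v ?e (Suc k)) \<bullet> (C *\<^sub>v (V1\<^sup>T *\<^sub>v ?e' (Suc k)))"
      by (rule bilinear_mult[OF C U1c]) (use V1c in auto)
    also have "\<dots> \<le> \<sigma> * (sqrt ((U1 *\<^sub>v ?e (Suc k)) \<bullet> (U1 *\<^sub>v ?e (Suc k)))
        * sqrt ((V1\<^sup>T *\<^sub>v ?e' (Suc k)) \<bullet> (V1\<^sup>T *\<^sub>v ?e' (Suc k))))"
      by (rule Cmax) (use U1c V1c in auto)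
    also have "\<dots> = \<sigma>"
      using k' by (simp add: orth_mat_isometry[OF U1 unit_vec_carrier unit_vec_carrier]
        orth_mat_isometry[OF orth_mat_transpose[OF V1] unit_vec_carrier unit_vec_carrier])
    finally show ?thesis .
  qed
  have "s \<in> carrier_vec (Suc d)" using s2 by (simp add: s_def)
  moreover have "\<forall>i<Suc d. 0 \<le> s $ i" using s2 \<sigma> by (auto simp: s_def vec_index_vCons)
  moreover have "\<forall>i j. i \<le> j \<and> j < Suc d \<longrightarrow> s $ j \<le> s $ i"
  proof (intro allI impI)
    fix i j assume "i \<le> j \<and> j < Suc d"
    then show "s $ j \<le> s $ i" using s2(3)[of "i - 1" "j - 1"] le[of "j - 1"] \<sigma>
      by (cases i; cases j) (auto simp: s_def)
  qed
  moreover have "orth_mat (Suc d) (P * U1)" "orth_mat (Suc q) (V1 * Q\<^sup>T)"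
    using orth_mat_mult P U1 V1 orth_mat_transpose[OF Q(1)] by auto
  ultimately show ?case using Aeq unfolding p by blast
qed

section \<open>Uniqueness of singular values and pinching\<close>

lemma (in vec_space) card_indpt_le_rank:
  assumes A: "A \<in> carrier_mat n nc" and S: "S \<subseteq> col_space A" "lin_indpt S"
  shows "card S \<le> rank A"
proof -
  let ?W = "span (set (cols A))"
  have c: "set (cols A) \<subseteq> carrier_vec n" using cols_dim A by blast
  have vs: "vectorspace class_ring (vs ?W)"
    by (rule subspace_is_vs, rule span_is_subspace) (use c in simp)
  have sub: "submodule class_ring ?W V" by (rule span_is_submodule) (use c in simp)
  have SW: "S \<subseteq> ?W" using S by (simp add: col_space_def)
  have "LinearCombinations.module.lin_indpt class_ring (vs ?W) S"
    using span_li_not_depend(2)[OF SW sub] S(2) by simp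
  then have "card S \<le> vectorspace.dim class_ring (vs ?W)"
    using vectorspace.li_le_dim(2)[OF vs fin_dim_span_cols[OF A], of S] SW by simp
  then show ?thesis by (simp add: rank_def)
qed

lemma orth_mat_cols_indpt:
  assumes "orth_mat n U"
  shows "distinct (cols U)" "module.lin_indpt class_ring (module_vec TYPE(real) n) (set (cols U))"
proof -
  interpret vec_space "TYPE(real)" n .
  note U = orth_matD[OF assms]
  have "det U\<^sup>T * det U = 1" using det_mult[of "U\<^sup>T" n U] U by simp
  then have "det U \<noteq> 0" by auto
  then have r: "rank U = n" using det_rank_iff[OF U(1)] by simp
  show d: "distinct (cols U)" using non_distinct_low_rank[OF U(1)] r by auto
  show "lin_indpt (set (cols U))" by (rule full_rank_lin_indpt[OF U(1) r d])
qed

text \<open>Write A for the product. If the entry at \<open>i\<close> were positive, so would be all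
  earlier ones by the ordering, and U e_j = A (V^T e_j / s_j) would put the first i + 1 columns of U
  into the column space of A. They are independent, so the rank would be at least i + 1.\<close>

lemma rank_singular_values_zero:
  assumes U: "orth_mat d U" and V: "orth_mat p V" and dp: "d \<le> p"
    and s: "\<And>i. i < d \<Longrightarrow> 0 \<le> s $ i" "\<And>i j. i \<le> j \<Longrightarrow> j < d \<Longrightarrow> s $ j \<le> s $ i"
    and i: "vec_space.rank d (U * rect_diag d p s * V) \<le> i" "i < d"
  shows "s $ i = 0"
proof (rule ccontr)
  assume "s $ i \<noteq> 0"
  then have pos: "0 < s $ j" if "j \<le> i" for j
    using s(1)[OF i(2)] s(2)[OF that i(2)] by linarith
  interpret vec_space "TYPE(real)" d .
  let ?R = "rect_diag d p s" and ?A = "U * rect_diag d p s * V"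
  note u = orth_matD[OF U] and v = orth_matD[OF V]
  have UR: "U * ?R \<in> carrier_mat d p" by (rule mult_carrier_mat[OF u(1) rect_diag_carrier])
  have A: "?A \<in> carrier_mat d p" by (rule mult_carrier_mat[OF UR v(1)])
  define S where "S = set (take (Suc i) (cols U))"
  have len: "length (cols U) = d" using u by simp
  have "card S = Suc i"
    unfolding S_def using orth_mat_cols_indpt(1)[OF U] i(2) len by (simp add: distinct_card)
  moreover have "lin_indpt S"
  proof (rule subset_li_is_li)
    show "lin_indpt (set (cols U))" by (rule orth_mat_cols_indpt(2)[OF U])
    show "S \<subseteq> set (cols U)" unfolding S_def by (rule set_take_subset)
  qed
  moreover have "S \<subseteq> col_space ?A"
  proof
    fix w assume "w \<in> S"
    then obtain j where "j < Suc i" "j < dim_col U" and wj: "w = col U j"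
      unfolding S_def by (auto simp: in_set_conv_nth)
    then have j: "j \<le> i" and jd: "j < d" "j < p" using u(1) dp by auto
    have w: "w = U *\<^sub>v unit_vec d j"
      unfolding wj using jd u(1) by (intro eq_vecI) (auto simp: scalar_prod_right_unit)
    define z where "z = (1 / s $ j) \<cdot>\<^sub>v unit_vec p j"
    have z: "z \<in> carrier_vec p" by (simp add: z_def)
    have Rz: "?R *\<^sub>v z = unit_vec d j"
      using pos[OF j] jd
      by (intro eq_vecI) (auto simp: z_def rect_diag_def scalar_prod_right_unit row_def)
    have VV: "V *\<^sub>v (V\<^sup>T *\<^sub>v z) = z"
      using assoc_mult_mat_vec[of V p p "V\<^sup>T" p z] v z by simp
    have "?A *\<^sub>v (V\<^sup>T *\<^sub>v z) = (U * ?R) *\<^sub>v (V *\<^sub>v (V\<^sup>T *\<^sub>v z))"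
      by (rule assoc_mult_mat_vec[OF UR v(1)]) (use v z in simp)
    also have "\<dots> = U *\<^sub>v (?R *\<^sub>v z)"
      unfolding VV by (rule assoc_mult_mat_vec[OF u(1) rect_diag_carrier z])
    finally have "?A *\<^sub>v (V\<^sup>T *\<^sub>v z) = w" by (simp add: Rz w)
    moreover have "V\<^sup>T *\<^sub>v z \<in> carrier_vec p" using v z by simp
    moreover have "w \<in> carrier_vec d" unfolding w using u by simp
    ultimately show "w \<in> col_space ?A"
      unfolding col_space_eq[OF A] carrier_matD[OF A] by blast
  qed
  ultimately have "Suc i \<le> rank ?A" using card_indpt_le_rank[OF A] by metis
  with i show False by simp
qed

section \<open>Uniqueness of singular values through the Gram matrix\<close>

lemma rect_diag_gram:
  assumes "d \<le> p"
  shows "rect_diag d p s * (rect_diag d p s)\<^sup>T = mat d d (\<lambda>(i,j). if i = j then (s $ i)\<^sup>2 else 0)"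
proof (rule eq_matI)
  fix i j assume "i < dim_row (mat d d (\<lambda>(i,j). if i = j then (s $ i)\<^sup>2 else 0))"
    "j < dim_col (mat d d (\<lambda>(i,j). if i = j then (s $ i)\<^sup>2 else 0))"
  then have ij: "i < d" "j < d" "i < p" "j < p" using assms by auto
  have "(rect_diag d p s * (rect_diag d p s)\<^sup>T) $$ (i,j)
     = (\<Sum>k<p. (if i = k then s $ i else 0) * (if j = k then s $ j else 0))"
    using ij by (simp add: rect_diag_def scalar_prod_def atLeast0LessThan)
  also have "\<dots> = (\<Sum>k<p. if i = k then (if i = j then (s $ i)\<^sup>2 else 0) else 0)"
    by (intro sum.cong) (auto simp: power2_eq_square)
  finally show "(rect_diag d p s * (rect_diag d p s)\<^sup>T) $$ (i,j)
     = mat d d (\<lambda>(i,j). if i = j then (s $ i)\<^sup>2 else 0) $$ (i,j)"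
    using ij by simp
qed (auto simp: rect_diag_def)

lemma proots_linear_factors:
  "proots (\<Prod>a\<leftarrow>xs. [:- a, 1 :: real:]) = mset xs"
proof (induction xs)
  case (Cons a xs)
  have "(\<Prod>a\<leftarrow>xs. [:- a, 1 :: real:]) \<noteq> 0" by (auto simp: prod_list_zero_iff)
  then show ?case using Cons by (simp add: proots_mult del: mult_pCons_left)
qed simp

text \<open>The two diagonal Gram matrices are similar through \<open>U\<close>, as V V^T cancels,
  so their characteristic polynomials have the same roots with multiplicity. The Gram matrix sees
  squares, which suits a \<open>y\<close> with negative or unordered entries.\<close>

lemma singular_values_unique:
  assumes U: "orth_mat d U" and V: "orth_mat p V" and dp: "d \<le> p"
    and eq: "rect_diag d p y = U * rect_diag d p s * V"
  shows "\<exists>\<pi>. \<pi> permutes {..<d} \<and> (\<forall>i<d. (s $ \<pi> i)\<^sup>2 = (y $ i)\<^sup>2)"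
proof -
  let ?Ry = "rect_diag d p y" and ?Rs = "rect_diag d p s"
  let ?D = "\<lambda>s. mat d d (\<lambda>(i,j). if i = j then (s $ i)\<^sup>2 else 0) :: real mat"
  note u = orth_matD[OF U] and v = orth_matD[OF V]
  define X where "X = U * ?Rs"
  have X: "X \<in> carrier_mat d p" unfolding X_def by (rule mult_carrier_mat[OF u(1) rect_diag_carrier])
  have XT: "X\<^sup>T \<in> carrier_mat p d" "V\<^sup>T \<in> carrier_mat p p" "U\<^sup>T \<in> carrier_mat d d" "?Rs\<^sup>T \<in> carrier_mat p d"
    using X v u by auto
  have "?D y = ?Ry * ?Ry\<^sup>T" by (rule rect_diag_gram[OF dp, symmetric])
  also have "\<dots> = (X * V) * (X * V)\<^sup>T" by (simp only: eq X_def)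
  also have "\<dots> = (X * V) * (V\<^sup>T * X\<^sup>T)" by (simp only: transpose_mult[OF X v(1)])
  also have "\<dots> = X * (V * (V\<^sup>T * X\<^sup>T))"
    by (rule assoc_mult_mat[OF X v(1) mult_carrier_mat[OF XT(2,1)]])
  also have "V * (V\<^sup>T * X\<^sup>T) = X\<^sup>T"
    using assoc_mult_mat[OF v(1) XT(2,1)] left_mult_one_mat[OF XT(1)] by (simp only: v(3))
  also have "X * X\<^sup>T = U * ?Rs * (?Rs\<^sup>T * U\<^sup>T)"
    unfolding X_def by (simp only: transpose_mult[OF u(1) rect_diag_carrier])
  also have "\<dots> = U * (?Rs * (?Rs\<^sup>T * U\<^sup>T))"
    by (rule assoc_mult_mat[OF u(1) rect_diag_carrier mult_carrier_mat[OF XT(4,3)]])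
  also have "?Rs * (?Rs\<^sup>T * U\<^sup>T) = ?D s * U\<^sup>T"
    by (simp only: assoc_mult_mat[OF rect_diag_carrier XT(4,3), symmetric] rect_diag_gram[OF dp])
  also have "U * (?D s * U\<^sup>T) = U * ?D s * U\<^sup>T"
    by (rule assoc_mult_mat[OF u(1) _ XT(3), symmetric]) simp
  finally have "similar_mat (?D y) (?D s)"
    by (intro similar_matI[of _ _ U "U\<^sup>T" d]) (use u in auto)
  then have cp: "char_poly (?D y) = char_poly (?D s)" by (rule char_poly_similar)
  have ch: "char_poly (?D z) = (\<Prod>a\<leftarrow>map (\<lambda>i. (z $ i)\<^sup>2) [0..<d]. [:- a, 1:])" for z
  proof -
    have "char_poly (?D z) = (\<Prod>a\<leftarrow>diag_mat (?D z). [:- a, 1:])"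
      by (rule char_poly_upper_triangular[of _ d]) (auto simp: upper_triangular_def)
    moreover have "diag_mat (?D z) = map (\<lambda>i. (z $ i)\<^sup>2) [0..<d]"
      by (auto simp: diag_mat_def)
    ultimately show ?thesis by simp
  qed
  have "mset (map (\<lambda>i. (y $ i)\<^sup>2) [0..<d]) = mset (map (\<lambda>i. (s $ i)\<^sup>2) [0..<d])"
    using arg_cong[OF cp, of proots] by (simp only: ch proots_linear_factors)
  then obtain \<pi> where pi: "\<pi> permutes {..<length (map (\<lambda>i. (s $ i)\<^sup>2) [0..<d])}"
    "permute_list \<pi> (map (\<lambda>i. (s $ i)\<^sup>2) [0..<d]) = map (\<lambda>i. (y $ i)\<^sup>2) [0..<d]"
    by (rule mset_eq_permutation)
  have "(s $ \<pi> i)\<^sup>2 = (y $ i)\<^sup>2" if "i < d" for i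
  proof -
    have "\<pi> i < d" using permutes_in_image[OF pi(1), of i] that by simp
    then show ?thesis
      using arg_cong[OF pi(2), of "\<lambda>l. l ! i"] permute_list_nth[OF pi(1), of i] that by simp
  qed
  then show ?thesis using pi(1) by auto
qed

text \<open>\<open>sing_vals\<close> is picked by \<open>SOME\<close>; the existence of a
  decomposition is what endows the choice with its properties.\<close>

lemma sing_vals_svd:
  assumes "A \<in> carrier_mat d p" "d \<le> p"
  shows "sing_vals d p A \<in> carrier_vec d" "\<And>i. i < d \<Longrightarrow> 0 \<le> sing_vals d p A $ i"
    "\<And>i j. i \<le> j \<Longrightarrow> j < d \<Longrightarrow> sing_vals d p A $ j \<le> sing_vals d p A $ i"
    "\<exists>U V. orth_mat d U \<and> orth_mat p V \<and> A = U * rect_diag d p (sing_vals d p A) * V"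
proof -
  let ?P = "\<lambda>s. s \<in> carrier_vec d \<and> (\<forall>i<d. 0 \<le> s $ i) \<and>
      (\<forall>i j. i \<le> j \<and> j < d \<longrightarrow> s $ j \<le> s $ i) \<and>
      (\<exists>U V. orth_mat d U \<and> orth_mat p V \<and> A = U * rect_diag d p s * V)"
  have "\<exists>s. ?P s" using svd_exists[OF assms] by blast
  then have "?P (sing_vals d p A)" unfolding sing_vals_def by (rule someI_ex)
  then show "sing_vals d p A \<in> carrier_vec d" "\<And>i. i < d \<Longrightarrow> 0 \<le> sing_vals d p A $ i"
    "\<And>i j. i \<le> j \<Longrightarrow> j < d \<Longrightarrow> sing_vals d p A $ j \<le> sing_vals d p A $ i"
    "\<exists>U V. orth_mat d U \<and> orth_mat p V \<and> A = U * rect_diag d p (sing_vals d p A) * V"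
    by blast+
qed

lemma symmetric_gauge_abs_permute:
  assumes f: "symmetric_gauge d f" and y: "y \<in> carrier_vec d" and s: "s \<in> carrier_vec d"
    and pi: "\<pi> permutes {..<d}" and eq: "\<And>i. i < d \<Longrightarrow> (s $ \<pi> i)\<^sup>2 = (y $ i)\<^sup>2"
  shows "f y = f s"
proof -
  let ?x = "vec d (\<lambda>i. s $ \<pi> i)"
  define \<epsilon> :: "nat \<Rightarrow> real" where "\<epsilon> i = (if y $ i = s $ \<pi> i then 1 else -1)" for i
  have "y = vec d (\<lambda>i. \<epsilon> i * ?x $ i)"
  proof (rule eq_vecI)
    fix i assume "i < dim_vec (vec d (\<lambda>i. \<epsilon> i * ?x $ i))"
    then have i: "i < d" by simp
    have "y $ i = s $ \<pi> i \<or> y $ i = - s $ \<pi> i" using eq[OF i] by (simp add: power2_eq_iff) auto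
    then show "y $ i = vec d (\<lambda>i. \<epsilon> i * ?x $ i) $ i" using i by (auto simp: \<epsilon>_def)
  qed (use y in simp)
  moreover have "f (vec d (\<lambda>i. \<epsilon> i * ?x $ i)) = f ?x"
    using f unfolding symmetric_gauge_def by (elim conjE ballE[of _ _ ?x]) (auto simp: \<epsilon>_def)
  moreover have "f ?x = f s" using f s pi unfolding symmetric_gauge_def by blast
  ultimately show ?thesis by simp
qed

text \<open>The hypothesis describes \<open>R\<close> through sorted nonnegative singular values,
  whereas pinching yields an arbitrary diagonal \<open>y\<close>. The two differ by a permutation
  and signs, which \<open>f\<close> does not see.\<close>

lemma norm_rect_diag:
  assumes "d \<le> p" and f: "symmetric_gauge d f"
    and R: "\<forall>A\<in>carrier_mat d p. R A = f (sing_vals d p A)" and y: "y \<in> carrier_vec d"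
  shows "R (rect_diag d p y) = f y"
proof -
  let ?s = "sing_vals d p (rect_diag d p y)"
  note sv = sing_vals_svd[OF rect_diag_carrier[of d p y] assms(1)]
  obtain U V where "orth_mat d U" "orth_mat p V" "rect_diag d p y = U * rect_diag d p ?s * V"
    using sv(4) by blast
  then obtain \<pi> where "\<pi> permutes {..<d}" "\<forall>i<d. (?s $ \<pi> i)\<^sup>2 = (y $ i)\<^sup>2"
    using singular_values_unique[OF _ _ assms(1)] by blast
  then have "f y = f ?s" using symmetric_gauge_abs_permute[OF f y sv(1)] by blast
  then show ?thesis using R by simp
qed

definition sign_flip :: "nat \<Rightarrow> nat \<Rightarrow> real mat" where
  "sign_flip n k = mat n n (\<lambda>(i,j). if i = j then if i = k then -1 else 1 else 0)"

lemma sign_flip_carrier [simp]: "sign_flip n k \<in> carrier_mat n n"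
  by (simp add: sign_flip_def)

lemma sign_flip_mult_left:
  assumes "A \<in> carrier_mat n m" "i < n" "j < m"
  shows "(sign_flip n k * A) $$ (i,j) = (if i = k then -1 else 1) * A $$ (i,j)"
proof -
  have "(sign_flip n k * A) $$ (i,j) = (\<Sum>l<n. (if i = l then if i = k then -1 else 1 else 0) * A $$ (l,j))"
    using assms by (simp add: sign_flip_def scalar_prod_def atLeast0LessThan)
  also have "\<dots> = (\<Sum>l<n. if i = l then (if i = k then -1 else 1) * A $$ (i,j) else 0)"
    by (intro sum.cong) auto
  finally show ?thesis using assms by simp
qed

lemma sign_flip_mult_right:
  assumes "A \<in> carrier_mat n m" "i < n" "j < m"
  shows "(A * sign_flip m k) $$ (i,j) = A $$ (i,j) * (if j = k then -1 else 1)"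
proof -
  have "(A * sign_flip m k) $$ (i,j) = (\<Sum>l<m. A $$ (i,l) * (if l = j then if l = k then -1 else 1 else 0))"
    using assms by (simp add: sign_flip_def scalar_prod_def atLeast0LessThan)
  also have "\<dots> = (\<Sum>l<m. if l = j then A $$ (i,j) * (if j = k then -1 else 1) else 0)"
    by (intro sum.cong) auto
  finally show ?thesis using assms by simp
qed

lemma orth_mat_sign_flip: "orth_mat n (sign_flip n k)"
proof -
  have "(sign_flip n k)\<^sup>T = sign_flip n k" by (intro eq_matI) (auto simp: sign_flip_def)
  moreover have "sign_flip n k * sign_flip n k = 1\<^sub>m n"
    by (intro eq_matI) (auto simp: sign_flip_mult_left[OF sign_flip_carrier] simp del: index_mult_mat(1), auto simp: sign_flip_def)
  ultimately show ?thesis by (simp add: orth_mat_def)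
qed

lemma pinching:
  assumes dp: "d \<le> p" and R: "unitarily_invariant d p R" and A: "A \<in> carrier_mat d p"
  shows "R (rect_diag d p (vec d (\<lambda>i. A $$ (i,i)))) \<le> R A"
proof -
  \<comment> \<open>Averaging with the sign flip of row and column \<open>k\<close> clears their off-diagonal entries.\<close>
  define P where "P k = mat d p (\<lambda>(i,j). if i \<noteq> j \<and> (i < k \<or> j < k) then 0 else A $$ (i,j))" for k
  have P: "P k \<in> carrier_mat d p" for k by (simp add: P_def)
  have norm: "R (X + Y) \<le> R X + R Y" "R (c \<cdot>\<^sub>m X) = \<bar>c\<bar> * R X"
    if "X \<in> carrier_mat d p" "Y \<in> carrier_mat d p" for X Y c
    using R that unfolding unitarily_invariant_def is_mat_norm_def by blast+
  have "R (P k) \<le> R A" for k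
  proof (induction k)
    case 0
    have "P 0 = A" using A by (intro eq_matI) (auto simp: P_def)
    then show ?case by simp
  next
    case (Suc k)
    let ?F = "sign_flip d k * P k * sign_flip p k"
    have F: "sign_flip d k * P k \<in> carrier_mat d p" "?F \<in> carrier_mat d p"
      using mult_carrier_mat[OF sign_flip_carrier P] mult_carrier_mat[OF mult_carrier_mat[OF sign_flip_carrier P] sign_flip_carrier]
      by blast+
    have X: "(1/2) \<cdot>\<^sub>m (P k + ?F) \<in> carrier_mat d p"
      by (intro smult_carrier_mat add_carrier_mat F)
    have "P (Suc k) = (1/2) \<cdot>\<^sub>m (P k + ?F)"
    proof (rule eq_matI)
      fix i j assume "i < dim_row ((1/2) \<cdot>\<^sub>m (P k + ?F))" "j < dim_col ((1/2) \<cdot>\<^sub>m (P k + ?F))"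
      then have ij: "i < d" "j < p" by (simp_all only: carrier_matD[OF X])
      have Fe: "?F $$ (i,j) = (if i = k then -1 else 1) * P k $$ (i,j) * (if j = k then -1 else 1)"
        unfolding sign_flip_mult_right[OF F(1) ij] sign_flip_mult_left[OF P ij] by simp
      have "((1/2) \<cdot>\<^sub>m (P k + ?F)) $$ (i,j) = 1/2 * (P k $$ (i,j) + ?F $$ (i,j))"
      proof -
        have "((1/2) \<cdot>\<^sub>m (P k + Y)) $$ (i,j) = 1/2 * (P k $$ (i,j) + Y $$ (i,j))"
          if "Y \<in> carrier_mat d p" for Y
          using that ij P[of k] by simp
        then show ?thesis using F(2) by blast
      qed
      also have "\<dots> = P (Suc k) $$ (i,j)"
        unfolding Fe using ij by (auto simp: P_def less_Suc_eq)
      finally show "P (Suc k) $$ (i,j) = ((1/2) \<cdot>\<^sub>m (P k + ?F)) $$ (i,j)" by simp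
    qed (simp_all only: carrier_matD[OF X] carrier_matD[OF P])
    then have "R (P (Suc k)) = 1/2 * R (P k + ?F)"
      using norm(2)[where X="P k + ?F" and Y="?F" and c="1/2", OF add_carrier_mat[OF F(2)] F(2)] by simp
    also have "\<dots> \<le> 1/2 * (R (P k) + R ?F)" using norm(1)[OF P F(2)] by simp
    also have "R ?F = R (P k)"
      using R orth_mat_sign_flip P unfolding unitarily_invariant_def by blast
    finally show ?case using Suc by simp
  qed
  \<comment> \<open>Index \<open>d\<close> suffices although there are \<open>p\<close> columns:
    every off-diagonal entry has row index below \<open>d\<close>, so it has been cleared.\<close>
  moreover have "P d = rect_diag d p (vec d (\<lambda>i. A $$ (i,i)))"
    by (intro eq_matI) (auto simp: P_def rect_diag_def)
  ultimately show ?thesis by metis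
qed

lemma svd_entry:
  assumes U: "U \<in> carrier_mat m m" and V: "V \<in> carrier_mat n n" and mn: "m \<le> n" and ij: "i < m" "j < n"
  shows "(U * rect_diag m n s * V) $$ (i,j) = (\<Sum>k<m. U $$ (i,k) * s $ k * V $$ (k,j))"
proof -
  have UD: "U * rect_diag m n s \<in> carrier_mat m n" by (rule mult_carrier_mat[OF U rect_diag_carrier])
  have e: "(U * rect_diag m n s) $$ (i,k) = (if k < m then U $$ (i,k) * s $ k else 0)" if "k < n" for k
  proof -
    have "(U * rect_diag m n s) $$ (i,k) = (\<Sum>l<m. U $$ (i,l) * (if l = k then s $ l else 0))"
      using U ij that by (simp add: rect_diag_def scalar_prod_def atLeast0LessThan)
    also have "\<dots> = (\<Sum>l<m. if l = k then U $$ (i,k) * s $ k else 0)" by (intro sum.cong) auto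
    finally show ?thesis by simp
  qed
  have "(X * V) $$ (i,j) = (\<Sum>k<n. X $$ (i,k) * V $$ (k,j))" if "X \<in> carrier_mat m n" for X
    using that V ij by (simp add: scalar_prod_def atLeast0LessThan)
  then have "(U * rect_diag m n s * V) $$ (i,j) = (\<Sum>k<n. (U * rect_diag m n s) $$ (i,k) * V $$ (k,j))"
    using UD by blast
  also have "\<dots> = (\<Sum>k<n. if k \<in> {..<m} then U $$ (i,k) * s $ k * V $$ (k,j) else 0)"
    by (intro sum.cong refl) (auto simp: e)
  also have "\<dots> = (\<Sum>k\<in>{..<n} \<inter> {..<m}. U $$ (i,k) * s $ k * V $$ (k,j))"
    by (rule sum.inter_restrict[symmetric]) simp
  also have "{..<n} \<inter> {..<m} = {..<m}" using mn by auto
  finally show ?thesis .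
qed

section \<open>Gaussian integration by parts\<close>

lemma std_normal_integrable_iff:
  fixes f :: "real \<Rightarrow> real"
  assumes "f \<in> borel_measurable borel"
  shows "integrable std_normal_distribution f \<longleftrightarrow> integrable lborel (\<lambda>x. std_normal_density x * f x)"
  using assms by (subst integrable_real_density) auto

text \<open>Stein's identity. The density n satisfies n' = - x n, so the difference of the two
  integrands, weighted by n, is the derivative of n \<psi> up to sign. It integrates to zero because
  a bounded \<psi>' forces linear growth of \<psi>, which the Gaussian tail kills at both
  ends.\<close>

lemma std_normal_integral_by_parts:
  fixes \<psi> \<psi>' :: "real \<Rightarrow> real"
  assumes D: "\<And>x. (\<psi> has_real_derivative \<psi>' x) (at x)"
    and cont: "\<And>x. isCont \<psi>' x"
    and bd: "\<And>x. \<bar>\<psi>' x\<bar> \<le> C"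
  shows "(\<integral>x. x * \<psi> x \<partial>std_normal_distribution) = (\<integral>x. \<psi>' x \<partial>std_normal_distribution)"
proof -
  have C: "0 \<le> C" using bd[of 0] by linarith
  have lin: "\<bar>\<psi> x\<bar> \<le> \<bar>\<psi> 0\<bar> + C * \<bar>x\<bar>" for x
  proof -
    have "norm (\<psi> x - \<psi> 0) \<le> C * norm (x - 0)"
      by (rule field_differentiable_bound[of UNIV \<psi> \<psi>']) (use D bd in \<open>auto intro: DERIV_subset\<close>)
    then show ?thesis by simp
  qed
  have contpsi: "continuous_on UNIV \<psi>" "continuous_on UNIV \<psi>'"
    using D cont by (auto intro: continuous_at_imp_continuous_on DERIV_isCont)
  have [measurable]: "\<psi> \<in> borel_measurable borel" "\<psi>' \<in> borel_measurable borel"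
    using contpsi by (auto intro: borel_measurable_continuous_onI)
  let ?n = std_normal_density
  have nn: "?n x \<ge> 0" for x by simp
  have int1: "integrable lborel (\<lambda>x. ?n x * (x * \<psi> x))"
  proof (rule Bochner_Integration.integrable_bound)
    show "integrable lborel (\<lambda>x. \<bar>\<psi> 0\<bar> * (?n x * \<bar>x\<bar>^1) + C * (?n x * x^2))"
      using integrable_std_normal_moment_abs[of 1] integrable_std_normal_moment[of 2] by auto
    show "AE x in lborel. norm (?n x * (x * \<psi> x)) \<le> norm (\<bar>\<psi> 0\<bar> * (?n x * \<bar>x\<bar>^1) + C * (?n x * x\<^sup>2))"
    proof (rule AE_I2)
      fix x
      have "norm (?n x * (x * \<psi> x)) = ?n x * (\<bar>x\<bar> * \<bar>\<psi> x\<bar>)" by (simp add: abs_mult)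
      also have "\<dots> \<le> ?n x * (\<bar>x\<bar> * (\<bar>\<psi> 0\<bar> + C * \<bar>x\<bar>))"
        using lin by (intro mult_left_mono) auto
      also have "\<dots> = \<bar>\<psi> 0\<bar> * (?n x * \<bar>x\<bar>^1) + C * (?n x * x\<^sup>2)"
        by (simp add: algebra_simps power2_eq_square)
      finally show "norm (?n x * (x * \<psi> x)) \<le> norm (\<bar>\<psi> 0\<bar> * (?n x * \<bar>x\<bar>^1) + C * (?n x * x\<^sup>2))"
        by (simp add: abs_le_iff)
    qed
  qed measurable
  have int2: "integrable lborel (\<lambda>x. ?n x * \<psi>' x)"
  proof (rule Bochner_Integration.integrable_bound)
    show "integrable lborel (\<lambda>x. C * (?n x * x^0))"
      using integrable_std_normal_moment[of 0] by auto
    show "AE x in lborel. norm (?n x * \<psi>' x) \<le> norm (C * (?n x * x^0))"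
    proof (rule AE_I2)
      fix x
      have "norm (?n x * \<psi>' x) = ?n x * \<bar>\<psi>' x\<bar>" by (simp add: abs_mult)
      also have "\<dots> \<le> ?n x * C" using bd by (intro mult_left_mono) auto
      finally show "norm (?n x * \<psi>' x) \<le> norm (C * (?n x * x^0))"
        using C by (simp add: mult.commute abs_mult)
    qed
  qed measurable
  let ?F = "\<lambda>x. ?n x * \<psi> x"
  let ?f = "\<lambda>x. ?n x * \<psi>' x - ?n x * (x * \<psi> x)"
  have Dn: "(?n has_real_derivative - x * ?n x) (at x)" for x
    unfolding std_normal_density_def
    by (auto intro!: derivative_eq_intros simp: field_simps)
  have DF: "(?F has_real_derivative ?f x) (at x)" for x
    using DERIV_mult[OF Dn D, of x] by (simp add: algebra_simps)
  have contf: "isCont ?f x" for x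
  proof -
    have "isCont ?n x" using Dn DERIV_isCont by blast
    moreover have "isCont \<psi> x" using D DERIV_isCont by blast
    ultimately show ?thesis using cont by (intro continuous_intros) auto
  qed
  have bound: "\<bar>?F x\<bar> \<le> ?n x * (\<bar>\<psi> 0\<bar> + C * \<bar>x\<bar>)" for x
    using lin by (simp add: abs_mult mult_left_mono)
  have top: "(?F \<longlongrightarrow> 0) at_top"
  proof (rule Lim_null_comparison)
    show "((\<lambda>x. ?n x * (\<bar>\<psi> 0\<bar> + C * \<bar>x\<bar>)) \<longlongrightarrow> 0) at_top"
      unfolding std_normal_density_def by real_asymp
  qed (use bound in auto)
  have bot: "(?F \<longlongrightarrow> 0) at_bot"
  proof (rule Lim_null_comparison)
    show "((\<lambda>x. ?n x * (\<bar>\<psi> 0\<bar> + C * \<bar>x\<bar>)) \<longlongrightarrow> 0) at_bot"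
      unfolding std_normal_density_def by real_asymp
  qed (use bound in auto)
  have "(LBINT x=-\<infinity>..\<infinity>. ?f x) = 0 - 0"
  proof (rule interval_integral_FTC_integrable[where F="?F"])
    show "set_integrable lborel (einterval (-\<infinity>) \<infinity>) ?f"
      using int1 int2 by (simp add: set_integrable_def)
    show "((?F \<circ> real_of_ereal) \<longlongrightarrow> 0) (at_right (-\<infinity>))"
      using bot by (simp add: at_right_MInf filterlim_filtermap o_def tendsto_def eventually_filtermap)
    show "((?F \<circ> real_of_ereal) \<longlongrightarrow> 0) (at_left \<infinity>)"
      using top by (simp add: at_left_PInf tendsto_def eventually_filtermap)
  qed (use DF contf in \<open>auto simp: has_real_derivative_iff_has_vector_derivative[symmetric]\<close>)
  then have "(\<integral>x. ?f x \<partial>lborel) = 0"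
    by (simp add: interval_lebesgue_integral_def set_lebesgue_integral_def)
  then have "(\<integral>x. ?n x * \<psi>' x \<partial>lborel) = (\<integral>x. ?n x * (x * \<psi> x) \<partial>lborel)"
    using int1 int2 by simp
  moreover have "(\<integral>x. x * \<psi> x \<partial>std_normal_distribution) = (\<integral>x. ?n x * (x * \<psi> x) \<partial>lborel)"
    by (intro integral_real_density) auto
  moreover have "(\<integral>x. \<psi>' x \<partial>std_normal_distribution) = (\<integral>x. ?n x * \<psi>' x \<partial>lborel)"
    by (intro integral_real_density) auto
  ultimately show ?thesis by simp
qed

text \<open>The index set is arbitrary rather than a rectangle, so that further independent
  coordinates can be adjoined in a comparison; \<open>gauss_mat\<close> is the case of a
  rectangle.\<close>

definition gaussian :: "'i set \<Rightarrow> ('i \<Rightarrow> real) measure" where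
  "gaussian K = PiM K (\<lambda>_. std_normal_distribution)"

interpretation gaussian: product_prob_space "\<lambda>_. std_normal_distribution" I for I
proof -
  interpret prob_space std_normal_distribution by (rule prob_space_normal_density) simp
  show "product_prob_space (\<lambda>_. std_normal_distribution)"
    by unfold_locales
qed

lemma prob_space_gaussian: "prob_space (gaussian K)"
  unfolding gaussian_def by (intro prob_space_PiM prob_space_normal_density) simp

lemma measurable_gaussian_component [measurable]:
  "k \<in> K \<Longrightarrow> (\<lambda>g. g k) \<in> borel_measurable (gaussian K)"
  unfolding gaussian_def by measurable

lemma gaussian_integral_component:
  fixes h :: "real \<Rightarrow> real"
  assumes "finite K" "k \<in> K" "h \<in> borel_measurable borel"
  shows "(\<integral>g. h (g k) \<partial>gaussian K) = (\<integral>x. h x \<partial>std_normal_distribution)"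
    and "integrable (gaussian K) (\<lambda>g. h (g k)) \<longleftrightarrow> integrable std_normal_distribution h"
proof -
  have d: "distr (gaussian K) std_normal_distribution (\<lambda>g. g k) = std_normal_distribution"
    using gaussian.PiM_component[OF assms(2)] by (simp add: gaussian_def)
  show "(\<integral>g. h (g k) \<partial>gaussian K) = (\<integral>x. h x \<partial>std_normal_distribution)"
    using assms by (subst d[symmetric], subst integral_distr) auto
  show "integrable (gaussian K) (\<lambda>g. h (g k)) \<longleftrightarrow> integrable std_normal_distribution h"
    using integrable_distr_eq[of "\<lambda>g. g k" "gaussian K" std_normal_distribution h] assms d by simp
qed

lemma gaussian_square_integrable:
  assumes "finite K" "k \<in> K"
  shows "integrable (gaussian K) (\<lambda>g. (g k)\<^sup>2)"
  using assms
  by (subst gaussian_integral_component(2)[of K k "\<lambda>x. x\<^sup>2"])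
     (auto simp: std_normal_integrable_iff integrable_std_normal_moment)

text \<open>Fubini isolates the coordinate \<open>k\<close>, and the one-dimensional identity
  applies on each line \<open>x(k := y)\<close>; \<open>F'\<close> is therefore the partial
  derivative in that one direction.\<close>

lemma gaussian_integral_by_parts:
  fixes F F' :: "('i \<Rightarrow> real) \<Rightarrow> real"
  assumes K: "finite K" "k \<in> K"
    and D: "\<And>x y. ((\<lambda>y. F (x(k := y))) has_real_derivative F' (x(k := y))) (at y)"
    and cont: "\<And>x y. isCont (\<lambda>y. F' (x(k := y))) y"
    and bd: "\<And>x. \<bar>F' x\<bar> \<le> C"
    and meas: "F' \<in> borel_measurable (gaussian K)"
    and int: "integrable (gaussian K) (\<lambda>g. g k * F g)"
  shows "(\<integral>g. g k * F g \<partial>gaussian K) = (\<integral>g. F' g \<partial>gaussian K)"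
proof -
  interpret prob_space "gaussian K" by (rule prob_space_gaussian)
  have int': "integrable (gaussian K) F'"
    by (rule integrable_const_bound[of _ C]) (simp_all add: bd meas)
  obtain I where I: "K = insert k I" "k \<notin> I" "finite I"
    using K by (metis finite_insert mk_disjoint_insert)
  have "(\<integral>g. g k * F g \<partial>gaussian K)
      = (\<integral>x. (\<integral>y. y * F (x(k := y)) \<partial>std_normal_distribution) \<partial>gaussian I)"
    using gaussian.product_integral_insert[OF I(3) I(2), of "\<lambda>g. g k * F g"] int
    by (simp add: gaussian_def I(1))
  also have "\<dots> = (\<integral>x. (\<integral>y. F' (x(k := y)) \<partial>std_normal_distribution) \<partial>gaussian I)"
    by (intro Bochner_Integration.integral_cong refl std_normal_integral_by_parts[where C=C] D cont bd)
  also have "\<dots> = (\<integral>g. F' g \<partial>gaussian K)"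
    using gaussian.product_integral_insert[OF I(3) I(2), of F'] int'
    by (simp add: gaussian_def I(1))
  finally show ?thesis .
qed

text \<open>By the mean value inequality the bound \<open>w\<close> on the derivative also bounds
  the difference quotients, so dominated convergence applies along every sequence tending to
  \<open>t0\<close>.\<close>

lemma has_real_derivative_integral:
  fixes f f' :: "real \<Rightarrow> 'a \<Rightarrow> real"
  assumes int: "\<And>t. integrable M (f t)"
    and D: "\<And>t x. ((\<lambda>t. f t x) has_real_derivative f' t x) (at t)"
    and bd: "\<And>t x. \<bar>f' t x\<bar> \<le> w x"
    and w: "integrable M w"
    and meas: "f' t0 \<in> borel_measurable M"
  shows "((\<lambda>t. \<integral>x. f t x \<partial>M) has_real_derivative (\<integral>x. f' t0 x \<partial>M)) (at t0)"
  unfolding has_field_derivative_iff tendsto_at_iff_sequentially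
proof (intro allI impI)
  fix X :: "nat \<Rightarrow> real" assume X: "\<forall>i. X i \<in> UNIV - {t0}" "X \<longlonglongrightarrow> t0"
  have "(\<lambda>i. \<integral>x. (f (X i) x - f t0 x) / (X i - t0) \<partial>M) \<longlonglongrightarrow> (\<integral>x. f' t0 x \<partial>M)"
  proof (rule integral_dominated_convergence[where w=w])
    show "\<And>i. (\<lambda>x. (f (X i) x - f t0 x) / (X i - t0)) \<in> borel_measurable M"
      using int[THEN borel_measurable_integrable] by measurable
    show "AE x in M. (\<lambda>i. (f (X i) x - f t0 x) / (X i - t0)) \<longlonglongrightarrow> f' t0 x"
    proof (rule AE_I2)
      fix x
      have "((\<lambda>t. (f t x - f t0 x) / (t - t0)) \<longlongrightarrow> f' t0 x) (at t0)"
        using D[of x t0] by (simp add: has_field_derivative_iff)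
      then show "(\<lambda>i. (f (X i) x - f t0 x) / (X i - t0)) \<longlonglongrightarrow> f' t0 x"
        using X by (simp add: tendsto_at_iff_sequentially o_def)
    qed
    show "AE x in M. norm ((f (X i) x - f t0 x) / (X i - t0)) \<le> w x" for i
    proof (rule AE_I2)
      fix x
      have "norm (f (X i) x - f t0 x) \<le> w x * norm (X i - t0)"
        by (rule field_differentiable_bound[of UNIV "\<lambda>t. f t x" "\<lambda>t. f' t x"])
           (use D bd in \<open>auto intro: DERIV_subset\<close>)
      then show "norm ((f (X i) x - f t0 x) / (X i - t0)) \<le> w x"
        using X by (simp add: field_simps)
    qed
  qed (rule meas, rule w)
  moreover have "(\<integral>x. (f (X i) x - f t0 x) / (X i - t0) \<partial>M)
      = ((\<integral>x. f (X i) x \<partial>M) - (\<integral>x. f t0 x \<partial>M)) / (X i - t0)" for i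
    by (simp only: integral_divide_zero Bochner_Integration.integral_diff[OF int int])
  ultimately show "((\<lambda>t. ((\<integral>x. f t x \<partial>M) - (\<integral>x. f t0 x \<partial>M)) / (t - t0)) \<circ> X) \<longlonglongrightarrow> (\<integral>x. f' t0 x \<partial>M)"
    by (simp only: o_def)
qed

section \<open>Gaussian comparison\<close>

text \<open>A smooth stand-in for the maximum, exceeding it by at most the logarithm of the number
  of terms; this is the function in which the two processes are compared.\<close>

definition log_sum_exp :: "'a set \<Rightarrow> ('a \<Rightarrow> real) \<Rightarrow> real" where
  "log_sum_exp T x = ln (\<Sum>i\<in>T. exp (x i))"

text \<open>The gradient of \<open>log_sum_exp\<close>: probability weights on
  \<open>T\<close>.\<close>

definition softmax :: "'a set \<Rightarrow> ('a \<Rightarrow> real) \<Rightarrow> 'a \<Rightarrow> real" where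
  "softmax T x i = exp (x i) / (\<Sum>j\<in>T. exp (x j))"

lemma sum_exp_pos: "finite T \<Longrightarrow> T \<noteq> {} \<Longrightarrow> 0 < (\<Sum>i\<in>T. exp (x i :: real))"
  by (intro sum_pos) auto

lemma softmax_nonneg: "0 \<le> softmax T x i"
  by (simp add: softmax_def sum_nonneg)

lemma sum_softmax: "finite T \<Longrightarrow> T \<noteq> {} \<Longrightarrow> (\<Sum>i\<in>T. softmax T x i) = 1"
  using sum_exp_pos[of T x] by (simp add: softmax_def flip: sum_divide_distrib)

lemma softmax_le_1: "finite T \<Longrightarrow> i \<in> T \<Longrightarrow> softmax T x i \<le> 1"
  using member_le_sum[of i T "\<lambda>i. exp (x i)"] sum_exp_pos[of T x]
  by (auto simp: softmax_def divide_le_eq_1)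

lemma log_sum_exp_bounds:
  assumes "finite T" "T \<noteq> {}"
  shows "Max (x ` T) \<le> log_sum_exp T x" and "log_sum_exp T x \<le> Max (x ` T) + ln (card T)"
proof -
  have "Max (x ` T) \<in> x ` T" using assms by (intro Max_in) auto
  then obtain m where m: "m \<in> T" "x m = Max (x ` T)" by (metis imageE)
  have "exp (x m) \<le> (\<Sum>i\<in>T. exp (x i))"
    using m assms by (intro member_le_sum) auto
  then have "ln (exp (x m)) \<le> ln (\<Sum>i\<in>T. exp (x i))"
    by (subst ln_le_cancel_iff) (auto simp: sum_exp_pos assms)
  then show "Max (x ` T) \<le> log_sum_exp T x" using m by (simp add: log_sum_exp_def)
  have "(\<Sum>i\<in>T. exp (x i)) \<le> (\<Sum>i\<in>T. exp (x m))"
    using assms m by (intro sum_mono) auto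
  then have "ln (\<Sum>i\<in>T. exp (x i)) \<le> ln (card T * exp (x m))"
    using assms by (subst ln_le_cancel_iff) (auto simp: sum_exp_pos card_gt_0_iff)
  also have "\<dots> = x m + ln (card T)"
    using assms by (subst ln_mult) (auto simp: card_gt_0_iff)
  finally show "log_sum_exp T x \<le> Max (x ` T) + ln (card T)" using m by (simp add: log_sum_exp_def)
qed

lemma log_sum_exp_has_derivative:
  assumes "finite T" "T \<noteq> {}"
    and "\<And>i. i \<in> T \<Longrightarrow> ((\<lambda>t. x t i) has_real_derivative x' i) (at t)"
  shows "((\<lambda>t. log_sum_exp T (x t)) has_real_derivative (\<Sum>i\<in>T. softmax T (x t) i * x' i)) (at t)"
  unfolding log_sum_exp_def softmax_def
  by (rule derivative_eq_intros assms refl sum_exp_pos | assumption)+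
     (simp_all add: sum_divide_distrib sum_distrib_right sum_distrib_left field_simps)

lemma softmax_has_derivative:
  assumes "finite T" "T \<noteq> {}"
    and "\<And>i. i \<in> T \<Longrightarrow> ((\<lambda>t. x t i) has_real_derivative x' i) (at t)" and "i \<in> T"
  shows "((\<lambda>t. softmax T (x t) i) has_real_derivative
     softmax T (x t) i * (x' i - (\<Sum>j\<in>T. softmax T (x t) j * x' j))) (at t)"
proof -
  \<comment> \<open>Written as an exponential, the weight has logarithmic derivative x'_i minus the
    derivative of \<open>log_sum_exp\<close>, which is the mean of x' under the weights.\<close>
  have eq: "softmax T y i = exp (y i - log_sum_exp T y)" for y
    using sum_exp_pos[OF assms(1,2), of y] by (simp add: softmax_def log_sum_exp_def exp_diff)
  show ?thesis
    unfolding eq[of "x _"]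
    by (rule derivative_eq_intros assms log_sum_exp_has_derivative[of T x x'] refl | assumption)+
qed

text \<open>A Gaussian process is represented by the coefficient vectors of its members over one
  family of independent Gaussians: covariances are dot products of coefficients, and orthogonality
  expresses independence.\<close>

definition lin_form :: "'i set \<Rightarrow> ('i \<Rightarrow> real) \<Rightarrow> ('i \<Rightarrow> real) \<Rightarrow> real" where
  "lin_form K a g = (\<Sum>k\<in>K. a k * g k)"

lemma lin_form_measurable [measurable]: "lin_form K a \<in> borel_measurable (gaussian K)"
  unfolding lin_form_def by measurable

lemma log_sum_exp_lin_measurable:
  "(\<lambda>g. log_sum_exp T (\<lambda>i. lin_form K (a i) g + c i)) \<in> borel_measurable (gaussian K)"
  unfolding log_sum_exp_def by measurable

lemma softmax_lin_measurable:
  "(\<lambda>g. softmax T (\<lambda>i. lin_form K (a i) g + c i) i) \<in> borel_measurable (gaussian K)"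
proof -
  have "(\<lambda>g. exp (lin_form K (a i) g + c i)) \<in> borel_measurable (gaussian K)" for i
    by (rule measurable_compose[OF borel_measurable_add[OF lin_form_measurable borel_measurable_const]
          borel_measurable_exp])
  then show ?thesis unfolding softmax_def by (intro borel_measurable_divide borel_measurable_sum)
qed

section \<open>Integrability from linear growth\<close>

lemma integrable_abs_component:
  assumes "finite K" "k \<in> K" shows "integrable (gaussian K) (\<lambda>g. \<bar>g k\<bar>)"
  using assms integrable_std_normal_moment_abs[of 1]
  by (subst gaussian_integral_component(2)) (auto simp: std_normal_integrable_iff)

lemma integrable_abs_prod:
  assumes K: "finite K" "k \<in> K" "l \<in> K"
  shows "integrable (gaussian K) (\<lambda>g. \<bar>g k\<bar> * \<bar>g l\<bar>)"
proof (rule Bochner_Integration.integrable_bound)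
  show "integrable (gaussian K) (\<lambda>g. (g k)\<^sup>2 + (g l)\<^sup>2)"
    by (intro Bochner_Integration.integrable_add gaussian_square_integrable K)
  have "\<bar>x\<bar> * \<bar>y\<bar> \<le> x\<^sup>2 + y\<^sup>2" for x y :: real
  proof -
    have "2 * (\<bar>x\<bar> * \<bar>y\<bar>) \<le> x\<^sup>2 + y\<^sup>2"
      using sum_squares_bound[of "\<bar>x\<bar>" "\<bar>y\<bar>"] by (simp only: power2_abs mult.assoc)
    moreover have "0 \<le> \<bar>x\<bar> * \<bar>y\<bar>" by simp
    ultimately show ?thesis by linarith
  qed
  then show "AE g in gaussian K. norm (\<bar>g k\<bar> * \<bar>g l\<bar>) \<le> norm ((g k)\<^sup>2 + (g l)\<^sup>2)"
    by (intro AE_I2) (simp add: abs_mult)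
  show "(\<lambda>g. \<bar>g k\<bar> * \<bar>g l\<bar>) \<in> borel_measurable (gaussian K)"
    by (intro borel_measurable_times borel_measurable_abs measurable_gaussian_component K)
qed

lemma lin_form_bound:
  assumes "finite K" shows "\<bar>lin_form K a g\<bar> \<le> (\<Sum>k\<in>K. \<bar>a k\<bar>) * (\<Sum>k\<in>K. \<bar>g k\<bar>)"
proof -
  have "\<bar>lin_form K a g\<bar> \<le> (\<Sum>k\<in>K. \<bar>a k\<bar> * \<bar>g k\<bar>)"
    unfolding lin_form_def abs_mult[symmetric] by (rule sum_abs)
  also have "\<dots> \<le> (\<Sum>k\<in>K. \<bar>a k\<bar> * (\<Sum>k\<in>K. \<bar>g k\<bar>))"
    using assms by (intro sum_mono mult_left_mono member_le_sum) auto
  finally show ?thesis by (simp add: sum_distrib_right)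
qed

text \<open>Maxima, \<open>log_sum_exp\<close> and softmax weights of affine forms all grow at most
  linearly in the sum of the |g k|. This lemma and its version with an extra factor
  \<open>g l\<close> turn such bounds into integrability.\<close>

lemma integrable_linear_growth:
  assumes K: "finite K" and m: "f \<in> borel_measurable (gaussian K)"
    and b: "\<And>g. \<bar>f g\<bar> \<le> A + B * (\<Sum>k\<in>K. \<bar>g k\<bar>)"
  shows "integrable (gaussian K) f"
proof -
  interpret prob_space "gaussian K" by (rule prob_space_gaussian)
  show ?thesis
  proof (rule Bochner_Integration.integrable_bound[OF _ m])
    show "integrable (gaussian K) (\<lambda>g. A + B * (\<Sum>k\<in>K. \<bar>g k\<bar>))"
      by (intro Bochner_Integration.integrable_add integrable_const integrable_mult_right Bochner_Integration.integrable_sum integrable_abs_component[OF K])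
    show "AE g in gaussian K. norm (f g) \<le> norm (A + B * (\<Sum>k\<in>K. \<bar>g k\<bar>))"
      by (intro AE_I2) (metis abs_ge_self b order_trans real_norm_def)
  qed
qed

lemma integrable_mult_linear_growth:
  assumes K: "finite K" "l \<in> K" and m: "f \<in> borel_measurable (gaussian K)"
    and b: "\<And>g. \<bar>f g\<bar> \<le> A + B * (\<Sum>k\<in>K. \<bar>g k\<bar>)"
  shows "integrable (gaussian K) (\<lambda>g. g l * f g)"
proof (rule Bochner_Integration.integrable_bound)
  show "integrable (gaussian K) (\<lambda>g. A * \<bar>g l\<bar> + B * (\<Sum>k\<in>K. \<bar>g l\<bar> * \<bar>g k\<bar>))"
    by (intro Bochner_Integration.integrable_add integrable_mult_right Bochner_Integration.integrable_sum integrable_abs_component integrable_abs_prod K)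
  show "AE g in gaussian K. norm (g l * f g) \<le> norm (A * \<bar>g l\<bar> + B * (\<Sum>k\<in>K. \<bar>g l\<bar> * \<bar>g k\<bar>))"
  proof (rule AE_I2)
    fix g :: "'a \<Rightarrow> real"
    have "norm (g l * f g) \<le> \<bar>g l\<bar> * (A + B * (\<Sum>k\<in>K. \<bar>g k\<bar>))"
      using b[of g] by (simp add: abs_mult mult_left_mono)
    also have "\<dots> = A * \<bar>g l\<bar> + B * (\<Sum>k\<in>K. \<bar>g l\<bar> * \<bar>g k\<bar>)"
      by (simp add: algebra_simps sum_distrib_left)
    finally show "norm (g l * f g) \<le> norm (A * \<bar>g l\<bar> + B * (\<Sum>k\<in>K. \<bar>g l\<bar> * \<bar>g k\<bar>))"
      by simp
  qed
  show "(\<lambda>g. g l * f g) \<in> borel_measurable (gaussian K)"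
    by (intro borel_measurable_times m measurable_gaussian_component K)
qed

lemma Max_lin_bound:
  assumes "finite K" "finite T" "T \<noteq> {}"
  shows "\<bar>Max ((\<lambda>i. lin_form K (a i) g + c i) ` T)\<bar>
     \<le> (\<Sum>i\<in>T. \<bar>c i\<bar>) + (\<Sum>i\<in>T. \<Sum>k\<in>K. \<bar>a i k\<bar>) * (\<Sum>k\<in>K. \<bar>g k\<bar>)"
proof -
  let ?x = "\<lambda>i. lin_form K (a i) g + c i"
  have "Max (?x ` T) \<in> ?x ` T" using assms by (intro Max_in) auto
  then obtain m where m: "m \<in> T" "Max (?x ` T) = ?x m" by (rule imageE)
  have "\<bar>?x m\<bar> \<le> \<bar>c m\<bar> + (\<Sum>k\<in>K. \<bar>a m k\<bar>) * (\<Sum>k\<in>K. \<bar>g k\<bar>)"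
    using lin_form_bound[OF assms(1), of "a m" g] by linarith
  also have "\<dots> \<le> (\<Sum>i\<in>T. \<bar>c i\<bar>) + (\<Sum>i\<in>T. \<Sum>k\<in>K. \<bar>a i k\<bar>) * (\<Sum>k\<in>K. \<bar>g k\<bar>)"
    using m assms by (intro add_mono mult_right_mono member_le_sum sum_nonneg) auto
  finally show ?thesis using m by simp
qed

lemma log_sum_exp_lin_bound:
  assumes "finite K" "finite T" "T \<noteq> {}"
  shows "\<bar>log_sum_exp T (\<lambda>i. lin_form K (a i) g + c i)\<bar>
     \<le> (ln (card T) + (\<Sum>i\<in>T. \<bar>c i\<bar>)) + (\<Sum>i\<in>T. \<Sum>k\<in>K. \<bar>a i k\<bar>) * (\<Sum>k\<in>K. \<bar>g k\<bar>)"
proof -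
  let ?x = "\<lambda>i. lin_form K (a i) g + c i"
  have "0 \<le> ln (card T)" using assms by (simp add: card_gt_0_iff Suc_leI)
  then have "\<bar>log_sum_exp T ?x\<bar> \<le> ln (card T) + \<bar>Max (?x ` T)\<bar>"
    using log_sum_exp_bounds[OF assms(2,3), of ?x] by linarith
  with Max_lin_bound[OF assms, of a g c] show ?thesis by linarith
qed

lemma lin_form_upd_deriv:
  assumes "finite K" "k \<in> K"
  shows "((\<lambda>y. lin_form K a (g(k := y))) has_real_derivative a k) (at y)"
proof -
  have "lin_form K a (g(k := y)) = a k * y + (\<Sum>j\<in>K-{k}. a j * g j)" for y
    unfolding lin_form_def using assms by (subst sum.remove[of K k]) auto
  then show ?thesis by (auto intro!: derivative_eq_intros)
qed

text \<open>Along coordinate \<open>k\<close> a softmax weight changes at the rate weight times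
  deviation of \<open>a i k\<close> from its weighted mean; this is bounded, as integration by parts
  requires.\<close>

lemma gaussian_softmax_by_parts:
  fixes a :: "'a \<Rightarrow> 'i \<Rightarrow> real" and c :: "'a \<Rightarrow> real"
  assumes K: "finite K" "k \<in> K" and T: "finite T" "T \<noteq> {}" "i \<in> T"
    and p_def: "p = (\<lambda>g. softmax T (\<lambda>i. lin_form K (a i) g + c i))"
  shows "(\<integral>g. g k * p g i \<partial>gaussian K) = (\<integral>g. p g i * (a i k - (\<Sum>j\<in>T. p g j * a j k)) \<partial>gaussian K)"
proof (rule gaussian_integral_by_parts[OF K])
  have p: "0 \<le> p g j" "j \<in> T \<Longrightarrow> p g j \<le> 1" for g j
    unfolding p_def using T by (auto intro: softmax_nonneg softmax_le_1)
  have D: "((\<lambda>y. p (x(k := y)) i) has_real_derivative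
         p (x(k := y)) i * (a i k - (\<Sum>j\<in>T. p (x(k := y)) j * a j k))) (at y)" if "i \<in> T" for x y i
    unfolding p_def using T that
    by (intro softmax_has_derivative) (auto intro!: derivative_eq_intros lin_form_upd_deriv K)
  from this[OF T(3)] show "((\<lambda>y. p (x(k := y)) i) has_real_derivative
         p (x(k := y)) i * (a i k - (\<Sum>j\<in>T. p (x(k := y)) j * a j k))) (at y)" for x y .
  have "isCont (\<lambda>y. p (x(k := y)) i) y" if "i \<in> T" for x y i
    using DERIV_isCont[OF D[OF that]] .
  then show "isCont (\<lambda>y. p (x(k := y)) i * (a i k - (\<Sum>j\<in>T. p (x(k := y)) j * a j k))) y" for x y
    using T by (intro continuous_intros) auto
  have *: "\<bar>\<Sum>j\<in>T. p x j * a j k\<bar> \<le> (\<Sum>j\<in>T. \<bar>a j k\<bar>)" for x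
    using p by (intro order_trans[OF sum_abs] sum_mono) (auto simp: abs_mult mult_left_le_one_le)
  show "\<bar>p x i * (a i k - (\<Sum>j\<in>T. p x j * a j k))\<bar> \<le> \<bar>a i k\<bar> + (\<Sum>j\<in>T. \<bar>a j k\<bar>)" for x
  proof -
    have "\<bar>p x i * (a i k - (\<Sum>j\<in>T. p x j * a j k))\<bar> \<le> \<bar>a i k - (\<Sum>j\<in>T. p x j * a j k)\<bar>"
      using p T(3) by (simp add: abs_mult mult_left_le_one_le)
    with *[of x] show ?thesis by linarith
  qed
  show "(\<lambda>g. p g i * (a i k - (\<Sum>j\<in>T. p g j * a j k))) \<in> borel_measurable (gaussian K)"
    unfolding p_def
    by (intro borel_measurable_times borel_measurable_diff borel_measurable_const borel_measurable_sum
        softmax_lin_measurable)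
  show "integrable (gaussian K) (\<lambda>g. g k * p g i)"
    using p T(3) by (intro integrable_mult_linear_growth[where A=1 and B=0] K)
      (simp_all add: p_def softmax_lin_measurable)
qed

text \<open>The covariance under the weights \<open>p\<close>, written as half a mean over two
  independent copies. In this form only differences between members of a process occur, which a
  hypothesis on increments can control.\<close>

lemma weighted_covariance:
  fixes p x y :: "'a \<Rightarrow> real"
  assumes "(\<Sum>i\<in>T. p i) = 1"
  shows "(\<Sum>i\<in>T. p i * x i * (y i - (\<Sum>j\<in>T. p j * y j)))
     = (\<Sum>i\<in>T. \<Sum>j\<in>T. p i * p j * ((x i - x j) * (y i - y j))) / 2"
proof -
  have a: "(\<Sum>i\<in>T. \<Sum>j\<in>T. p i * p j * (x i * y i)) = (\<Sum>i\<in>T. p i * x i * y i)"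
    using assms by (intro sum.cong refl) (simp add: sum_distrib_left[symmetric] sum_distrib_right[symmetric] mult_ac)
  have b: "(\<Sum>i\<in>T. \<Sum>j\<in>T. p i * p j * (x j * y j)) = (\<Sum>i\<in>T. p i * x i * y i)"
    by (subst sum.swap) (use a in \<open>simp add: mult_ac\<close>)
  have c: "(\<Sum>i\<in>T. \<Sum>j\<in>T. p i * p j * (x i * y j)) = (\<Sum>i\<in>T. p i * x i) * (\<Sum>j\<in>T. p j * y j)"
    by (simp add: sum_product mult_ac)
  have d: "(\<Sum>i\<in>T. \<Sum>j\<in>T. p i * p j * (x j * y i)) = (\<Sum>i\<in>T. p i * x i) * (\<Sum>j\<in>T. p j * y j)"
    by (subst sum.swap) (use c in \<open>simp add: mult_ac\<close>)
  have "(\<Sum>i\<in>T. \<Sum>j\<in>T. p i * p j * ((x i - x j) * (y i - y j)))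
     = (\<Sum>i\<in>T. \<Sum>j\<in>T. p i * p j * (x i * y i)) + (\<Sum>i\<in>T. \<Sum>j\<in>T. p i * p j * (x j * y j))
       - (\<Sum>i\<in>T. \<Sum>j\<in>T. p i * p j * (x i * y j)) - (\<Sum>i\<in>T. \<Sum>j\<in>T. p i * p j * (x j * y i))"
    by (simp add: algebra_simps sum.distrib sum_subtractf)
  moreover have "(\<Sum>i\<in>T. p i * x i * (y i - (\<Sum>j\<in>T. p j * y j)))
     = (\<Sum>i\<in>T. p i * x i * y i) - (\<Sum>i\<in>T. p i * x i) * (\<Sum>j\<in>T. p j * y j)"
    by (simp add: right_diff_distrib sum_subtractf sum_distrib_right)
  ultimately show ?thesis unfolding a b c d by simp
qed

text \<open>Interpolate along the quarter circle cos t x + sin t y. Integration by parts turns the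
  derivative of the expectation into a weighted mean of inner products between increments of the
  path and of its velocity. The offsets \<open>c\<close> are constant along the path and enter only
  through the weights.\<close>

lemma log_sum_exp_comparison:
  fixes x y :: "'a \<Rightarrow> 'i \<Rightarrow> real" and c :: "'a \<Rightarrow> real"
  assumes K: "finite K" and T: "finite T" "T \<noteq> {}"
    and orth: "\<And>i j. i \<in> T \<Longrightarrow> j \<in> T \<Longrightarrow> (\<Sum>k\<in>K. x i k * y j k) = 0"
    and incr: "\<And>i j. i \<in> T \<Longrightarrow> j \<in> T \<Longrightarrow> (\<Sum>k\<in>K. (x i k - x j k)\<^sup>2) \<le> (\<Sum>k\<in>K. (y i k - y j k)\<^sup>2)"
  shows "(\<integral>g. log_sum_exp T (\<lambda>i. lin_form K (x i) g + c i) \<partial>gaussian K)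
       \<le> (\<integral>g. log_sum_exp T (\<lambda>i. lin_form K (y i) g + c i) \<partial>gaussian K)"
proof -
  define A where "A t i k = cos t * x i k + sin t * y i k" for t i k
  define A' where "A' t i k = - sin t * x i k + cos t * y i k" for t i k
  define p where "p t g = softmax T (\<lambda>i. lin_form K (A t i) g + c i)" for t g
  define \<phi> where "\<phi> t = (\<integral>g. log_sum_exp T (\<lambda>i. lin_form K (A t i) g + c i) \<partial>gaussian K)" for t
  have p: "0 \<le> p t g i" "i \<in> T \<Longrightarrow> p t g i \<le> 1" "(\<Sum>i\<in>T. p t g i) = 1" for t g i
    unfolding p_def using T by (auto intro: softmax_nonneg softmax_le_1 sum_softmax)
  have pm [measurable]: "(\<lambda>g. p t g i) \<in> borel_measurable (gaussian K)" for t i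
    unfolding p_def by (rule softmax_lin_measurable)
  have dA: "((\<lambda>t. lin_form K (A t i) g + c i) has_real_derivative lin_form K (A' t i) g) (at t)" for t i g
    unfolding lin_form_def A_def A'_def by (auto intro!: derivative_eq_intros sum.cong)
  have A'b: "\<bar>A' t i k\<bar> \<le> \<bar>x i k\<bar> + \<bar>y i k\<bar>" for t i k
  proof -
    have "\<bar>A' t i k\<bar> \<le> \<bar>sin t\<bar> * \<bar>x i k\<bar> + \<bar>cos t\<bar> * \<bar>y i k\<bar>"
      unfolding A'_def by (intro order_trans[OF abs_triangle_ineq]) (simp add: abs_mult)
    also have "\<dots> \<le> 1 * \<bar>x i k\<bar> + 1 * \<bar>y i k\<bar>"
      by (intro add_mono mult_right_mono) auto
    finally show ?thesis by simp
  qed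
  have int_gp: "integrable (gaussian K) (\<lambda>g. g k * p t g i)" if "k \<in> K" "i \<in> T" for k i t
    using p that by (intro integrable_mult_linear_growth[where A=1 and B=0] K) auto
  define D where "D t = (\<integral>g. (\<Sum>i\<in>T. p t g i * lin_form K (A' t i) g) \<partial>gaussian K)" for t
  have deriv: "(\<phi> has_real_derivative D t) (at t)" for t
    unfolding \<phi>_def D_def
  proof (rule has_real_derivative_integral)
    show "integrable (gaussian K) (\<lambda>g. log_sum_exp T (\<lambda>i. lin_form K (A t i) g + c i))" for t
      by (rule integrable_linear_growth[OF K]) (rule log_sum_exp_lin_measurable, rule log_sum_exp_lin_bound[OF K T])
    show "((\<lambda>t. log_sum_exp T (\<lambda>i. lin_form K (A t i) g + c i)) has_real_derivative
           (\<Sum>i\<in>T. p t g i * lin_form K (A' t i) g)) (at t)" for t g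
      unfolding p_def by (rule log_sum_exp_has_derivative[OF T dA])
    show "\<bar>\<Sum>i\<in>T. p t g i * lin_form K (A' t i) g\<bar>
        \<le> (\<Sum>i\<in>T. \<Sum>k\<in>K. \<bar>x i k\<bar> + \<bar>y i k\<bar>) * (\<Sum>k\<in>K. \<bar>g k\<bar>)" for t g
      unfolding sum_distrib_right[of _ T]
    proof (rule order_trans[OF sum_abs], rule sum_mono)
      fix i assume i: "i \<in> T"
      have "\<bar>p t g i * lin_form K (A' t i) g\<bar> \<le> \<bar>lin_form K (A' t i) g\<bar>"
        using p i by (simp add: abs_mult mult_left_le_one_le)
      also have "\<dots> \<le> (\<Sum>k\<in>K. \<bar>A' t i k\<bar>) * (\<Sum>k\<in>K. \<bar>g k\<bar>)" by (rule lin_form_bound[OF K])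
      also have "\<dots> \<le> (\<Sum>k\<in>K. \<bar>x i k\<bar> + \<bar>y i k\<bar>) * (\<Sum>k\<in>K. \<bar>g k\<bar>)"
        by (intro mult_right_mono sum_mono A'b sum_nonneg) auto
      finally show "\<bar>p t g i * lin_form K (A' t i) g\<bar> \<le> (\<Sum>k\<in>K. \<bar>x i k\<bar> + \<bar>y i k\<bar>) * (\<Sum>k\<in>K. \<bar>g k\<bar>)" .
    qed
    show "integrable (gaussian K) (\<lambda>g. (\<Sum>i\<in>T. \<Sum>k\<in>K. \<bar>x i k\<bar> + \<bar>y i k\<bar>) * (\<Sum>k\<in>K. \<bar>g k\<bar>))"
      using integrable_abs_component[OF K] by auto
    show "(\<lambda>g. \<Sum>i\<in>T. p t g i * lin_form K (A' t i) g) \<in> borel_measurable (gaussian K)"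
      by (intro borel_measurable_times borel_measurable_sum pm lin_form_measurable)
  qed
  \<comment> \<open>Half the derivative of the squared increment along the path. Orthogonality of
    the two processes removes the cross terms and leaves sin t cos t times the difference of the
    squared increments, which is nonnegative in the first quadrant.\<close>
  have inc: "(\<Sum>k\<in>K. (A' t i k - A' t j k) * (A t i k - A t j k)) \<ge> 0"
    if t: "0 \<le> t" "t \<le> pi/2" and ij: "i \<in> T" "j \<in> T" for t i j
  proof -
    have "(A' t i k - A' t j k) * (A t i k - A t j k)
      = sin t * cos t * ((y i k - y j k)\<^sup>2 - (x i k - x j k)\<^sup>2)
        + ((cos t)\<^sup>2 - (sin t)\<^sup>2) * (x i k * y i k - x i k * y j k - x j k * y i k + x j k * y j k)" for k
      unfolding A_def A'_def by (simp add: algebra_simps power2_eq_square)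
    then have "(\<Sum>k\<in>K. (A' t i k - A' t j k) * (A t i k - A t j k))
      = sin t * cos t * ((\<Sum>k\<in>K. (y i k - y j k)\<^sup>2) - (\<Sum>k\<in>K. (x i k - x j k)\<^sup>2))
       + ((cos t)\<^sup>2 - (sin t)\<^sup>2) * ((\<Sum>k\<in>K. x i k * y i k) - (\<Sum>k\<in>K. x i k * y j k) - (\<Sum>k\<in>K. x j k * y i k) + (\<Sum>k\<in>K. x j k * y j k))"
      by (simp add: sum.distrib sum_subtractf flip: sum_distrib_left)
    moreover have "0 \<le> sin t" "0 \<le> cos t" using t by (auto intro: sin_ge_zero cos_ge_zero)
    ultimately show ?thesis using incr[OF ij] orth ij by simp
  qed
  have Dnn: "0 \<le> D t" if t: "0 \<le> t" "t \<le> pi/2" for t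
  proof -
    have int2: "integrable (gaussian K) (\<lambda>g. p t g i * (A t i k - (\<Sum>j\<in>T. p t g j * A t j k)))"
      if "i \<in> T" for i k
    proof (rule integrable_linear_growth[OF K, where A="\<bar>A t i k\<bar> + (\<Sum>j\<in>T. \<bar>A t j k\<bar>)" and B=0])
      fix g
      have "\<bar>\<Sum>j\<in>T. p t g j * A t j k\<bar> \<le> (\<Sum>j\<in>T. \<bar>A t j k\<bar>)"
        using p by (intro order_trans[OF sum_abs] sum_mono) (auto simp: abs_mult mult_left_le_one_le)
      then have "\<bar>A t i k - (\<Sum>j\<in>T. p t g j * A t j k)\<bar> \<le> \<bar>A t i k\<bar> + (\<Sum>j\<in>T. \<bar>A t j k\<bar>)" by linarith
      moreover have "\<bar>p t g i * (A t i k - (\<Sum>j\<in>T. p t g j * A t j k))\<bar> \<le> \<bar>A t i k - (\<Sum>j\<in>T. p t g j * A t j k)\<bar>"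
        using p that by (simp add: abs_mult mult_left_le_one_le)
      ultimately show "\<bar>p t g i * (A t i k - (\<Sum>j\<in>T. p t g j * A t j k))\<bar> \<le> \<bar>A t i k\<bar> + (\<Sum>j\<in>T. \<bar>A t j k\<bar>) + 0 * (\<Sum>k\<in>K. \<bar>g k\<bar>)" by simp
    qed (intro borel_measurable_times borel_measurable_diff borel_measurable_const borel_measurable_sum pm)
    have "D t = (\<integral>g. (\<Sum>i\<in>T. \<Sum>k\<in>K. A' t i k * (g k * p t g i)) \<partial>gaussian K)"
      unfolding D_def lin_form_def by (simp add: sum_distrib_left mult_ac)
    also have "\<dots> = (\<Sum>i\<in>T. \<Sum>k\<in>K. A' t i k * (\<integral>g. g k * p t g i \<partial>gaussian K))"
      using int_gp by (simp add: Bochner_Integration.integral_sum)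
    also have "\<dots> = (\<Sum>i\<in>T. \<Sum>k\<in>K. A' t i k * (\<integral>g. p t g i * (A t i k - (\<Sum>j\<in>T. p t g j * A t j k)) \<partial>gaussian K))"
      by (intro sum.cong refl arg_cong2[where f="(*)"] gaussian_softmax_by_parts[OF K _ T, where c=c])
         (auto simp: p_def)
    also have "\<dots> = (\<integral>g. (\<Sum>i\<in>T. \<Sum>k\<in>K. A' t i k * (p t g i * (A t i k - (\<Sum>j\<in>T. p t g j * A t j k)))) \<partial>gaussian K)"
      using int2 by (simp add: Bochner_Integration.integral_sum)
    also have "\<dots> \<ge> 0"
    proof (rule Bochner_Integration.integral_nonneg)
      fix g
      have "(\<Sum>i\<in>T. \<Sum>k\<in>K. A' t i k * (p t g i * (A t i k - (\<Sum>j\<in>T. p t g j * A t j k))))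
         = (\<Sum>k\<in>K. \<Sum>i\<in>T. p t g i * A' t i k * (A t i k - (\<Sum>j\<in>T. p t g j * A t j k)))"
        by (subst sum.swap) (simp add: mult_ac)
      also have "\<dots> = (\<Sum>k\<in>K. (\<Sum>i\<in>T. \<Sum>j\<in>T. p t g i * p t g j * ((A' t i k - A' t j k) * (A t i k - A t j k))) / 2)"
        by (intro sum.cong refl weighted_covariance p)
      also have "\<dots> = (\<Sum>i\<in>T. \<Sum>j\<in>T. p t g i * p t g j * (\<Sum>k\<in>K. (A' t i k - A' t j k) * (A t i k - A t j k))) / 2"
        by (simp add: sum_divide_distrib[symmetric] sum_distrib_left sum.swap[of _ T K])
      also have "\<dots> \<ge> 0"
        by (intro divide_nonneg_nonneg sum_nonneg mult_nonneg_nonneg[OF mult_nonneg_nonneg] p inc[OF t]) auto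
      finally show "0 \<le> (\<Sum>i\<in>T. \<Sum>k\<in>K. A' t i k * (p t g i * (A t i k - (\<Sum>j\<in>T. p t g j * A t j k))))" .
    qed
    finally show ?thesis .
  qed
  have "\<phi> 0 \<le> \<phi> (pi/2)"
    by (rule DERIV_nonneg_imp_nondecreasing) (use deriv Dnn in auto)
  then show ?thesis by (simp add: \<phi>_def A_def lin_form_def)
qed

section \<open>The limit from log-sum-exp to maxima\<close>

lemma log_sum_exp_scaled_bounds:
  assumes "finite T" "T \<noteq> {}" "0 < b"
  shows "Max (x ` T) \<le> log_sum_exp T (\<lambda>i. b * x i) / b"
    and "log_sum_exp T (\<lambda>i. b * x i) / b \<le> Max (x ` T) + ln (card T) / b"
proof -
  have "Max ((\<lambda>i. b * x i) ` T) = b * Max (x ` T)"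
    using mono_Max_commute[of "\<lambda>y. b * y" "x ` T"] assms
    by (auto simp: image_image mono_def)
  then show "Max (x ` T) \<le> log_sum_exp T (\<lambda>i. b * x i) / b"
    "log_sum_exp T (\<lambda>i. b * x i) / b \<le> Max (x ` T) + ln (card T) / b"
    using log_sum_exp_bounds[OF assms(1,2), of "\<lambda>i. b * x i"] assms(3) by (auto simp: field_simps)
qed

lemma scale_lin_form: "b * (lin_form K a g + c) = lin_form K (\<lambda>k. b * a k) g + b * (c::real)"
  by (simp add: lin_form_def sum_distrib_left algebra_simps)

lemma integrable_Max_lin:
  assumes "finite K" "finite T" "T \<noteq> {}"
  shows "integrable (gaussian K) (\<lambda>g. Max ((\<lambda>i. lin_form K (a i) g + c i) ` T))"
  using assms by (intro integrable_linear_growth[OF _ _ Max_lin_bound]) auto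

text \<open>Multiplying coefficients and offsets by \<open>b\<close> and dividing the log-sum-exp by
  \<open>b\<close> approximates the maximum up to ln (card T) / b. The scaling preserves both
  hypotheses, so the error disappears as \<open>b\<close> tends to infinity.\<close>

theorem gaussian_max_comparison:
  fixes x y :: "'a \<Rightarrow> 'i \<Rightarrow> real" and c :: "'a \<Rightarrow> real"
  assumes K: "finite K" and T: "finite T" "T \<noteq> {}"
    and orth: "\<And>i j. i \<in> T \<Longrightarrow> j \<in> T \<Longrightarrow> (\<Sum>k\<in>K. x i k * y j k) = 0"
    and incr: "\<And>i j. i \<in> T \<Longrightarrow> j \<in> T \<Longrightarrow> (\<Sum>k\<in>K. (x i k - x j k)\<^sup>2) \<le> (\<Sum>k\<in>K. (y i k - y j k)\<^sup>2)"
  shows "(\<integral>g. Max ((\<lambda>i. lin_form K (x i) g + c i) ` T) \<partial>gaussian K)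
       \<le> (\<integral>g. Max ((\<lambda>i. lin_form K (y i) g + c i) ` T) \<partial>gaussian K)" (is "?X \<le> ?Y")
proof -
  interpret prob_space "gaussian K" by (rule prob_space_gaussian)
  have *: "?X \<le> ?Y + ln (card T) / b" if b: "0 < b" for b
  proof -
    let ?L = "\<lambda>a g. log_sum_exp T (\<lambda>i. lin_form K (\<lambda>k. b * a i k) g + b * c i)"
    have int: "integrable (gaussian K) (?L a)" for a
      by (rule integrable_linear_growth[OF K]) (rule log_sum_exp_lin_measurable, rule log_sum_exp_lin_bound[OF K T])
    have "?X \<le> (\<integral>g. ?L x g / b \<partial>gaussian K)"
      using int log_sum_exp_scaled_bounds(1)[OF T b, of "\<lambda>i. lin_form K (x i) _ + c i"]
      by (intro integral_mono integrable_Max_lin K T) (auto simp: scale_lin_form)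
    also have "\<dots> \<le> (\<integral>g. ?L y g / b \<partial>gaussian K)"
    proof -
      have "(\<integral>g. ?L x g \<partial>gaussian K) \<le> (\<integral>g. ?L y g \<partial>gaussian K)"
      proof (rule log_sum_exp_comparison[OF K T])
        fix i j assume ij: "i \<in> T" "j \<in> T"
        show "(\<Sum>k\<in>K. b * x i k * (b * y j k)) = 0"
          using orth[OF ij] by (simp add: mult_ac flip: sum_distrib_left)
        have "(b * u - b * v)\<^sup>2 = b\<^sup>2 * (u - v)\<^sup>2" for u v :: real
          by (simp add: algebra_simps power2_eq_square)
        then show "(\<Sum>k\<in>K. (b * x i k - b * x j k)\<^sup>2) \<le> (\<Sum>k\<in>K. (b * y i k - b * y j k)\<^sup>2)"
          using incr[OF ij] by (simp add: mult_left_mono flip: sum_distrib_left)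
      qed
      then show ?thesis using b by (simp add: divide_right_mono)
    qed
    also have "\<dots> \<le> (\<integral>g. Max ((\<lambda>i. lin_form K (y i) g + c i) ` T) + ln (card T) / b \<partial>gaussian K)"
      using int log_sum_exp_scaled_bounds(2)[OF T b, of "\<lambda>i. lin_form K (y i) _ + c i"]
      by (intro integral_mono Bochner_Integration.integrable_add integrable_Max_lin K T) (auto simp: scale_lin_form)
    also have "\<dots> = ?Y + ln (card T) / b"
      using integrable_Max_lin[OF K T, of y c] by (simp add: prob_space)
    finally show ?thesis .
  qed
  have "((\<lambda>b. ?Y + ln (card T) / b) \<longlongrightarrow> ?Y + 0) at_top"
    by (intro tendsto_intros tendsto_divide_0[OF tendsto_const]) (auto intro: filterlim_mono[OF filterlim_ident] at_top_le_at_infinity)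
  then have "((\<lambda>b. ?Y + ln (card T) / b) \<longlongrightarrow> ?Y) at_top" by simp
  then show ?thesis
    by (rule tendsto_lowerbound) (use * in \<open>auto intro: eventually_mono[OF eventually_gt_at_top[of 0]]\<close>)
qed

text \<open>Let S be the form with coefficients \<open>s\<close>. For the smoothed maximum L,
  integration by parts makes E (S L) the sum over i of b E (p_i) <s, a_i>, which is zero. Passing
  from L / b to the maximum costs at most E |S| ln (card T) / b, which tends to zero.\<close>

lemma gaussian_max_uncorrelated:
  fixes a :: "'a \<Rightarrow> 'i \<Rightarrow> real" and c :: "'a \<Rightarrow> real"
  assumes K: "finite K" and T: "finite T" "T \<noteq> {}"
    and orth: "\<And>i. i \<in> T \<Longrightarrow> (\<Sum>k\<in>K. s k * a i k) = 0"
  shows "(\<integral>g. lin_form K s g * Max ((\<lambda>i. lin_form K (a i) g + c i) ` T) \<partial>gaussian K) = 0" (is "?E = 0")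
proof -
  interpret prob_space "gaussian K" by (rule prob_space_gaussian)
  let ?M = "\<lambda>g. Max ((\<lambda>i. lin_form K (a i) g + c i) ` T)"
  have intS: "integrable (gaussian K) (lin_form K s)"
    by (rule integrable_linear_growth[OF K lin_form_measurable, where A=0 and B="\<Sum>k\<in>K. \<bar>s k\<bar>"])
       (simp add: lin_form_bound[OF K])
  have intm: "integrable (gaussian K) (\<lambda>g. lin_form K s g * f g)"
    if "f \<in> borel_measurable (gaussian K)" "\<And>g. \<bar>f g\<bar> \<le> A + B * (\<Sum>k\<in>K. \<bar>g k\<bar>)" for f A B
    unfolding lin_form_def sum_distrib_right mult.assoc
    by (intro Bochner_Integration.integrable_sum integrable_mult_right integrable_mult_linear_growth[OF K _ that])
  have intM: "integrable (gaussian K) (\<lambda>g. lin_form K s g * ?M g)"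
    by (rule intm[OF borel_measurable_integrable[OF integrable_Max_lin[OF K T]] Max_lin_bound[OF K T]])
  have *: "\<bar>?E\<bar> \<le> (\<integral>g. \<bar>lin_form K s g\<bar> \<partial>gaussian K) * ln (card T) / b" if b: "0 < b" for b
  proof -
    define L where "L g = log_sum_exp T (\<lambda>i. lin_form K (\<lambda>k. b * a i k) g + b * c i)" for g
    define p where "p g = softmax T (\<lambda>i. lin_form K (\<lambda>k. b * a i k) g + b * c i)" for g
    have p: "0 \<le> p g i" "i \<in> T \<Longrightarrow> p g i \<le> 1" "(\<Sum>i\<in>T. p g i) = 1" for g i
      unfolding p_def using T by (auto intro: softmax_nonneg softmax_le_1 sum_softmax)
    have pm [measurable]: "(\<lambda>g. p g i) \<in> borel_measurable (gaussian K)" for i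
      unfolding p_def by (rule softmax_lin_measurable)
    have Lm [measurable]: "L \<in> borel_measurable (gaussian K)" unfolding L_def by (rule log_sum_exp_lin_measurable)
    have Lb: "\<bar>L g\<bar> \<le> (ln (card T) + (\<Sum>i\<in>T. \<bar>b * c i\<bar>)) + (\<Sum>i\<in>T. \<Sum>k\<in>K. \<bar>b * a i k\<bar>) * (\<Sum>k\<in>K. \<bar>g k\<bar>)" for g
      unfolding L_def by (rule log_sum_exp_lin_bound[OF K T])
    have intL: "integrable (gaussian K) (\<lambda>g. g k * L g)" if "k \<in> K" for k
      by (rule integrable_mult_linear_growth[OF K that Lm Lb])
    have intp: "integrable (gaussian K) (\<lambda>g. p g i)" if "i \<in> T" for i
      by (rule integrable_const_bound[of _ 1]) (use p that in auto)
    have ibp: "(\<integral>g. g k * L g \<partial>gaussian K) = (\<integral>g. (\<Sum>i\<in>T. p g i * (b * a i k)) \<partial>gaussian K)" if k: "k \<in> K" for k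
    proof (rule gaussian_integral_by_parts[OF K k])
      show "((\<lambda>y. L (x(k := y))) has_real_derivative (\<Sum>i\<in>T. p (x(k := y)) i * (b * a i k))) (at y)" for x y
        unfolding L_def p_def
        by (rule log_sum_exp_has_derivative[OF T]) (auto intro!: derivative_eq_intros lin_form_upd_deriv K k)
      have "((\<lambda>y. p (x(k := y)) i) has_real_derivative
         p (x(k := y)) i * (b * a i k - (\<Sum>j\<in>T. p (x(k := y)) j * (b * a j k)))) (at y)" if "i \<in> T" for x y i
        unfolding p_def using T that
        by (intro softmax_has_derivative) (auto intro!: derivative_eq_intros lin_form_upd_deriv K k)
      then have "isCont (\<lambda>y. p (x(k := y)) i) y" if "i \<in> T" for x y i
        using DERIV_isCont that by blast
      then show "isCont (\<lambda>y. \<Sum>i\<in>T. p (x(k := y)) i * (b * a i k)) y" for x y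
        by (intro continuous_intros) auto
      show "\<bar>\<Sum>i\<in>T. p x i * (b * a i k)\<bar> \<le> (\<Sum>i\<in>T. \<bar>b * a i k\<bar>)" for x
        using p by (intro order_trans[OF sum_abs] sum_mono) (simp add: abs_mult[of "p _ _"] mult_left_le_one_le)
      show "(\<lambda>g. \<Sum>i\<in>T. p g i * (b * a i k)) \<in> borel_measurable (gaussian K)"
        by (intro borel_measurable_times borel_measurable_sum pm borel_measurable_const)
      show "integrable (gaussian K) (\<lambda>g. g k * L g)" by (rule intL[OF k])
    qed
    have "(\<integral>g. lin_form K s g * L g \<partial>gaussian K) = (\<Sum>k\<in>K. s k * (\<integral>g. g k * L g \<partial>gaussian K))"
      using intL by (simp add: lin_form_def sum_distrib_right mult.assoc)
    also have "\<dots> = (\<Sum>k\<in>K. s k * (\<Sum>i\<in>T. (\<integral>g. p g i \<partial>gaussian K) * (b * a i k)))"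
      using intp by (intro sum.cong refl) (simp add: ibp)
    also have "\<dots> = (\<Sum>i\<in>T. (\<integral>g. p g i \<partial>gaussian K) * b * (\<Sum>k\<in>K. s k * a i k))"
      by (simp add: sum_distrib_left sum.swap[of _ T K] mult_ac)
    also have "\<dots> = 0" using orth by simp
    finally have z: "(\<integral>g. lin_form K s g * L g \<partial>gaussian K) = 0" .
    have intSL: "integrable (gaussian K) (\<lambda>g. lin_form K s g * L g)" by (rule intm[OF Lm Lb])
    have "?E = (\<integral>g. lin_form K s g * ?M g - (lin_form K s g * L g) / b \<partial>gaussian K)"
      using intM intSL z by simp
    also have "\<bar>\<dots>\<bar> \<le> (\<integral>g. \<bar>lin_form K s g\<bar> * (ln (card T) / b) \<partial>gaussian K)"
    proof (rule order_trans[OF integral_abs_bound], rule integral_mono)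
      show "integrable (gaussian K) (\<lambda>g. \<bar>lin_form K s g * ?M g - (lin_form K s g * L g) / b\<bar>)"
        using intM intSL by auto
      show "integrable (gaussian K) (\<lambda>g. \<bar>lin_form K s g\<bar> * (ln (card T) / b))" using intS by auto
      fix g
      have "Max ((\<lambda>i. lin_form K (a i) g + c i) ` T) \<le> L g / b" "L g / b \<le> ?M g + ln (card T) / b"
        using log_sum_exp_scaled_bounds[OF T b, of "\<lambda>i. lin_form K (a i) g + c i"]
        by (auto simp: scale_lin_form L_def)
      then have "\<bar>?M g - L g / b\<bar> \<le> ln (card T) / b" by linarith
      then have "\<bar>lin_form K s g\<bar> * \<bar>?M g - L g / b\<bar> \<le> \<bar>lin_form K s g\<bar> * (ln (card T) / b)"
        by (rule mult_left_mono) simp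
      then show "\<bar>lin_form K s g * ?M g - (lin_form K s g * L g) / b\<bar> \<le> \<bar>lin_form K s g\<bar> * (ln (card T) / b)"
        by (simp add: right_diff_distrib flip: abs_mult)
    qed
    finally show ?thesis by simp
  qed
  have "((\<lambda>b. (\<integral>g. \<bar>lin_form K s g\<bar> \<partial>gaussian K) * ln (card T) / b) \<longlongrightarrow> 0) at_top"
    by (intro tendsto_divide_0[OF tendsto_const]) (auto intro: filterlim_mono[OF filterlim_ident] at_top_le_at_infinity)
  then have "\<bar>?E\<bar> \<le> 0"
    by (rule tendsto_lowerbound) (use * in \<open>auto intro: eventually_mono[OF eventually_gt_at_top[of 0]]\<close>)
  then show ?thesis by simp
qed

section \<open>Chevet's inequality\<close>

definition euclid_norm :: "nat \<Rightarrow> (nat \<Rightarrow> real) \<Rightarrow> real" where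
  "euclid_norm n u = sqrt (\<Sum>i<n. (u i)\<^sup>2)"

lemma euclid_norm_nonneg [simp]: "0 \<le> euclid_norm n u"
  by (simp add: euclid_norm_def sum_nonneg)

lemma euclid_norm_square: "(euclid_norm n u)\<^sup>2 = (\<Sum>i<n. (u i)\<^sup>2)"
  by (simp add: euclid_norm_def sum_nonneg)

lemma sum_mult_le_euclid_norm: "(\<Sum>i<n. u i * v i) \<le> euclid_norm n u * euclid_norm n v"
proof -
  have "(\<Sum>i<n. u i * v i)\<^sup>2 \<le> (euclid_norm n u * euclid_norm n v)\<^sup>2"
    using Cauchy_Schwarz_ineq_sum[of u v "{..<n}"] by (simp add: power_mult_distrib euclid_norm_square)
  then show ?thesis by (rule power2_le_imp_le) simp
qed

lemma euclid_norm_diff_square: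
  "(\<Sum>i<n. (a * u i - b * v i)\<^sup>2)
     = a\<^sup>2 * (euclid_norm n u)\<^sup>2 + b\<^sup>2 * (euclid_norm n v)\<^sup>2 - 2 * a * b * (\<Sum>i<n. u i * v i)"
proof -
  have "(a * u i - b * v i)\<^sup>2 = a\<^sup>2 * (u i)\<^sup>2 + b\<^sup>2 * (v i)\<^sup>2 - 2 * a * b * (u i * v i)" for i
    by (simp add: power2_eq_square algebra_simps)
  then show ?thesis unfolding euclid_norm_square
    by (simp only: sum.distrib sum_subtractf sum_distrib_left)
qed

lemma gaussian_second_moment:
  assumes "finite K" "k \<in> K" shows "(\<integral>g. (g k)\<^sup>2 \<partial>gaussian K) = 1"
proof -
  have "(\<integral>g. (g k)\<^sup>2 \<partial>gaussian K) = (\<integral>x. x\<^sup>2 \<partial>std_normal_distribution)"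
    by (rule gaussian_integral_component(1)[OF assms]) simp
  then show ?thesis using std_normal_distribution_even_moments(1)[of 1] by (simp add: fact_numeral)
qed

text \<open>Marginals of a product measure: this carries an expectation unchanged into the space
  enlarged by fresh coordinates.\<close>

lemma gaussian_integral_restrict:
  fixes f :: "('i \<Rightarrow> real) \<Rightarrow> real"
  assumes "J \<subseteq> K" "finite K" "f \<in> borel_measurable (gaussian J)"
  shows "(\<integral>g. f (restrict g J) \<partial>gaussian K) = (\<integral>g. f g \<partial>gaussian J)"
proof -
  have d: "gaussian J = distr (gaussian K) (gaussian J) (\<lambda>g. restrict g J)"
    unfolding gaussian_def by (rule gaussian.distr_restrict[OF assms(1,2)])
  have m: "(\<lambda>g. restrict g J) \<in> measurable (gaussian K) (gaussian J)"
    unfolding gaussian_def using assms(1) by (rule measurable_restrict_subset)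
  show ?thesis using integral_distr[OF m assms(3)] unfolding d[symmetric] by (rule sym)
qed

lemma orthonormal_expansion:
  fixes q :: "'a \<Rightarrow> 'i \<Rightarrow> real"
  assumes "finite I" and "\<And>i j. i \<in> I \<Longrightarrow> j \<in> I \<Longrightarrow> (\<Sum>k\<in>K. q i k * q j k) = (if i = j then 1 else 0)"
  shows "(\<Sum>k\<in>K. (\<Sum>i\<in>I. w i * q i k)\<^sup>2) = (\<Sum>i\<in>I. (w i)\<^sup>2)"
proof -
  have "(\<Sum>k\<in>K. (\<Sum>i\<in>I. w i * q i k)\<^sup>2) = (\<Sum>k\<in>K. \<Sum>i\<in>I. \<Sum>j\<in>I. w i * w j * (q i k * q j k))"
    by (simp add: power2_eq_square sum_product mult_ac)
  also have "\<dots> = (\<Sum>i\<in>I. \<Sum>j\<in>I. w i * w j * (\<Sum>k\<in>K. q i k * q j k))"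
    unfolding sum_distrib_left
    by (subst sum.swap, rule sum.cong[OF refl], rule sum.swap)
  also have "\<dots> = (\<Sum>i\<in>I. \<Sum>j\<in>I. if i = j then w i * w j else 0)"
    using assms(2) by (intro sum.cong refl) simp
  also have "\<dots> = (\<Sum>i\<in>I. (w i)\<^sup>2)"
    using assms(1) by (simp add: power2_eq_square)
  finally show ?thesis .
qed

lemma pair_image: "Pair a ` A = {a} \<times> A"
  by auto

lemma sum_singleton_times: "(\<Sum>k\<in>{a} \<times> A. f k) = (\<Sum>b\<in>A. f (a, b))"
  by (simp add: sum.reindex inj_on_def flip: pair_image)

text \<open>Orthonormality of \<open>q\<close> makes the forms \<open>lin_form K (q i j)\<close> the
  entries of a standard Gaussian m x n matrix, whatever coordinates underlie it. The offset - |u|^2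
  |v|^2 takes the place of normalising \<open>u\<close> and \<open>v\<close> and produces second
  moments.\<close>

lemma chevet_finite:
  fixes q :: "nat \<Rightarrow> nat \<Rightarrow> nat \<times> nat \<Rightarrow> real" and u v :: "'a \<Rightarrow> nat \<Rightarrow> real"
  assumes K: "finite K" "K \<subseteq> {..<N} \<times> UNIV" and T: "finite T" "T \<noteq> {}"
    and orthonormal: "\<And>i j i' j'. i < m \<Longrightarrow> j < n \<Longrightarrow> i' < m \<Longrightarrow> j' < n \<Longrightarrow>
      (\<Sum>k\<in>K. q i j k * q i' j' k) = (if i = i' \<and> j = j' then 1 else 0)"
  shows "(\<integral>g. Max ((\<lambda>t. lin_form K (\<lambda>k. 2 * (\<Sum>i<m. \<Sum>j<n. u t i * v t j * q i j k)) g
             + - (euclid_norm m (u t) * euclid_norm n (v t))\<^sup>2) ` T) \<partial>gaussian K) \<le> 2 * (real m + real n)"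
proof -
  \<comment> \<open>The comparison process needs \<open>m + n\<close> further independent Gaussians; they are indexed by the
    rows \<open>N\<close> and \<open>N + 1\<close>, which \<open>K\<close> does not meet.\<close>
  define G where "G = {N} \<times> {..<m}"
  define H where "H = {Suc N} \<times> {..<n}"
  define L where "L = K \<union> (G \<union> H)"
  have fin: "finite G" "finite H" "finite L" and disj: "K \<inter> (G \<union> H) = {}" "G \<inter> H = {}"
    using K by (auto simp: G_def H_def L_def)
  have sumL: "(\<Sum>k\<in>L. f k) = (\<Sum>k\<in>K. f k) + ((\<Sum>b<m. f (N, b)) + (\<Sum>b<n. f (Suc N, b)))" for f :: "_ \<Rightarrow> real"
  proof -
    have "(\<Sum>k\<in>G. f k) = (\<Sum>b<m. f (N, b))" "(\<Sum>k\<in>H. f k) = (\<Sum>b<n. f (Suc N, b))"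
      unfolding G_def H_def by (rule sum_singleton_times)+
    then show ?thesis unfolding L_def using fin K disj by (simp add: sum.union_disjoint)
  qed
  have Kfst: "fst k < N" if "k \<in> K" for k using subsetD[OF K(2) that] by (simp add: mem_Times_iff)
  have notK: "(N, b) \<notin> K" "(Suc N, b) \<notin> K" for b
    by (rule notI, drule Kfst, simp)+
  let ?U = "\<lambda>t. euclid_norm m (u t)" and ?V = "\<lambda>t. euclid_norm n (v t)"
  define a where "a t k = 2 * (\<Sum>i<m. \<Sum>j<n. u t i * v t j * q i j k)" for t k
  define c where "c t = - (?U t * ?V t)\<^sup>2" for t
  define x where "x t k = (if k \<in> K then a t k else 0)" for t k
  \<comment> \<open>Chevet's comparison process: with g, h the two fresh Gaussian vectors it is 2
    (|v| <u, g> + |u| <v, h>). The weights |v| and |u| make it scale like the bilinear form.\<close>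
  define y where "y t k = (if k \<in> K then 0 else if fst k = N then 2 * (?V t * u t (snd k)) else 2 * (?U t * v t (snd k)))" for t k
  have inner: "(\<Sum>k\<in>K. (a s k - a t k)\<^sup>2)
     = 4 * ((?U s * ?V s)\<^sup>2 + (?U t * ?V t)\<^sup>2 - 2 * (\<Sum>i<m. u s i * u t i) * (\<Sum>j<n. v s j * v t j))" for s t
  proof -
    let ?I = "{..<m} \<times> {..<n}"
    let ?w = "\<lambda>z. u s (fst z) * v s (snd z) - u t (fst z) * v t (snd z)"
    have a': "a t k = 2 * (\<Sum>z\<in>?I. u t (fst z) * v t (snd z) * q (fst z) (snd z) k)" for t k
      by (simp only: a_def sum.cartesian_product case_prod_unfold)
    have "a s k - a t k = 2 * (\<Sum>z\<in>?I. ?w z * q (fst z) (snd z) k)" for k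
      unfolding a' by (simp only: left_diff_distrib sum_subtractf right_diff_distrib)
    then have sq: "(a s k - a t k)\<^sup>2 = 4 * (\<Sum>z\<in>?I. ?w z * q (fst z) (snd z) k)\<^sup>2" for k
      by (simp only: power_mult_distrib) simp
    have "(\<Sum>k\<in>K. (a s k - a t k)\<^sup>2) = 4 * (\<Sum>k\<in>K. (\<Sum>z\<in>?I. ?w z * q (fst z) (snd z) k)\<^sup>2)"
      by (simp only: sq sum_distrib_left)
    also have "(\<Sum>k\<in>K. (\<Sum>z\<in>?I. ?w z * q (fst z) (snd z) k)\<^sup>2) = (\<Sum>z\<in>?I. (?w z)\<^sup>2)"
    proof (rule orthonormal_expansion)
      fix y z assume "y \<in> ?I" "z \<in> ?I"
      then show "(\<Sum>k\<in>K. q (fst y) (snd y) k * q (fst z) (snd z) k) = (if y = z then 1 else 0)"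
        using orthonormal[of "fst y" "snd y" "fst z" "snd z"] by (simp add: mem_Times_iff prod_eq_iff)
    qed simp
    also have "\<dots> = (\<Sum>i<m. \<Sum>j<n. (u s i * v s j - u t i * v t j)\<^sup>2)"
      by (simp only: sum.cartesian_product case_prod_unfold)
    also have "\<dots> = (\<Sum>i<m. (u s i)\<^sup>2 * (?V s)\<^sup>2 + (u t i)\<^sup>2 * (?V t)\<^sup>2 - 2 * (u s i * u t i) * (\<Sum>j<n. v s j * v t j))"
      by (simp only: euclid_norm_diff_square mult.assoc)
    also have "\<dots> = (?U s * ?V s)\<^sup>2 + (?U t * ?V t)\<^sup>2 - 2 * (\<Sum>i<m. u s i * u t i) * (\<Sum>j<n. v s j * v t j)"
    proof -
      have "(\<Sum>i<m. (u s i)\<^sup>2 * P + (u t i)\<^sup>2 * Q - 2 * (u s i * u t i) * W)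
          = (?U s)\<^sup>2 * P + (?U t)\<^sup>2 * Q - 2 * (\<Sum>i<m. u s i * u t i) * W" for P Q W
        by (simp only: sum.distrib sum_subtractf euclid_norm_square sum_distrib_right sum_distrib_left)
      then show ?thesis by (simp only: power_mult_distrib)
    qed
    finally show ?thesis .
  qed
  have intY: "(\<Sum>k\<in>L. (y s k - y t k)\<^sup>2)
     = 4 * (2 * (?U s * ?V s)\<^sup>2 + 2 * (?U t * ?V t)\<^sup>2
        - 2 * (?V s * ?V t) * (\<Sum>i<m. u s i * u t i) - 2 * (?U s * ?U t) * (\<Sum>j<n. v s j * v t j))" for s t
  proof -
    have "(2 * a - 2 * b)\<^sup>2 = 4 * (a - b)\<^sup>2" for a b :: real by (simp add: power2_eq_square algebra_simps)
    then have "(\<Sum>k\<in>L. (y s k - y t k)\<^sup>2)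
      = 4 * ((\<Sum>b<m. (?V s * u s b - ?V t * u t b)\<^sup>2) + (\<Sum>b<n. (?U s * v s b - ?U t * v t b)\<^sup>2))"
      by (simp add: sumL y_def notK sum_distrib_left)
    then show ?thesis unfolding euclid_norm_diff_square by (simp add: power_mult_distrib algebra_simps)
  qed
  have eqX: "lin_form L (x t) g = lin_form K (a t) g" for t g
    unfolding lin_form_def sumL x_def by (simp add: notK)
  have "(\<integral>g. Max ((\<lambda>t. lin_form K (a t) g + c t) ` T) \<partial>gaussian K)
      = (\<integral>g. Max ((\<lambda>t. lin_form L (x t) g + c t) ` T) \<partial>gaussian L)"
  proof -
    have restr: "lin_form K (a t) (restrict g K) = lin_form K (a t) g" for t g
      unfolding lin_form_def by (intro sum.cong) auto
    have "K \<subseteq> L" by (auto simp: L_def)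
    from gaussian_integral_restrict[OF this fin(3) borel_measurable_integrable[OF integrable_Max_lin[OF K(1) T, of a c]]]
    show ?thesis unfolding eqX restr by (rule sym)
  qed
  also have "\<dots> \<le> (\<integral>g. Max ((\<lambda>t. lin_form L (y t) g + c t) ` T) \<partial>gaussian L)"
  proof (rule gaussian_max_comparison[OF fin(3) T])
    fix s t
    show "(\<Sum>k\<in>L. x s k * y t k) = 0" by (intro sum.neutral) (auto simp: x_def y_def)
    have "(\<Sum>k\<in>L. (x s k - x t k)\<^sup>2) = (\<Sum>k\<in>K. (a s k - a t k)\<^sup>2)"
      unfolding sumL x_def by (simp add: notK)
    also have "\<dots> \<le> (\<Sum>k\<in>L. (y s k - y t k)\<^sup>2)"
    proof -
      let ?a = "\<Sum>i<m. u s i * u t i" and ?b = "\<Sum>j<n. v s j * v t j"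
      \<comment> \<open>Up to the factor 4, the gap between the squared increments is (|u_s| |v_s| -
        |u_t| |v_t|)^2 plus twice this product, whose factors are nonnegative by
        Cauchy-Schwarz.\<close>
      have "0 \<le> (?U s * ?U t - ?a) * (?V s * ?V t - ?b)"
        by (intro mult_nonneg_nonneg) (simp_all add: sum_mult_le_euclid_norm)
      moreover have "2 * (?U s * ?V s) * (?U t * ?V t) \<le> (?U s * ?V s)\<^sup>2 + (?U t * ?V t)\<^sup>2"
        by (rule sum_squares_bound)
      ultimately have "(?U s * ?V s)\<^sup>2 + (?U t * ?V t)\<^sup>2 - 2 * ?a * ?b
         \<le> 2 * (?U s * ?V s)\<^sup>2 + 2 * (?U t * ?V t)\<^sup>2 - 2 * (?V s * ?V t) * ?a - 2 * (?U s * ?U t) * ?b"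
        by (simp add: algebra_simps)
      then show ?thesis unfolding inner intY by simp
    qed
    finally show "(\<Sum>k\<in>L. (x s k - x t k)\<^sup>2) \<le> (\<Sum>k\<in>L. (y s k - y t k)\<^sup>2)" .
  qed
  also have "\<dots> \<le> (\<integral>g. 2 * (\<Sum>k\<in>G \<union> H. (g k)\<^sup>2) \<partial>gaussian L)"
  proof (rule integral_mono)
    show "integrable (gaussian L) (\<lambda>g. Max ((\<lambda>t. lin_form L (y t) g + c t) ` T))"
      by (rule integrable_Max_lin[OF fin(3) T])
    show "integrable (gaussian L) (\<lambda>g. 2 * (\<Sum>k\<in>G \<union> H. (g k)\<^sup>2))"
      by (intro integrable_mult_right Bochner_Integration.integrable_sum gaussian_square_integrable fin) (simp add: L_def)
    fix g :: "nat \<times> nat \<Rightarrow> real"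
    let ?g = "euclid_norm m (\<lambda>b. g (N, b))" and ?h = "euclid_norm n (\<lambda>b. g (Suc N, b))"
    have "lin_form L (y t) g + c t \<le> 2 * (\<Sum>k\<in>G \<union> H. (g k)\<^sup>2)" for t
    proof -
      have "lin_form L (y t) g = 2 * (?V t * (\<Sum>b<m. u t b * g (N, b)) + ?U t * (\<Sum>b<n. v t b * g (Suc N, b)))"
        unfolding lin_form_def sumL y_def by (simp add: notK sum_distrib_left mult_ac)
      also have "\<dots> \<le> 2 * (?V t * (?U t * ?g) + ?U t * (?V t * ?h))"
        by (intro mult_left_mono add_mono sum_mult_le_euclid_norm) auto
      also have "\<dots> = 2 * (?U t * ?V t) * (?g + ?h)" by (simp add: algebra_simps)
      \<comment> \<open>The square of |u| |v| produced here is cancelled by the offset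
        \<open>c t\<close>, so the resulting bound does not depend on \<open>t\<close>.\<close>
      also have "\<dots> \<le> (?U t * ?V t)\<^sup>2 + (?g + ?h)\<^sup>2" by (rule sum_squares_bound)
      \<comment> \<open>The source of the factor 2 in the final constant.\<close>
      also have "(?g + ?h)\<^sup>2 \<le> 2 * (?g\<^sup>2 + ?h\<^sup>2)"
        using sum_squares_bound[of ?g ?h] by (simp add: power2_sum)
      also have "?g\<^sup>2 + ?h\<^sup>2 = (\<Sum>k\<in>G \<union> H. (g k)\<^sup>2)"
        using fin disj by (simp add: euclid_norm_square sum.union_disjoint G_def H_def sum_singleton_times)
      finally show ?thesis by (simp add: c_def)
    qed
    then show "Max ((\<lambda>t. lin_form L (y t) g + c t) ` T) \<le> 2 * (\<Sum>k\<in>G \<union> H. (g k)\<^sup>2)"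
      using T by (subst Max_le_iff) auto
  qed
  also have "\<dots> = 2 * (\<Sum>k\<in>G \<union> H. 1)"
  proof -
    have "(\<integral>g. 2 * (\<Sum>k\<in>G \<union> H. (g k)\<^sup>2) \<partial>gaussian L) = 2 * (\<Sum>k\<in>G \<union> H. (\<integral>g. (g k)\<^sup>2 \<partial>gaussian L))"
      using fin by (simp add: Bochner_Integration.integral_sum gaussian_square_integrable L_def)
    also have "\<dots> = 2 * (\<Sum>k\<in>G \<union> H. 1)"
      using fin(3) by (intro arg_cong[where f="(*) 2"] sum.cong refl gaussian_second_moment) (auto simp: L_def)
    finally show ?thesis .
  qed
  also have "\<dots> = 2 * (real m + real n)"
    using fin disj by (simp add: card_Un_disjoint G_def H_def)
  finally show ?thesis by (simp only: a_def[abs_def] c_def)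
qed

text \<open>Integration by parts with a constant derivative: the mean of \<open>g k\<close> times
  the form is \<open>a k\<close>.\<close>

lemma gaussian_lin_form_square:
  assumes K: "finite K"
  shows "integrable (gaussian K) (\<lambda>g. (lin_form K a g)\<^sup>2)"
    and "(\<integral>g. (lin_form K a g)\<^sup>2 \<partial>gaussian K) = (\<Sum>k\<in>K. (a k)\<^sup>2)"
proof -
  interpret prob_space "gaussian K" by (rule prob_space_gaussian)
  have eq: "(lin_form K a g)\<^sup>2 = (\<Sum>k\<in>K. a k * (g k * lin_form K a g))" for g
    unfolding power2_eq_square by (subst (1) lin_form_def) (simp only: sum_distrib_right mult.assoc)
  have int: "integrable (gaussian K) (\<lambda>g. g k * lin_form K a g)" if "k \<in> K" for k
    by (rule integrable_mult_linear_growth[OF K that lin_form_measurable, where A=0 and B="\<Sum>k\<in>K. \<bar>a k\<bar>"])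
       (simp add: lin_form_bound[OF K])
  show "integrable (gaussian K) (\<lambda>g. (lin_form K a g)\<^sup>2)"
    unfolding eq by (intro Bochner_Integration.integrable_sum integrable_mult_right int)
  have "(\<integral>g. g k * lin_form K a g \<partial>gaussian K) = (\<integral>g. a k \<partial>gaussian K)" if k: "k \<in> K" for k
    by (rule gaussian_integral_by_parts[OF K k _ _ _ _ int[OF k], where C="\<bar>a k\<bar>"])
       (simp_all add: lin_form_upd_deriv[OF K k])
  then have "(\<integral>g. g k * lin_form K a g \<partial>gaussian K) = a k" if k: "k \<in> K" for k
    using k by (simp add: prob_space)
  then show "(\<integral>g. (lin_form K a g)\<^sup>2 \<partial>gaussian K) = (\<Sum>k\<in>K. (a k)\<^sup>2)"
    unfolding eq using int by (simp add: Bochner_Integration.integral_sum power2_eq_square)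
qed

section \<open>The operator norm as a countable supremum\<close>

lemma rational_sequences: "\<exists>r :: nat \<Rightarrow> real \<Rightarrow> rat. \<forall>x. (\<lambda>k. real_of_rat (r k x)) \<longlonglongrightarrow> x"
proof -
  define r where "r k x = (SOME y. x < real_of_rat y \<and> real_of_rat y < x + inverse (real (Suc k)))" for k x
  have r: "x < real_of_rat (r k x) \<and> real_of_rat (r k x) < x + inverse (real (Suc k))" for k x
    unfolding r_def by (rule someI_ex, rule of_rat_dense) simp
  have "(\<lambda>k. real_of_rat (r k x)) \<longlonglongrightarrow> x" for x
  proof (rule real_tendsto_sandwich)
    show "\<forall>\<^sub>F k in sequentially. x \<le> real_of_rat (r k x)"
      using r by (intro always_eventually allI less_imp_le) blast
    show "\<forall>\<^sub>F k in sequentially. real_of_rat (r k x) \<le> x + inverse (real (Suc k))"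
      using r by (intro always_eventually allI less_imp_le) blast
    show "(\<lambda>k. x + inverse (real (Suc k))) \<longlonglongrightarrow> x" by (rule LIMSEQ_inverse_real_of_nat_add)
  qed simp
  then show ?thesis by blast
qed

text \<open>Finite lists of rationals are countable, so a supremum over them is a limit of maxima
  over finite sets and hence measurable. Padding by zero lets one type of list serve both
  dimensions.\<close>

definition rat_vec :: "rat list \<Rightarrow> nat \<Rightarrow> real" where
  "rat_vec l i = (if i < length l then real_of_rat (l ! i) else 0)"

text \<open>Supplies the integrable majorant: the operator norm is at most the Frobenius norm, whose
  square is a sum of squared linear forms.\<close>

lemma bilinear_le_frobenius:
  "(\<Sum>i<m. \<Sum>j<n. u i * v j * H i j) \<le> euclid_norm m u * euclid_norm n v * sqrt (\<Sum>i<m. \<Sum>j<n. (H i j)\<^sup>2)"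
proof -
  let ?I = "{..<m} \<times> {..<n}"
  have "(\<Sum>z\<in>?I. u (fst z) * v (snd z) * H (fst z) (snd z))\<^sup>2
      \<le> (\<Sum>z\<in>?I. (u (fst z) * v (snd z))\<^sup>2) * (\<Sum>z\<in>?I. (H (fst z) (snd z))\<^sup>2)"
    by (rule Cauchy_Schwarz_ineq_sum)
  then have le: "(\<Sum>i<m. \<Sum>j<n. u i * v j * H i j)\<^sup>2 \<le> (\<Sum>i<m. \<Sum>j<n. (u i * v j)\<^sup>2) * (\<Sum>i<m. \<Sum>j<n. (H i j)\<^sup>2)"
    by (simp only: sum.cartesian_product case_prod_unfold)
  have "(\<Sum>i<m. \<Sum>j<n. (u i * v j)\<^sup>2) = (euclid_norm m u * euclid_norm n v)\<^sup>2"
    by (simp only: power_mult_distrib euclid_norm_square sum_product)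
  moreover have "(\<Sum>i<m. \<Sum>j<n. (H i j)\<^sup>2) = (sqrt (\<Sum>i<m. \<Sum>j<n. (H i j)\<^sup>2))\<^sup>2"
    by (simp add: sum_nonneg)
  ultimately have "(\<Sum>i<m. \<Sum>j<n. u i * v j * H i j)\<^sup>2
     \<le> (euclid_norm m u * euclid_norm n v * sqrt (\<Sum>i<m. \<Sum>j<n. (H i j)\<^sup>2))\<^sup>2"
    using le by (simp only: power_mult_distrib)
  then show ?thesis
    by (rule power2_le_imp_le) (intro mult_nonneg_nonneg euclid_norm_nonneg real_sqrt_ge_zero sum_nonneg zero_le_power2)
qed

text \<open>\<tau> is the operator norm of the matrix with entries
  \<open>lin_form K (q i j)\<close>, obtained as a limit of maxima over rational vectors. The last
  clause makes the cross term vanish: forms orthogonal to all \<open>q i j\<close> are uncorrelated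
  with \<tau>.\<close>

theorem gaussian_operator_norm:
  fixes q :: "nat \<Rightarrow> nat \<Rightarrow> nat \<times> nat \<Rightarrow> real"
  assumes K: "finite K" "K \<subseteq> {..<N} \<times> UNIV"
    and orthonormal: "\<And>i j i' j'. i < m \<Longrightarrow> j < n \<Longrightarrow> i' < m \<Longrightarrow> j' < n \<Longrightarrow>
      (\<Sum>k\<in>K. q i j k * q i' j' k) = (if i = i' \<and> j = j' then 1 else 0)"
  obtains \<tau> :: "(nat \<times> nat \<Rightarrow> real) \<Rightarrow> real" where
    "\<And>g. 0 \<le> \<tau> g"
    "\<And>g u v. (\<Sum>i<m. \<Sum>j<n. u i * v j * lin_form K (q i j) g) \<le> \<tau> g * (euclid_norm m u * euclid_norm n v)"
    "integrable (gaussian K) (\<lambda>g. (\<tau> g)\<^sup>2)"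
    "(\<integral>g. (\<tau> g)\<^sup>2 \<partial>gaussian K) \<le> 2 * (real m + real n)"
    "\<And>s. \<forall>i<m. \<forall>j<n. (\<Sum>k\<in>K. s k * q i j k) = 0 \<Longrightarrow>
       integrable (gaussian K) (\<lambda>g. lin_form K s g * \<tau> g) \<and> (\<integral>g. lin_form K s g * \<tau> g \<partial>gaussian K) = 0"
proof -
  define B where "B u v g = (\<Sum>i<m. \<Sum>j<n. u i * v j * lin_form K (q i j) g)" for u v g
  define b where "b t k = (\<Sum>i<m. \<Sum>j<n. rat_vec (fst t) i * rat_vec (snd t) j * q i j k)" for t k
  define Bt where "Bt t g = B (rat_vec (fst t)) (rat_vec (snd t)) g" for t g
  define nrm where "nrm t = euclid_norm m (rat_vec (fst t)) * euclid_norm n (rat_vec (snd t))" for t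
  define F where "F g = sqrt (\<Sum>i<m. \<Sum>j<n. (lin_form K (q i j) g)\<^sup>2)" for g
  \<comment> \<open>These finite sets increase to all pairs of rational lists. The empty lists stand
    for zero vectors; including them keeps every set nonempty and both maxima nonnegative.\<close>
  define T :: "nat \<Rightarrow> (rat list \<times> rat list) set" where "T r = insert ([], []) (from_nat ` {..r})" for r
  \<comment> \<open>\<open>M r\<close> and \<open>L r\<close> increase to the operator norm and to its square: \<open>M\<close> is a maximum of linear
    forms, so its covariance with uncorrelated forms vanishes, while \<open>L\<close> has the offsets of
    \<open>chevet_finite\<close>. Where \<open>nrm t = 0\<close> the quotient in \<open>M\<close> is \<open>0\<close>.\<close>
  define M where "M r g = Max ((\<lambda>t. lin_form K (\<lambda>k. b t k / nrm t) g + 0) ` T r)" for r g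
  define L where "L r g = Max ((\<lambda>t. lin_form K (\<lambda>k. 2 * b t k) g + - (nrm t)\<^sup>2) ` T r)" for r g
  have T: "finite (T r)" "T r \<noteq> {}" for r by (simp_all add: T_def)
  have Tmem: "t \<in> T (to_nat t)" for t unfolding T_def by (metis atMost_iff from_nat_to_nat imageI insertI2 order_refl)
  have Tmono: "T r \<subseteq> T s" if "r \<le> s" for r s using that by (auto simp: T_def)
  have nrm0: "0 \<le> nrm t" for t by (simp add: nrm_def)
  have F0: "0 \<le> F g" for g by (simp add: F_def sum_nonneg)
  have lb: "lin_form K (b t) g = Bt t g" for t g
  proof -
    have "lin_form K (b t) g = (\<Sum>i<m. \<Sum>j<n. \<Sum>k\<in>K. rat_vec (fst t) i * rat_vec (snd t) j * q i j k * g k)"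
      unfolding lin_form_def b_def sum_distrib_right
      by (subst sum.swap, rule sum.cong[OF refl], rule sum.swap)
    then show ?thesis by (simp only: Bt_def B_def lin_form_def sum_distrib_left mult.assoc)
  qed
  have Mt: "lin_form K (\<lambda>k. b t k / nrm t) g + 0 = Bt t g / nrm t" for t g
    unfolding lb[symmetric] lin_form_def by (simp add: sum_divide_distrib)
  have Lt: "lin_form K (\<lambda>k. 2 * b t k) g + - (nrm t)\<^sup>2 = 2 * Bt t g - (nrm t)\<^sup>2" for t g
    unfolding lb[symmetric] lin_form_def by (simp add: sum_distrib_left mult.assoc)
  have BF: "Bt t g \<le> nrm t * F g" for t g
    unfolding Bt_def B_def nrm_def F_def by (rule bilinear_le_frobenius)
  have zero: "Bt ([], []) g = 0" "nrm ([], []) = 0" for g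
    by (simp_all add: Bt_def B_def rat_vec_def nrm_def euclid_norm_def)
  have M_ge: "Bt t g / nrm t \<le> M r g" if "t \<in> T r" for t r g
    unfolding M_def Mt by (rule Max_ge) (use T that in auto)
  have M_le: "M r g \<le> c" if "\<And>t. t \<in> T r \<Longrightarrow> Bt t g / nrm t \<le> c" for r g c
    unfolding M_def Mt by (rule Max.boundedI) (use T that in auto)
  have L_ge: "2 * Bt t g - (nrm t)\<^sup>2 \<le> L r g" if "t \<in> T r" for t r g
    unfolding L_def Lt by (rule Max_ge) (use T that in auto)
  have L_le: "L r g \<le> c" if "\<And>t. t \<in> T r \<Longrightarrow> 2 * Bt t g - (nrm t)\<^sup>2 \<le> c" for r g c
    unfolding L_def Lt by (rule Max.boundedI) (use T that in auto)
  have M_F: "M r g \<le> F g" for r g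
  proof (rule M_le)
    fix t show "Bt t g / nrm t \<le> F g"
      using BF[of t g] F0[of g] nrm0[of t] by (cases "nrm t = 0") (simp_all add: divide_le_eq mult.commute)
  qed
  have M0: "0 \<le> M r g" for r g
    using M_ge[of "([], [])" r g] by (simp add: T_def zero)
  have M_inc: "incseq (\<lambda>r. M r g)" for g
    by (rule incseq_SucI, rule M_le, rule M_ge) (rule subsetD[OF Tmono[OF le_SucI[OF order_refl]]])
  have L_inc: "incseq (\<lambda>r. L r g)" for g
    by (rule incseq_SucI, rule L_le, rule L_ge) (rule subsetD[OF Tmono[OF le_SucI[OF order_refl]]])
  define \<tau> where "\<tau> g = (SUP r. M r g)" for g
  have bddM: "bdd_above (range (\<lambda>r. M r g))" for g using M_F by (intro bdd_aboveI2)
  have M_lim: "(\<lambda>r. M r g) \<longlonglongrightarrow> \<tau> g" for g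
    unfolding \<tau>_def by (rule LIMSEQ_incseq_SUP[OF bddM M_inc])
  have M_\<tau>: "M r g \<le> \<tau> g" for r g unfolding \<tau>_def by (rule cSUP_upper[OF UNIV_I bddM])
  have \<tau>0: "0 \<le> \<tau> g" for g using M0[of 0 g] M_\<tau>[of 0 g] by linarith
  have \<tau>F: "\<tau> g \<le> F g" for g unfolding \<tau>_def by (rule cSUP_least) (simp_all add: M_F)
  have Bt_\<tau>: "Bt t g \<le> \<tau> g * nrm t" for t g
  proof (cases "nrm t = 0")
    case True then show ?thesis using BF[of t g] by simp
  next
    case False
    then have "0 < nrm t" using nrm0[of t] by simp
    moreover have "Bt t g / nrm t \<le> \<tau> g" using M_ge[OF Tmem] M_\<tau> by (rule order_trans)
    ultimately show ?thesis by (simp add: divide_le_eq)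
  qed
  obtain r :: "nat \<Rightarrow> real \<Rightarrow> rat" where r: "\<And>x. (\<lambda>k. real_of_rat (r k x)) \<longlonglongrightarrow> x"
    using rational_sequences by blast
  \<comment> \<open>Both sides are continuous in \<open>u\<close> and \<open>v\<close>, so the
    inequality passes from rational to real vectors by coordinatewise approximation.\<close>
  have bound: "B u v g \<le> \<tau> g * (euclid_norm m u * euclid_norm n v)" for u v g
  proof (rule LIMSEQ_le)
    define t where "t k = (map (\<lambda>i. r k (u i)) [0..<m], map (\<lambda>j. r k (v j)) [0..<n])" for k
    have t: "i < m \<Longrightarrow> rat_vec (fst (t k)) i = real_of_rat (r k (u i))"
      "j < n \<Longrightarrow> rat_vec (snd (t k)) j = real_of_rat (r k (v j))" for i j k
      by (simp_all add: t_def rat_vec_def)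
    have "Bt (t k) g = (\<Sum>i<m. \<Sum>j<n. real_of_rat (r k (u i)) * real_of_rat (r k (v j)) * lin_form K (q i j) g)" for k
      unfolding Bt_def B_def by (intro sum.cong refl) (simp only: t lessThan_iff)
    moreover have "(\<lambda>k. \<Sum>i<m. \<Sum>j<n. real_of_rat (r k (u i)) * real_of_rat (r k (v j)) * lin_form K (q i j) g) \<longlonglongrightarrow> B u v g"
      unfolding B_def by (intro tendsto_sum tendsto_mult tendsto_const r)
    ultimately show "(\<lambda>k. Bt (t k) g) \<longlonglongrightarrow> B u v g" by simp
    have "nrm (t k) = sqrt (\<Sum>i<m. (real_of_rat (r k (u i)))\<^sup>2) * sqrt (\<Sum>i<n. (real_of_rat (r k (v i)))\<^sup>2)" for k
      unfolding nrm_def euclid_norm_def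
      by (intro arg_cong2[where f="(*)"] arg_cong[where f=sqrt] sum.cong refl) (simp_all only: t lessThan_iff)
    moreover have "(\<lambda>k. sqrt (\<Sum>i<m. (real_of_rat (r k (u i)))\<^sup>2) * sqrt (\<Sum>i<n. (real_of_rat (r k (v i)))\<^sup>2))
        \<longlonglongrightarrow> euclid_norm m u * euclid_norm n v"
      unfolding euclid_norm_def by (intro tendsto_mult tendsto_real_sqrt tendsto_sum tendsto_power r)
    ultimately show "(\<lambda>k. \<tau> g * nrm (t k)) \<longlonglongrightarrow> \<tau> g * (euclid_norm m u * euclid_norm n v)"
      by (intro tendsto_mult tendsto_const) simp
    show "\<exists>N. \<forall>k\<ge>N. Bt (t k) g \<le> \<tau> g * nrm (t k)" using Bt_\<tau> by blast
  qed
  have L_\<tau>: "L r g \<le> (\<tau> g)\<^sup>2" for r g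
  proof (rule L_le)
    fix t
    have "2 * \<tau> g * nrm t \<le> (\<tau> g)\<^sup>2 + (nrm t)\<^sup>2" by (rule sum_squares_bound)
    with Bt_\<tau>[of t g] show "2 * Bt t g - (nrm t)\<^sup>2 \<le> (\<tau> g)\<^sup>2" by linarith
  qed
  have L0: "0 \<le> L r g" for r g
    using L_ge[of "([], [])" r g] by (simp add: T_def zero)
  have bddL: "bdd_above (range (\<lambda>r. L r g))" for g using L_\<tau> by (intro bdd_aboveI2)
  \<comment> \<open>The substantial half is \<tau>^2 <= \<Lambda>. Scaling the first vector by
    \<open>c\<close> turns the process value into 2 c B - c^2 N^2, with B the form and N the product
    of the norms; its supremum over real \<open>c\<close> is (B / N)^2. Rational \<open>c\<close>
    stay inside the index set and approach the optimum.\<close>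
  have L_lim: "(\<lambda>r. L r g) \<longlonglongrightarrow> (\<tau> g)\<^sup>2" for g
  proof -
    define \<Lambda> where "\<Lambda> = (SUP r. L r g)"
    have lim: "(\<lambda>r. L r g) \<longlonglongrightarrow> \<Lambda>" unfolding \<Lambda>_def by (rule LIMSEQ_incseq_SUP[OF bddL L_inc])
    have L_\<Lambda>: "L r g \<le> \<Lambda>" for r unfolding \<Lambda>_def by (rule cSUP_upper[OF UNIV_I bddL])
    have \<Lambda>0: "0 \<le> \<Lambda>" using L0[of 0 g] L_\<Lambda>[of 0] by linarith
    have "Bt t g / nrm t \<le> sqrt \<Lambda>" for t
    proof (cases "nrm t = 0")
      case True then show ?thesis using \<Lambda>0 by simp
    next
      case False
      \<comment> \<open>the maximiser of \<open>2 c Bt t g - (c nrm t)\<^sup>2\<close> over real \<open>c\<close>\<close>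
      define x where "x = Bt t g / (nrm t)\<^sup>2"
      have scaled: "2 * (real_of_rat c * Bt t g) - (real_of_rat c * nrm t)\<^sup>2 \<le> \<Lambda>" for c
      proof -
        define t' where "t' = (map ((*) c) (fst t), snd t)"
        have v: "rat_vec (fst t') i = real_of_rat c * rat_vec (fst t) i" "snd t' = snd t" for i
          by (simp_all add: t'_def rat_vec_def of_rat_mult)
        have "Bt t' g = real_of_rat c * Bt t g"
          by (simp add: Bt_def B_def v sum_distrib_left mult.assoc)
        moreover have "(nrm t')\<^sup>2 = (real_of_rat c * nrm t)\<^sup>2"
        proof -
          have "(euclid_norm m (rat_vec (fst t')))\<^sup>2 = (real_of_rat c)\<^sup>2 * (euclid_norm m (rat_vec (fst t)))\<^sup>2"
            by (simp only: euclid_norm_square v power_mult_distrib sum_distrib_left)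
          then show ?thesis by (simp only: nrm_def power_mult_distrib v(2) mult.assoc)
        qed
        ultimately show ?thesis using order_trans[OF L_ge[OF Tmem[of t'], of g] L_\<Lambda>] by simp
      qed
      have "2 * (x * Bt t g) - (x * nrm t)\<^sup>2 \<le> \<Lambda>"
      proof (rule LIMSEQ_le_const2)
        show "(\<lambda>k. 2 * (real_of_rat (r k x) * Bt t g) - (real_of_rat (r k x) * nrm t)\<^sup>2)
           \<longlonglongrightarrow> 2 * (x * Bt t g) - (x * nrm t)\<^sup>2"
          by (intro tendsto_intros r)
        show "\<exists>N. \<forall>k\<ge>N. 2 * (real_of_rat (r k x) * Bt t g) - (real_of_rat (r k x) * nrm t)\<^sup>2 \<le> \<Lambda>"
          using scaled by blast
      qed
      also have "2 * (x * Bt t g) - (x * nrm t)\<^sup>2 = (Bt t g / nrm t)\<^sup>2"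
        using False by (simp add: x_def field_simps power2_eq_square)
      finally show ?thesis by (rule real_le_rsqrt)
    qed
    then have "\<tau> g \<le> sqrt \<Lambda>" unfolding \<tau>_def by (intro cSUP_least M_le) auto
    then have "(\<tau> g)\<^sup>2 \<le> (sqrt \<Lambda>)\<^sup>2" by (rule power_mono[OF _ \<tau>0])
    then have "(\<tau> g)\<^sup>2 \<le> \<Lambda>" using \<Lambda>0 by simp
    moreover have "\<Lambda> \<le> (\<tau> g)\<^sup>2" by (rule LIMSEQ_le_const2[OF lim]) (use L_\<tau> in blast)
    ultimately show ?thesis using lim by simp
  qed
  have Mm: "(\<lambda>g. M r g) \<in> borel_measurable (gaussian K)" for r
    unfolding M_def by (rule borel_measurable_integrable[OF integrable_Max_lin[OF K(1) T]])
  have Lm: "(\<lambda>g. L r g) \<in> borel_measurable (gaussian K)" for r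
    unfolding L_def by (rule borel_measurable_integrable[OF integrable_Max_lin[OF K(1) T]])
  have \<tau>m: "\<tau> \<in> borel_measurable (gaussian K)"
    by (rule borel_measurable_LIMSEQ_real[OF M_lim Mm])
  have F2: "(F g)\<^sup>2 = (\<Sum>i<m. \<Sum>j<n. (lin_form K (q i j) g)\<^sup>2)" for g
    by (simp add: F_def sum_nonneg)
  have intF: "integrable (gaussian K) (\<lambda>g. (F g)\<^sup>2)"
    unfolding F2 by (intro Bochner_Integration.integrable_sum gaussian_lin_form_square(1) K)
  have \<tau>F2: "(\<tau> g)\<^sup>2 \<le> (F g)\<^sup>2" for g by (rule power_mono[OF \<tau>F \<tau>0])
  have \<tau>2m: "(\<lambda>g. (\<tau> g)\<^sup>2) \<in> borel_measurable (gaussian K)" by (intro borel_measurable_power \<tau>m)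
  have int\<tau>: "integrable (gaussian K) (\<lambda>g. (\<tau> g)\<^sup>2)"
    by (rule Bochner_Integration.integrable_bound[OF intF \<tau>2m]) (simp add: \<tau>F2)
  have E: "(\<integral>g. (\<tau> g)\<^sup>2 \<partial>gaussian K) \<le> 2 * (real m + real n)"
  proof (rule LIMSEQ_le_const2)
    show "(\<lambda>r. \<integral>g. L r g \<partial>gaussian K) \<longlonglongrightarrow> (\<integral>g. (\<tau> g)\<^sup>2 \<partial>gaussian K)"
    proof (rule integral_dominated_convergence[OF \<tau>2m Lm intF])
      show "AE g in gaussian K. (\<lambda>r. L r g) \<longlonglongrightarrow> (\<tau> g)\<^sup>2" by (intro AE_I2 L_lim)
      show "AE g in gaussian K. norm (L r g) \<le> (F g)\<^sup>2" for r
        by (intro AE_I2) (simp add: L0 order_trans[OF L_\<tau> \<tau>F2])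
    qed
    have "(\<integral>g. L r g \<partial>gaussian K) \<le> 2 * (real m + real n)" for r
      unfolding L_def b_def nrm_def
      by (rule chevet_finite[OF K T orthonormal])
    then show "\<exists>N. \<forall>r\<ge>N. (\<integral>g. L r g \<partial>gaussian K) \<le> 2 * (real m + real n)" by blast
  qed
  \<comment> \<open>The covariance with each finite maximum \<open>M r\<close> is zero and passes to
    the limit; the majorant is the square of the form plus \<open>(F g)^2\<close>, by the
    arithmetic-geometric mean inequality.\<close>
  have cross: "integrable (gaussian K) (\<lambda>g. lin_form K s g * \<tau> g) \<and> (\<integral>g. lin_form K s g * \<tau> g \<partial>gaussian K) = 0"
    if s: "\<forall>i<m. \<forall>j<n. (\<Sum>k\<in>K. s k * q i j k) = 0" for s
  proof
    have intw: "integrable (gaussian K) (\<lambda>g. (lin_form K s g)\<^sup>2 + (F g)\<^sup>2)"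
      by (intro Bochner_Integration.integrable_add gaussian_lin_form_square(1) K intF)
    have dom: "norm (lin_form K s g * x) \<le> (lin_form K s g)\<^sup>2 + (F g)\<^sup>2" if "0 \<le> x" "x \<le> F g" for g x
    proof -
      have "norm (lin_form K s g * x) \<le> \<bar>lin_form K s g\<bar> * F g"
        using that by (simp add: abs_mult mult_left_mono)
      moreover have "2 * \<bar>lin_form K s g\<bar> * F g \<le> \<bar>lin_form K s g\<bar>\<^sup>2 + (F g)\<^sup>2" by (rule sum_squares_bound)
      moreover have "0 \<le> \<bar>lin_form K s g\<bar> * F g" using F0 by simp
      ultimately show ?thesis by simp
    qed
    have sm: "(\<lambda>g. lin_form K s g * \<tau> g) \<in> borel_measurable (gaussian K)"
      by (intro borel_measurable_times lin_form_measurable \<tau>m)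
    show "integrable (gaussian K) (\<lambda>g. lin_form K s g * \<tau> g)"
    proof (rule Bochner_Integration.integrable_bound[OF intw sm], rule AE_I2)
      fix g
      show "norm (lin_form K s g * \<tau> g) \<le> norm ((lin_form K s g)\<^sup>2 + (F g)\<^sup>2)"
        using dom[OF \<tau>0 \<tau>F, of g] by simp
    qed
    have "(\<lambda>r. \<integral>g. lin_form K s g * M r g \<partial>gaussian K) \<longlonglongrightarrow> (\<integral>g. lin_form K s g * \<tau> g \<partial>gaussian K)"
    proof (rule integral_dominated_convergence[OF sm _ intw])
      show "(\<lambda>g. lin_form K s g * M r g) \<in> borel_measurable (gaussian K)" for r
        by (intro borel_measurable_times lin_form_measurable Mm)
      show "AE g in gaussian K. (\<lambda>r. lin_form K s g * M r g) \<longlonglongrightarrow> lin_form K s g * \<tau> g"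
        by (intro AE_I2 tendsto_mult tendsto_const M_lim)
      show "AE g in gaussian K. norm (lin_form K s g * M r g) \<le> (lin_form K s g)\<^sup>2 + (F g)\<^sup>2" for r
        by (intro AE_I2 dom M0 M_F)
    qed
    moreover have "(\<integral>g. lin_form K s g * M r g \<partial>gaussian K) = 0" for r
      unfolding M_def
    proof (rule gaussian_max_uncorrelated[OF K(1) T])
      fix t
      have "(\<Sum>k\<in>K. s k * b t k) = (\<Sum>i<m. \<Sum>j<n. rat_vec (fst t) i * rat_vec (snd t) j * (\<Sum>k\<in>K. s k * q i j k))"
      proof -
        have "(\<Sum>k\<in>K. s k * b t k) = (\<Sum>k\<in>K. \<Sum>i<m. \<Sum>j<n. rat_vec (fst t) i * rat_vec (snd t) j * (s k * q i j k))"
          unfolding b_def sum_distrib_left by (intro sum.cong refl) (simp only: mult_ac)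
        also have "\<dots> = (\<Sum>i<m. \<Sum>j<n. \<Sum>k\<in>K. rat_vec (fst t) i * rat_vec (snd t) j * (s k * q i j k))"
          by (subst sum.swap, rule sum.cong[OF refl], rule sum.swap)
        finally show ?thesis by (simp only: sum_distrib_left)
      qed
      also have "\<dots> = 0" using s by simp
      finally have "(\<Sum>k\<in>K. s k * b t k) = 0" .
      then show "(\<Sum>k\<in>K. s k * (b t k / nrm t)) = 0" by (simp flip: sum_divide_distrib)
    qed
    ultimately show "(\<integral>g. lin_form K s g * \<tau> g \<partial>gaussian K) = 0"
      by (simp add: LIMSEQ_const_iff)
  qed
  from that[of \<tau>, OF \<tau>0 bound[unfolded B_def] int\<tau> E cross] show thesis .
qed

section \<open>Duality on the error cone\<close>

lemma orth_mat_unit_col: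
  assumes "orth_mat n U" "k < n" shows "euclid_norm n (\<lambda>i. U $$ (i,k)) = 1"
proof -
  note u = orth_matD[OF assms(1)]
  have "(U\<^sup>T * U) $$ (k,k) = (\<Sum>i<n. (U $$ (i,k))\<^sup>2)"
    using u(1) assms(2) by (simp add: scalar_prod_def atLeast0LessThan power2_eq_square)
  then show ?thesis using assms(2) by (simp add: u(2) euclid_norm_def)
qed

lemma sum_lessThan_add: "(\<Sum>i<r + m. h i) = (\<Sum>i<r. h i) + (\<Sum>i<m. h (r + i :: nat) :: real)"
  by (induction m) (simp_all add: add.assoc)

text \<open>The matrix with t \<theta>_i on the first \<open>r\<close> diagonal places and with
  block \<open>B\<close> has dual norm at most \<open>t\<close> once the operator norm of
  \<open>B\<close> is at most t c. Pairing \<open>B\<close> with the SVD of the lower block of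
  \<open>A\<close> gives at most t c per unit of singular value; since \<open>c\<close> is below
  every entry of \<theta>, this is paid for by pairing \<theta> with the pinched diagonal.\<close>

lemma dual_bound:
  fixes B :: "nat \<Rightarrow> nat \<Rightarrow> real"
  assumes dp: "d \<le> p" and inv: "unitarily_invariant d p R" and f: "symmetric_gauge d f"
    and R: "\<forall>A\<in>carrier_mat d p. R A = f (sing_vals d p A)"
    and \<theta>: "\<theta> \<in> carrier_vec d" "\<And>y. y \<in> carrier_vec d \<Longrightarrow> \<theta> \<bullet> y \<le> f y"
    and mono: "\<And>i. i < d \<Longrightarrow> c \<le> \<theta> $ i"
    and A: "A \<in> carrier_mat d p" and r: "r \<le> d" and t: "0 \<le> t"
    and B: "\<And>u v. (\<Sum>i<d-r. \<Sum>j<p-r. u i * v j * B i j) \<le> t * c * (euclid_norm (d-r) u * euclid_norm (p-r) v)"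
  shows "t * (\<Sum>i<r. \<theta> $ i * A $$ (i,i)) + (\<Sum>i<d-r. \<Sum>j<p-r. B i j * A $$ (r+i,r+j)) \<le> t * R A"
proof -
  define m n where "m = d - r" and "n = p - r"
  have dm: "d = r + m" "p = r + n" and mn: "m \<le> n" using r dp by (auto simp: m_def n_def)
  define A11 where "A11 = mat r r (\<lambda>(i,j). A $$ (i,j))"
  define A12 where "A12 = mat r n (\<lambda>(i,j). A $$ (i,r+j))"
  define A21 where "A21 = mat m r (\<lambda>(i,j). A $$ (r+i,j))"
  define A22 where "A22 = mat m n (\<lambda>(i,j). A $$ (r+i,r+j))"
  have c: "A11 \<in> carrier_mat r r" "A12 \<in> carrier_mat r n" "A21 \<in> carrier_mat m r" "A22 \<in> carrier_mat m n"
    by (simp_all add: A11_def A12_def A21_def A22_def)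
  have Ab: "A = four_block_mat A11 A12 A21 A22"
    using A by (intro eq_matI) (auto simp: A11_def A12_def A21_def A22_def dm)
  obtain s U V where s: "\<And>i. i < m \<Longrightarrow> 0 \<le> s $ i" and U: "orth_mat m U" and V: "orth_mat n V"
    and A22: "A22 = U * rect_diag m n s * V"
    using svd_exists[OF c(4) mn] by blast
  note u = orth_matD[OF U] and v = orth_matD[OF V]
  define U' where "U' = four_block_mat (1\<^sub>m r) (0\<^sub>m r m) (0\<^sub>m m r) U\<^sup>T"
  define V' where "V' = four_block_mat (1\<^sub>m r) (0\<^sub>m r n) (0\<^sub>m n r) V\<^sup>T"
  have U': "orth_mat d U'" and V': "orth_mat p V'"
    unfolding U'_def V'_def dm by (intro orth_mat_block orth_mat_transpose U V)+
  define A' where "A' = U' * A * V'"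
  have A'c: "A' \<in> carrier_mat d p"
    unfolding A'_def by (intro mult_carrier_mat[OF mult_carrier_mat[OF _ A]] orth_matD(1)[OF U'] orth_matD(1)[OF V'])
  have ut: "U\<^sup>T \<in> carrier_mat m m" "V\<^sup>T \<in> carrier_mat n n" using u v by auto
  have UA: "U' * A = four_block_mat A11 A12 (U\<^sup>T * A21) (U\<^sup>T * A22)"
  proof -
    have z: "0\<^sub>m r m * A21 = 0\<^sub>m r r" "0\<^sub>m r m * A22 = 0\<^sub>m r n" "0\<^sub>m m r * A11 = 0\<^sub>m m r" "0\<^sub>m m r * A12 = 0\<^sub>m m n"
      by (rule left_mult_zero_mat, rule c)+
    have "U' * A = four_block_mat (1\<^sub>m r * A11 + 0\<^sub>m r m * A21) (1\<^sub>m r * A12 + 0\<^sub>m r m * A22)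
        (0\<^sub>m m r * A11 + U\<^sup>T * A21) (0\<^sub>m m r * A12 + U\<^sup>T * A22)"
      unfolding U'_def Ab by (rule mult_four_block_mat[OF one_carrier_mat zero_carrier_mat zero_carrier_mat ut(1) c])
    then show ?thesis
      using c ut by (simp add: z right_add_zero_mat[OF c(1)] right_add_zero_mat[OF c(2)]
        left_add_zero_mat[OF mult_carrier_mat[OF ut(1) c(3)]] left_add_zero_mat[OF mult_carrier_mat[OF ut(1) c(4)]])
  qed
  have D: "U\<^sup>T * A22 * V\<^sup>T = rect_diag m n s"
    unfolding A22 by (rule orth_cancel[OF U V rect_diag_carrier])
  have c2: "U\<^sup>T * A21 \<in> carrier_mat m r" "U\<^sup>T * A22 \<in> carrier_mat m n"
    by (rule mult_carrier_mat[OF ut(1)], rule c)+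
  have A'b: "A' = four_block_mat A11 (A12 * V\<^sup>T) (U\<^sup>T * A21) (rect_diag m n s)"
  proof -
    have z: "A12 * 0\<^sub>m n r = 0\<^sub>m r r" "A11 * 0\<^sub>m r n = 0\<^sub>m r n"
      "(U\<^sup>T * A22) * 0\<^sub>m n r = 0\<^sub>m m r" "(U\<^sup>T * A21) * 0\<^sub>m r n = 0\<^sub>m m n"
      by (rule right_mult_zero_mat, rule c c2)+
    have "A' = four_block_mat (A11 * 1\<^sub>m r + A12 * 0\<^sub>m n r) (A11 * 0\<^sub>m r n + A12 * V\<^sup>T)
       (U\<^sup>T * A21 * 1\<^sub>m r + U\<^sup>T * A22 * 0\<^sub>m n r) (U\<^sup>T * A21 * 0\<^sub>m r n + U\<^sup>T * A22 * V\<^sup>T)"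
      unfolding A'_def UA V'_def
      by (rule mult_four_block_mat[OF c(1,2) c2 one_carrier_mat zero_carrier_mat zero_carrier_mat ut(2)])
    then show ?thesis
      by (simp only: z D right_mult_one_mat[OF c(1)] right_mult_one_mat[OF c2(1)] right_add_zero_mat[OF c(1)]
        right_add_zero_mat[OF c2(1)] left_add_zero_mat[OF mult_carrier_mat[OF c(2) ut(2)]] left_add_zero_mat[OF rect_diag_carrier])
  qed
  define y where "y = vec d (\<lambda>i. A' $$ (i,i))"
  have y: "y \<in> carrier_vec d" by (simp add: y_def)
  have y1: "y $ i = A $$ (i,i)" if "i < r" for i
    using that mn by (simp add: y_def A'b dm A11_def rect_diag_def)
  have y2: "y $ (r + i) = s $ i" if "i < m" for i
    using that mn by (simp add: y_def A'b dm A11_def rect_diag_def)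
  have sumd: "(\<Sum>i<d. h i) = (\<Sum>i<r. h i) + (\<Sum>i<m. h (r + i))" for h :: "nat \<Rightarrow> real"
    unfolding dm(1) by (rule sum_lessThan_add)
  have "(\<Sum>i<r. \<theta> $ i * A $$ (i,i)) + c * (\<Sum>k<m. s $ k) \<le> (\<Sum>i<r. \<theta> $ i * A $$ (i,i)) + (\<Sum>k<m. \<theta> $ (r + k) * s $ k)"
    unfolding sum_distrib_left by (intro add_left_mono sum_mono mult_right_mono mono s) (auto simp: dm)
  also have "\<dots> = \<theta> \<bullet> y"
    using \<theta>(1) y by (simp add: scalar_prod_def atLeast0LessThan sumd y1 y2)
  also have "\<dots> \<le> f y" by (rule \<theta>(2)[OF y])
  also have "\<dots> = R (rect_diag d p y)" by (rule norm_rect_diag[OF dp f R y, symmetric])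
  also have "\<dots> \<le> R A'" unfolding y_def by (rule pinching[OF dp inv A'c])
  also have "R A' = R A" unfolding A'_def using inv U' V' A unfolding unitarily_invariant_def by blast
  finally have main: "(\<Sum>i<r. \<theta> $ i * A $$ (i,i)) + c * (\<Sum>k<m. s $ k) \<le> R A" .
  have "(\<Sum>i<m. \<Sum>j<n. B i j * A $$ (r+i,r+j)) = (\<Sum>i<m. \<Sum>j<n. \<Sum>k<m. s $ k * (U $$ (i,k) * V $$ (k,j) * B i j))"
  proof (intro sum.cong refl)
    fix i j assume "i \<in> {..<m}" "j \<in> {..<n}"
    then have ij: "i < m" "j < n" by auto
    have "A $$ (r+i,r+j) = A22 $$ (i,j)" using ij by (simp add: A22_def)
    also have "\<dots> = (\<Sum>k<m. U $$ (i,k) * s $ k * V $$ (k,j))"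
      unfolding A22 by (rule svd_entry[OF u(1) v(1) mn ij])
    finally show "B i j * A $$ (r+i,r+j) = (\<Sum>k<m. s $ k * (U $$ (i,k) * V $$ (k,j) * B i j))"
      by (simp only: sum_distrib_left mult_ac)
  qed
  also have "\<dots> = (\<Sum>k<m. s $ k * (\<Sum>i<m. \<Sum>j<n. U $$ (i,k) * V $$ (k,j) * B i j))"
  proof -
    have "(\<Sum>i<m. \<Sum>j<n. \<Sum>k<m. F i j k) = (\<Sum>k<m. \<Sum>i<m. \<Sum>j<n. F i j k)" for F :: "nat \<Rightarrow> nat \<Rightarrow> nat \<Rightarrow> real"
      by (subst (2) sum.swap, rule sum.cong[OF refl], rule sum.swap)
    then show ?thesis by (simp only: sum_distrib_left)
  qed
  \<comment> \<open>The k-th column of \<open>U\<close> and the k-th row of \<open>V\<close> are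
    unit vectors, so the hypothesis on \<open>B\<close> applies with both norms equal to
    one.\<close>
  also have "\<dots> \<le> (\<Sum>k<m. s $ k * (t * c))"
  proof (rule sum_mono, rule mult_left_mono)
    fix k assume "k \<in> {..<m}"
    then have k: "k < m" "k < n" using mn by auto
    show "0 \<le> s $ k" by (rule s[OF k(1)])
    have "euclid_norm n (\<lambda>j. V $$ (k,j)) = euclid_norm n (\<lambda>j. V\<^sup>T $$ (j,k))"
      unfolding euclid_norm_def using v(1) k by simp
    also have "\<dots> = 1" by (rule orth_mat_unit_col[OF orth_mat_transpose[OF V] k(2)])
    finally have "euclid_norm n (\<lambda>j. V $$ (k,j)) = 1" .
    then show "(\<Sum>i<m. \<Sum>j<n. U $$ (i,k) * V $$ (k,j) * B i j) \<le> t * c"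
      using B[of "\<lambda>i. U $$ (i,k)" "\<lambda>j. V $$ (k,j)"] orth_mat_unit_col[OF U k(1)]
      by (simp flip: m_def n_def)
  qed
  also have "\<dots> = t * (c * (\<Sum>k<m. s $ k))"
    by (simp add: sum_distrib_left mult_ac)
  finally have "(\<Sum>i<m. \<Sum>j<n. B i j * A $$ (r+i,r+j)) \<le> t * (c * (\<Sum>k<m. s $ k))" .
  moreover have "t * ((\<Sum>i<r. \<theta> $ i * A $$ (i,i)) + c * (\<Sum>k<m. s $ k)) \<le> t * R A"
    by (rule mult_left_mono[OF main t])
  ultimately show ?thesis unfolding m_def[symmetric] n_def[symmetric] by (simp add: distrib_left)
qed

lemma (in vec_space) rank_le_n:
  assumes "A \<in> carrier_mat n nc" shows "rank A \<le> n"
proof -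
  have c: "set (cols A) \<subseteq> carrier_vec n" using cols_dim assms by blast
  have "vectorspace.dim class_ring (span_vs (set (cols A))) \<le> dim"
    by (rule subspace_dim[OF _ fin_dim fin_dim_span_cols[OF assms]], rule span_is_subspace) (use c in simp)
  then show ?thesis by (simp add: rank_def dim_is_n)
qed

section \<open>Rotated Gaussian entries\<close>

lemma triple_mult_entry:
  assumes X: "(X :: real mat) \<in> carrier_mat n d" and Y: "Y \<in> carrier_mat d p" and W: "W \<in> carrier_mat p m"
    and ij: "i < n" "j < m"
  shows "(X * Y * W) $$ (i,j) = (\<Sum>a<d. \<Sum>b<p. X $$ (i,a) * Y $$ (a,b) * W $$ (b,j))"
proof -
  have XY: "X * Y \<in> carrier_mat n p" by (rule mult_carrier_mat[OF X Y])
  have "(Z * W) $$ (i,j) = (\<Sum>b<p. Z $$ (i,b) * W $$ (b,j))" if "Z \<in> carrier_mat n p" for Z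
    using that W ij by (simp add: scalar_prod_def atLeast0LessThan)
  then have "(X * Y * W) $$ (i,j) = (\<Sum>b<p. (X * Y) $$ (i,b) * W $$ (b,j))" using XY by blast
  also have "\<dots> = (\<Sum>b<p. (\<Sum>a<d. X $$ (i,a) * Y $$ (a,b)) * W $$ (b,j))"
    using X Y ij by (intro sum.cong refl) (simp add: scalar_prod_def atLeast0LessThan)
  also have "\<dots> = (\<Sum>a<d. \<Sum>b<p. X $$ (i,a) * Y $$ (a,b) * W $$ (b,j))"
    unfolding sum_distrib_right by (rule sum.swap)
  finally show ?thesis .
qed

text \<open>Coefficients of the (i,j) entry of U^T G V^T as a linear form in the entries of G. The
  measure stays in the original coordinates, and the rotation lives in these coefficients.\<close>

definition rot_coeff :: "real mat \<Rightarrow> real mat \<Rightarrow> nat \<Rightarrow> nat \<Rightarrow> nat \<times> nat \<Rightarrow> real" where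
  "rot_coeff U V i j k = U $$ (fst k, i) * V $$ (j, snd k)"

lemma lin_form_rot_coeff:
  "lin_form ({..<d} \<times> {..<p}) (rot_coeff U V i j) g = (\<Sum>a<d. \<Sum>b<p. U $$ (a,i) * V $$ (j,b) * g (a,b))"
  unfolding lin_form_def rot_coeff_def by (simp only: sum.cartesian_product case_prod_unfold prod.collapse)

lemma rot_coeff_orthonormal:
  assumes U: "orth_mat d U" and V: "orth_mat p V" and ij: "i < d" "j < p" "i' < d" "j' < p"
  shows "(\<Sum>k\<in>{..<d} \<times> {..<p}. rot_coeff U V i j k * rot_coeff U V i' j' k) = (if i = i' \<and> j = j' then 1 else 0)"
proof -
  note u = orth_matD[OF U] and v = orth_matD[OF V]
  have "(\<Sum>k\<in>{..<d} \<times> {..<p}. rot_coeff U V i j k * rot_coeff U V i' j' k)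
      = (\<Sum>a<d. \<Sum>b<p. (U $$ (a,i) * U $$ (a,i')) * (V $$ (j,b) * V $$ (j',b)))"
    unfolding rot_coeff_def sum.cartesian_product by (intro sum.cong refl) (simp add: case_prod_unfold)
  also have "\<dots> = (\<Sum>a<d. U $$ (a,i) * U $$ (a,i')) * (\<Sum>b<p. V $$ (j,b) * V $$ (j',b))"
    by (simp only: sum_product)
  also have "(\<Sum>a<d. U $$ (a,i) * U $$ (a,i')) = (U\<^sup>T * U) $$ (i,i')"
    using u(1) ij by (simp add: scalar_prod_def atLeast0LessThan)
  also have "(\<Sum>b<p. V $$ (j,b) * V $$ (j',b)) = (V * V\<^sup>T) $$ (j,j')"
    using v(1) ij by (simp add: scalar_prod_def atLeast0LessThan)
  finally show ?thesis using ij by (simp add: u v)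
qed

lemma inner_rotate:
  assumes U: "orth_mat d U" and V: "orth_mat p V" and Z: "Z \<in> carrier_mat d p"
  defines "A \<equiv> U\<^sup>T * Z * V\<^sup>T"
  shows "(\<Sum>a<d. \<Sum>b<p. g (a,b) * Z $$ (a,b))
     = (\<Sum>i<d. \<Sum>j<p. lin_form ({..<d} \<times> {..<p}) (rot_coeff U V i j) g * A $$ (i,j))"
    and "(\<Sum>i<d. \<Sum>j<p. (A $$ (i,j))\<^sup>2) = (\<Sum>a<d. \<Sum>b<p. (Z $$ (a,b))\<^sup>2)"
proof -
  note u = orth_matD[OF U] and v = orth_matD[OF V]
  have ut: "U\<^sup>T \<in> carrier_mat d d" "V\<^sup>T \<in> carrier_mat p p" using u v by auto
  have A: "A \<in> carrier_mat d p" unfolding A_def by (rule mult_carrier_mat[OF mult_carrier_mat[OF ut(1) Z] ut(2)])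
  have ZA: "Z = U * A * V"
    using orth_cancel'[OF U orth_mat_transpose[OF V] Z] by (simp add: A_def)
  have swap: "(\<Sum>a<d. \<Sum>b<p. \<Sum>i<d. \<Sum>j<p. F a b i j) = (\<Sum>i<d. \<Sum>j<p. \<Sum>a<d. \<Sum>b<p. F a b i j)"
    for F :: "nat \<Rightarrow> nat \<Rightarrow> nat \<Rightarrow> nat \<Rightarrow> real"
  proof -
    have s3: "(\<Sum>x<n. \<Sum>i<d. \<Sum>j<p. G x i j) = (\<Sum>i<d. \<Sum>j<p. \<Sum>x<n. G x i j)"
      for n and G :: "nat \<Rightarrow> nat \<Rightarrow> nat \<Rightarrow> real"
      by (subst sum.swap, rule sum.cong[OF refl], rule sum.swap)
    have "(\<Sum>a<d. \<Sum>b<p. \<Sum>i<d. \<Sum>j<p. F a b i j) = (\<Sum>a<d. \<Sum>i<d. \<Sum>j<p. \<Sum>b<p. F a b i j)"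
      by (intro sum.cong refl s3)
    also have "\<dots> = (\<Sum>i<d. \<Sum>j<p. \<Sum>a<d. \<Sum>b<p. F a b i j)" by (rule s3)
    finally show ?thesis .
  qed
  have main: "(\<Sum>a<d. \<Sum>b<p. g (a,b) * Z $$ (a,b))
     = (\<Sum>i<d. \<Sum>j<p. lin_form ({..<d} \<times> {..<p}) (rot_coeff U V i j) g * A $$ (i,j))" for g
  proof -
    have "(\<Sum>a<d. \<Sum>b<p. g (a,b) * Z $$ (a,b))
        = (\<Sum>a<d. \<Sum>b<p. \<Sum>i<d. \<Sum>j<p. U $$ (a,i) * V $$ (j,b) * g (a,b) * A $$ (i,j))"
    proof (intro sum.cong refl)
      fix a b assume "a \<in> {..<d}" "b \<in> {..<p}"
      then have ab: "a < d" "b < p" by auto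
      have "Z $$ (a,b) = (\<Sum>i<d. \<Sum>j<p. U $$ (a,i) * A $$ (i,j) * V $$ (j,b))"
        unfolding ZA by (rule triple_mult_entry[OF u(1) A v(1) ab])
      then show "g (a,b) * Z $$ (a,b) = (\<Sum>i<d. \<Sum>j<p. U $$ (a,i) * V $$ (j,b) * g (a,b) * A $$ (i,j))"
        by (simp only: sum_distrib_left mult_ac)
    qed
    also have "\<dots> = (\<Sum>i<d. \<Sum>j<p. \<Sum>a<d. \<Sum>b<p. U $$ (a,i) * V $$ (j,b) * g (a,b) * A $$ (i,j))"
      by (rule swap)
    finally show ?thesis unfolding lin_form_rot_coeff by (simp only: sum_distrib_right)
  qed
  then show "(\<Sum>a<d. \<Sum>b<p. g (a,b) * Z $$ (a,b))
     = (\<Sum>i<d. \<Sum>j<p. lin_form ({..<d} \<times> {..<p}) (rot_coeff U V i j) g * A $$ (i,j))" .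
  \<comment> \<open>The second claim is the first one with \<open>g\<close> taken to be
    \<open>Z\<close> itself, whose rotated entries are those of \<open>A\<close>.\<close>
  have "lin_form ({..<d} \<times> {..<p}) (rot_coeff U V i j) (\<lambda>k. Z $$ k) = A $$ (i,j)" if ij: "i < d" "j < p" for i j
  proof -
    have "A $$ (i,j) = (\<Sum>a<d. \<Sum>b<p. U\<^sup>T $$ (i,a) * Z $$ (a,b) * V\<^sup>T $$ (b,j))"
      unfolding A_def by (rule triple_mult_entry[OF ut(1) Z ut(2) ij])
    also have "\<dots> = (\<Sum>a<d. \<Sum>b<p. U $$ (a,i) * V $$ (j,b) * Z $$ (a,b))"
      using u(1) v(1) ij by (intro sum.cong refl) simp
    finally show ?thesis by (simp only: lin_form_rot_coeff)
  qed
  then have "(\<Sum>i<d. \<Sum>j<p. lin_form ({..<d} \<times> {..<p}) (rot_coeff U V i j) (\<lambda>k. Z $$ k) * A $$ (i,j))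
      = (\<Sum>i<d. \<Sum>j<p. (A $$ (i,j))\<^sup>2)"
    by (intro sum.cong refl) (simp add: power2_eq_square)
  then show "(\<Sum>i<d. \<Sum>j<p. (A $$ (i,j))\<^sup>2) = (\<Sum>a<d. \<Sum>b<p. (Z $$ (a,b))\<^sup>2)"
    using main[of "\<lambda>k. Z $$ k"] by (simp only: power2_eq_square)
qed

text \<open>The dual bound at the rotated D + \<Theta> gives at most t R (D + \<Theta>) <= t R
  \<Theta> = t f \<sigma> <= t <\<theta>, \<sigma>>. The last term is exactly what \<Theta>
  contributes on the left, because \<sigma> vanishes from \<open>r\<close> on. Subtracting it leaves
  the claim for D, and the cone only rescales by a nonnegative factor.\<close>

lemma err_cone_dual:
  fixes B :: "nat \<Rightarrow> nat \<Rightarrow> real"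
  assumes dp: "d \<le> p" and inv: "unitarily_invariant d p R" and f: "symmetric_gauge d f"
    and R: "\<forall>A\<in>carrier_mat d p. R A = f (sing_vals d p A)"
    and sub: "is_subgradient d f \<sigma> \<theta>" and \<sigma>: "\<sigma> \<in> carrier_vec d" "\<And>i. r \<le> i \<Longrightarrow> i < d \<Longrightarrow> \<sigma> $ i = 0"
    and mono: "\<And>i. i < d \<Longrightarrow> c \<le> \<theta> $ i"
    and U: "orth_mat d U" and V: "orth_mat p V" and r: "r \<le> d" and t: "0 \<le> t"
    and B: "\<And>u v. (\<Sum>i<d-r. \<Sum>j<p-r. u i * v j * B i j) \<le> t * c * (euclid_norm (d-r) u * euclid_norm (p-r) v)"
    and Z: "Z \<in> err_cone d p R (U * rect_diag d p \<sigma> * V)"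
  defines "A \<equiv> U\<^sup>T * Z * V\<^sup>T"
  shows "t * (\<Sum>i<r. \<theta> $ i * A $$ (i,i)) + (\<Sum>i<d-r. \<Sum>j<p-r. B i j * A $$ (r+i,r+j)) \<le> 0"
proof -
  let ?\<Theta> = "U * rect_diag d p \<sigma> * V"
  note u = orth_matD[OF U] and v = orth_matD[OF V]
  have ut: "U\<^sup>T \<in> carrier_mat d d" "V\<^sup>T \<in> carrier_mat p p" using u v by auto
  have \<Theta>: "?\<Theta> \<in> carrier_mat d p" by (rule mult_carrier_mat[OF mult_carrier_mat[OF u(1) rect_diag_carrier] v(1)])
  obtain s D where Zs: "Z = s \<cdot>\<^sub>m D" and s: "0 \<le> s" and D: "D \<in> carrier_mat d p" and RD: "R (D + ?\<Theta>) \<le> R ?\<Theta>"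
    using Z unfolding err_cone_def by blast
  have inv': "R (P * X * Q) = R X" if "orth_mat d P" "orth_mat p Q" "X \<in> carrier_mat d p" for P Q X
    using inv that unfolding unitarily_invariant_def by blast
  have vn: "is_vec_norm d f" using f by (simp add: symmetric_gauge_def)
  have \<theta>: "\<theta> \<in> carrier_vec d" and sg: "\<And>y. y \<in> carrier_vec d \<Longrightarrow> f \<sigma> + \<theta> \<bullet> (y - \<sigma>) \<le> f y"
    using sub unfolding is_subgradient_def by auto
  \<comment> \<open>The subgradient inequality at \<open>y + \<sigma>\<close> combined with the
    triangle inequality: \<theta> lies in the unit ball of the dual gauge.\<close>
  have \<theta>f: "\<theta> \<bullet> y \<le> f y" if y: "y \<in> carrier_vec d" for y
  proof -
    have "f \<sigma> + \<theta> \<bullet> (y + \<sigma> - \<sigma>) \<le> f (y + \<sigma>)" by (rule sg) (use y \<sigma> in simp)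
    moreover have "y + \<sigma> - \<sigma> = y" using y \<sigma>(1) by (intro eq_vecI) auto
    moreover have "f (y + \<sigma>) \<le> f y + f \<sigma>" using vn y \<sigma>(1) unfolding is_vec_norm_def by blast
    ultimately show ?thesis by simp
  qed
  \<comment> \<open>The subgradient inequality at the origin, where \<open>f\<close>
    vanishes.\<close>
  have f\<sigma>: "f \<sigma> \<le> (\<Sum>i<r. \<theta> $ i * \<sigma> $ i)"
  proof -
    have "f (0\<^sub>v d) = 0" using vn unfolding is_vec_norm_def by simp
    then have "f \<sigma> + \<theta> \<bullet> (0\<^sub>v d - \<sigma>) \<le> 0" using sg[of "0\<^sub>v d"] by simp
    moreover have "\<theta> \<bullet> (0\<^sub>v d - \<sigma>) = - (\<Sum>i<d. \<theta> $ i * \<sigma> $ i)"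
      using \<theta> \<sigma>(1) by (simp add: scalar_prod_def atLeast0LessThan sum_negf)
    moreover have "(\<Sum>i<d. \<theta> $ i * \<sigma> $ i) = (\<Sum>i<r. \<theta> $ i * \<sigma> $ i)"
      using r \<sigma>(2) by (intro sum.mono_neutral_right) auto
    ultimately show ?thesis by simp
  qed
  define D' where "D' = U\<^sup>T * D * V\<^sup>T"
  define X where "X = U\<^sup>T * (D + ?\<Theta>) * V\<^sup>T"
  have D\<Theta>: "D + ?\<Theta> \<in> carrier_mat d p" using \<Theta> by (rule add_carrier_mat)
  have Xc: "X \<in> carrier_mat d p" unfolding X_def by (rule mult_carrier_mat[OF mult_carrier_mat[OF ut(1) D\<Theta>] ut(2)])
  have D'c: "D' \<in> carrier_mat d p" unfolding D'_def by (rule mult_carrier_mat[OF mult_carrier_mat[OF ut(1) D] ut(2)])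
  have "X = D' + U\<^sup>T * ?\<Theta> * V\<^sup>T"
    unfolding X_def D'_def mult_add_distrib_mat[OF ut(1) D \<Theta>]
    by (rule add_mult_distrib_mat[OF mult_carrier_mat[OF ut(1) D] mult_carrier_mat[OF ut(1) \<Theta>] ut(2)])
  also have "U\<^sup>T * ?\<Theta> * V\<^sup>T = rect_diag d p \<sigma>" by (rule orth_cancel[OF U V rect_diag_carrier])
  finally have XD: "X = D' + rect_diag d p \<sigma>" .
  have Xe: "X $$ (i,j) = D' $$ (i,j) + (if i = j then \<sigma> $ i else 0)" if "i < d" "j < p" for i j
    using that D'c unfolding XD by (simp add: rect_diag_def)
  have "t * (\<Sum>i<r. \<theta> $ i * X $$ (i,i)) + (\<Sum>i<d-r. \<Sum>j<p-r. B i j * X $$ (r+i,r+j)) \<le> t * R X"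
    by (rule dual_bound[OF dp inv f R \<theta> \<theta>f mono Xc r t B])
  also have "R X = R (D + ?\<Theta>)"
    unfolding X_def by (rule inv'[OF orth_mat_transpose[OF U] orth_mat_transpose[OF V] D\<Theta>])
  also have "t * R (D + ?\<Theta>) \<le> t * R ?\<Theta>" by (rule mult_left_mono[OF RD t])
  also have "R ?\<Theta> = f \<sigma>"
    using inv'[OF U V rect_diag_carrier] norm_rect_diag[OF dp f R \<sigma>(1)] by simp
  also have "t * f \<sigma> \<le> t * (\<Sum>i<r. \<theta> $ i * \<sigma> $ i)" by (rule mult_left_mono[OF f\<sigma> t])
  finally have le: "t * (\<Sum>i<r. \<theta> $ i * X $$ (i,i)) + (\<Sum>i<d-r. \<Sum>j<p-r. B i j * X $$ (r+i,r+j))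
      \<le> t * (\<Sum>i<r. \<theta> $ i * \<sigma> $ i)" .
  have "(\<Sum>i<r. \<theta> $ i * X $$ (i,i)) = (\<Sum>i<r. \<theta> $ i * D' $$ (i,i) + \<theta> $ i * \<sigma> $ i)"
    using r dp by (intro sum.cong refl) (simp add: Xe distrib_left)
  then have e1: "(\<Sum>i<r. \<theta> $ i * X $$ (i,i)) = (\<Sum>i<r. \<theta> $ i * D' $$ (i,i)) + (\<Sum>i<r. \<theta> $ i * \<sigma> $ i)"
    by (simp only: sum.distrib)
  have e2: "(\<Sum>i<d-r. \<Sum>j<p-r. B i j * X $$ (r+i,r+j)) = (\<Sum>i<d-r. \<Sum>j<p-r. B i j * D' $$ (r+i,r+j))"
    using r dp \<sigma>(2) by (intro sum.cong refl) (simp add: Xe)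
  have neg: "t * (\<Sum>i<r. \<theta> $ i * D' $$ (i,i)) + (\<Sum>i<d-r. \<Sum>j<p-r. B i j * D' $$ (r+i,r+j)) \<le> 0"
    using le unfolding e1 e2 by (simp add: distrib_left)
  have "A = s \<cdot>\<^sub>m D'"
    unfolding A_def D'_def Zs mult_smult_distrib[OF ut(1) D]
    by (rule mult_smult_assoc_mat[OF mult_carrier_mat[OF ut(1) D] ut(2)])
  then have Ae: "A $$ (i,j) = s * D' $$ (i,j)" if "i < d" "j < p" for i j using that D'c by simp
  have "t * (\<Sum>i<r. \<theta> $ i * A $$ (i,i)) + (\<Sum>i<d-r. \<Sum>j<p-r. B i j * A $$ (r+i,r+j))
      = s * (t * (\<Sum>i<r. \<theta> $ i * D' $$ (i,i)) + (\<Sum>i<d-r. \<Sum>j<p-r. B i j * D' $$ (r+i,r+j)))"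
  proof -
    have "(\<Sum>i<r. \<theta> $ i * A $$ (i,i)) = s * (\<Sum>i<r. \<theta> $ i * D' $$ (i,i))"
      unfolding sum_distrib_left using r dp by (intro sum.cong refl) (simp add: Ae)
    moreover have "(\<Sum>i<d-r. \<Sum>j<p-r. B i j * A $$ (r+i,r+j)) = s * (\<Sum>i<d-r. \<Sum>j<p-r. B i j * D' $$ (r+i,r+j))"
      unfolding sum_distrib_left using r dp by (intro sum.cong refl) (simp add: Ae)
    ultimately show ?thesis by (simp add: distrib_left)
  qed
  also have "\<dots> \<le> 0" by (rule mult_nonneg_nonpos[OF s neg])
  finally show ?thesis .
qed

section \<open>From a second moment to the width\<close>

lemma gauss_mat_eq: "gauss_mat d p = gaussian ({..<d} \<times> {..<p})"
  by (simp add: gauss_mat_def gaussian_def)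

text \<open>No measurability of the supremum is needed: the integral of a non-integrable function is \<open>0\<close>.\<close>

lemma gaussian_width_le_sqrt:
  assumes S: "S \<noteq> {}" and w: "0 < w"
    and le: "\<And>G Z. Z \<in> S \<Longrightarrow> (\<Sum>i<d. \<Sum>j<p. G (i,j) * Z $$ (i,j)) \<le> sqrt (W G)"
    and W: "\<And>G. 0 \<le> W G" "integrable (gauss_mat d p) W" "(\<integral>G. W G \<partial>gauss_mat d p) \<le> w"
  shows "gaussian_width d p S \<le> sqrt w"
proof -
  interpret prob_space "gauss_mat d p" unfolding gauss_mat_eq by (rule prob_space_gaussian)
  \<comment> \<open>A tangent-line form of Jensen's inequality: sqrt W is at most (W / k + k) / 2,
    which is affine in W. At k = sqrt w its integral is at most sqrt w.\<close>
  define k where "k = sqrt w"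
  have k: "0 < k" "k\<^sup>2 = w" using w by (simp_all add: k_def)
  let ?F = "\<lambda>G. SUP Z\<in>S. \<Sum>i<d. \<Sum>j<p. G (i,j) * Z $$ (i,j)"
  have F: "?F G \<le> (W G / k + k) / 2" for G
  proof -
    have "2 * sqrt (W G) * k \<le> (sqrt (W G))\<^sup>2 + k\<^sup>2" by (rule sum_squares_bound)
    then have "sqrt (W G) * (2 * k) \<le> W G + k\<^sup>2" using W(1)[of G] by (simp add: mult_ac)
    then have le2: "sqrt (W G) \<le> (W G + k\<^sup>2) / (2 * k)" using k(1) by (subst pos_le_divide_eq) simp_all
    have "?F G \<le> sqrt (W G)" by (rule cSUP_least[OF S le])
    also note le2
    also have "(W G + k\<^sup>2) / (2 * k) = (W G / k + k) / 2" using k(1) by (simp add: field_simps power2_eq_square)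
    finally show ?thesis .
  qed
  show ?thesis
  proof (cases "integrable (gauss_mat d p) ?F")
    case True
    have "gaussian_width d p S \<le> (\<integral>G. (W G / k + k) / 2 \<partial>gauss_mat d p)"
      unfolding gaussian_width_def
      by (rule integral_mono[OF True _ F]) (intro integrable_divide Bochner_Integration.integrable_add W integrable_const)
    also have "\<dots> = ((\<integral>G. W G \<partial>gauss_mat d p) / k + k) / 2"
      using W(2) by (simp add: prob_space)
    also have "\<dots> \<le> (w / k + k) / 2" using W(3) k(1) by (simp add: divide_right_mono)
    also have "\<dots> = k" using k by (simp add: field_simps power2_eq_square)
    finally show ?thesis by (simp add: k_def)
  next
    case False
    then show ?thesis using w by (simp add: gaussian_width_def not_integrable_integral_eq)
  qed
qed

lemma sum_lower_block:
  assumes "r \<le> d" "r \<le> (p::nat)"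
  shows "(\<Sum>i<d. \<Sum>j<p. if r \<le> i \<and> r \<le> j then h i j else 0 :: real) = (\<Sum>i<d-r. \<Sum>j<p-r. h (r+i) (r+j))"
proof -
  obtain m n where d: "d = r + m" "p = r + n" using assms le_Suc_ex by blast
  show ?thesis unfolding d sum_lessThan_add by simp
qed

lemma sum_upper_diagonal:
  assumes "r \<le> d" "d \<le> (p::nat)"
  shows "(\<Sum>i<d. \<Sum>j<p. if i = j \<and> i < r then h i j else 0 :: real) = (\<Sum>i<r. h i i)"
proof -
  have "(\<Sum>i<d. \<Sum>j<p. if i = j \<and> i < r then h i j else 0) = (\<Sum>i<d. if i < r then h i i else 0)"
  proof (intro sum.cong refl)
    fix i assume "i \<in> {..<d}"
    then have "i < p" using assms by simp
    have "(\<Sum>j<p. if i = j \<and> i < r then h i j else 0) = (\<Sum>j<p. if i = j then (if i < r then h i i else 0) else 0)"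
      by (intro sum.cong refl) auto
    then show "(\<Sum>j<p. if i = j \<and> i < r then h i j else 0) = (if i < r then h i i else 0)"
      using \<open>i < p\<close> by simp
  qed
  also have "\<dots> = (\<Sum>i<r. if i < r then h i i else 0)"
    using assms by (intro sum.mono_neutral_right) auto
  finally show ?thesis by simp
qed

section \<open>Bounds on the Gaussian width\<close>

lemma frob_norm_eq_1D:
  assumes "Z \<in> carrier_mat d p" "frob_norm Z = 1"
  shows "(\<Sum>i<d. \<Sum>j<p. (Z $$ (i,j))\<^sup>2) = 1"
  using assms unfolding frob_norm_def by simp

lemma frobenius_inner_le:
  fixes x y :: "nat \<Rightarrow> nat \<Rightarrow> real"
  assumes "(\<Sum>i<d. \<Sum>j<p. (y i j)\<^sup>2) = 1"
  shows "(\<Sum>i<d. \<Sum>j<p. x i j * y i j) \<le> sqrt (\<Sum>i<d. \<Sum>j<p. (x i j)\<^sup>2)"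
proof -
  let ?I = "{..<d} \<times> {..<p}"
  have "(\<Sum>z\<in>?I. x (fst z) (snd z) * y (fst z) (snd z))\<^sup>2
      \<le> (\<Sum>z\<in>?I. (x (fst z) (snd z))\<^sup>2) * (\<Sum>z\<in>?I. (y (fst z) (snd z))\<^sup>2)"
    by (rule Cauchy_Schwarz_ineq_sum)
  then have "(\<Sum>i<d. \<Sum>j<p. x i j * y i j)\<^sup>2 \<le> (\<Sum>i<d. \<Sum>j<p. (x i j)\<^sup>2) * (\<Sum>i<d. \<Sum>j<p. (y i j)\<^sup>2)"
    by (simp only: sum.cartesian_product case_prod_unfold)
  then show ?thesis unfolding assms by (intro real_le_rsqrt) simp
qed

text \<open>The witness is - \<Theta>, normalised: it moves \<Theta> to zero, where \<open>R\<close>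
  is smallest. Nonemptiness lets the supremum be bounded by any upper bound of its members.\<close>

lemma A_set_nonempty:
  assumes R: "unitarily_invariant d p R" and \<Theta>: "\<Theta> \<in> carrier_mat d p" "\<Theta> \<noteq> 0\<^sub>m d p"
  shows "A_set d p R \<Theta> \<noteq> {}"
proof -
  let ?D = "- \<Theta>"
  have D: "?D \<in> carrier_mat d p" using \<Theta> by simp
  have mn: "is_mat_norm d p R" using R by (simp add: unitarily_invariant_def)
  define N where "N = (\<Sum>i<d. \<Sum>j<p. (\<Theta> $$ (i,j))\<^sup>2)"
  have "0 \<le> N" unfolding N_def by (intro sum_nonneg) simp
  moreover have "N \<noteq> 0"
  proof
    assume "N = 0"
    then have "\<forall>i<d. \<forall>j<p. \<Theta> $$ (i,j) = 0"
      unfolding N_def by (simp add: sum_nonneg_eq_0_iff sum_nonneg)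
    then have "\<Theta> = 0\<^sub>m d p" using \<Theta>(1) by (intro eq_matI) auto
    with \<Theta>(2) show False ..
  qed
  ultimately have N: "0 < N" by simp
  let ?Z = "(1 / sqrt N) \<cdot>\<^sub>m ?D"
  have Z: "?Z \<in> carrier_mat d p" using D by simp
  have "?D + \<Theta> = 0\<^sub>m d p" using \<Theta>(1) by (intro eq_matI) auto
  moreover have "R (0\<^sub>m d p) = 0" "0 \<le> R \<Theta>" using mn \<Theta>(1) unfolding is_mat_norm_def by auto
  ultimately have "R (?D + \<Theta>) \<le> R \<Theta>" by simp
  then have "?Z \<in> err_cone d p R \<Theta>"
    unfolding err_cone_def using D N by (intro CollectI exI[of _ "1 / sqrt N"] exI[of _ ?D]) simp
  moreover have "frob_norm ?Z = 1"
  proof -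
    have "(\<Sum>i<d. \<Sum>j<p. (?Z $$ (i,j))\<^sup>2) = (\<Sum>i<d. \<Sum>j<p. 1 / N * (\<Theta> $$ (i,j))\<^sup>2)"
      using \<Theta>(1) N by (intro sum.cong refl) (simp add: power_divide)
    also have "\<dots> = 1 / N * N" unfolding N_def by (simp only: sum_distrib_left)
    also have "\<dots> = 1" using N by simp
    finally have eq: "(\<Sum>i<d. \<Sum>j<p. (?Z $$ (i,j))\<^sup>2) = 1" .
    show ?thesis unfolding frob_norm_def carrier_matD[OF Z] eq by (rule real_sqrt_one)
  qed
  ultimately show ?thesis unfolding A_set_def using Z by blast
qed

text \<open>On the Frobenius sphere Cauchy-Schwarz bounds the supremum by the Frobenius norm of G,
  whose second moment is d p.\<close>

lemma gaussian_width_A_set_le_dim: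
  assumes S: "A_set d p R \<Theta> \<noteq> {}" and dp: "0 < d" "0 < p"
  shows "gaussian_width d p (A_set d p R \<Theta>) \<le> sqrt (real d * real p)"
proof (rule gaussian_width_le_sqrt[OF S])
  let ?K = "{..<d} \<times> {..<p}"
  let ?W = "\<lambda>G :: nat \<times> nat \<Rightarrow> real. \<Sum>i<d. \<Sum>j<p. (G (i,j))\<^sup>2"
  have K: "finite ?K" by simp
  have mem: "(i,j) \<in> ?K" if "i \<in> {..<d}" "j \<in> {..<p}" for i j using that by simp
  show "0 < real d * real p" using dp by simp
  show "0 \<le> ?W G" for G by (intro sum_nonneg) simp
  show "integrable (gauss_mat d p) ?W"
    unfolding gauss_mat_eq
    by (intro Bochner_Integration.integrable_sum gaussian_square_integrable K mem)
  have "(\<integral>G. ?W G \<partial>gauss_mat d p) = (\<Sum>i<d. \<Sum>j<p. \<integral>G. (G (i,j))\<^sup>2 \<partial>gaussian ?K)"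
    unfolding gauss_mat_eq
    by (subst Bochner_Integration.integral_sum)
       (intro Bochner_Integration.integrable_sum gaussian_square_integrable K mem, assumption, assumption,
        intro sum.cong refl Bochner_Integration.integral_sum gaussian_square_integrable K mem)
  also have "\<dots> = (\<Sum>i<d. \<Sum>j<p. 1)"
    by (intro sum.cong refl gaussian_second_moment K mem)
  finally show "(\<integral>G. ?W G \<partial>gauss_mat d p) \<le> real d * real p" by simp
  show "(\<Sum>i<d. \<Sum>j<p. G (i,j) * Z $$ (i,j)) \<le> sqrt (?W G)" if "Z \<in> A_set d p R \<Theta>" for G Z
    using that by (intro frobenius_inner_le frob_norm_eq_1D) (auto simp: A_set_def)
qed

text \<open>Here b / c is in the role of \<rho>: the first \<open>r\<close> entries of \<theta>
  contribute at most r b^2 / c^2 as the factor of E \<tau>^2.\<close>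

lemma gaussian_width_A_set_le_rank:
  assumes dp: "d \<le> p" and inv: "unitarily_invariant d p R" and f: "symmetric_gauge d f"
    and R: "\<forall>A\<in>carrier_mat d p. R A = f (sing_vals d p A)"
    and sub: "is_subgradient d f \<sigma> \<theta>" and \<sigma>: "\<sigma> \<in> carrier_vec d" "\<And>i. r \<le> i \<Longrightarrow> i < d \<Longrightarrow> \<sigma> $ i = 0"
    and c: "0 < c" "\<And>i. i < d \<Longrightarrow> c \<le> \<theta> $ i" and b: "\<And>i. i < d \<Longrightarrow> \<theta> $ i \<le> b"
    and U: "orth_mat d U" and V: "orth_mat p V" and r: "r \<le> d" "1 \<le> r"
    and \<Theta>: "\<Theta> = U * rect_diag d p \<sigma> * V" and S: "A_set d p R \<Theta> \<noteq> {}"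
  shows "gaussian_width d p (A_set d p R \<Theta>) \<le> sqrt ((2 * (b / c)\<^sup>2 + 1) * (real d + real p - real r) * real r)"
proof -
  let ?K = "{..<d} \<times> {..<p}"
  let ?q = "rot_coeff U V"
  define H where "H i j G = lin_form ?K (?q i j) G" for i j and G :: "nat \<times> nat \<Rightarrow> real"
  define m n where "m = d - r" and "n = p - r"
  have dims: "real m = real d - real r" "real n = real p - real r" using r dp by (simp_all add: m_def n_def)
  have K: "finite ?K" "?K \<subseteq> {..<d} \<times> UNIV" by auto
  obtain \<tau> where \<tau>: "\<And>g. 0 \<le> \<tau> g"
    and op: "\<And>g u v. (\<Sum>i<m. \<Sum>j<n. u i * v j * lin_form ?K (?q (r+i) (r+j)) g) \<le> \<tau> g * (euclid_norm m u * euclid_norm n v)"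
    and int\<tau>: "integrable (gaussian ?K) (\<lambda>g. (\<tau> g)\<^sup>2)" and E\<tau>: "(\<integral>g. (\<tau> g)\<^sup>2 \<partial>gaussian ?K) \<le> 2 * (real m + real n)"
    and cross: "\<And>s. \<forall>i<m. \<forall>j<n. (\<Sum>k\<in>?K. s k * ?q (r+i) (r+j) k) = 0 \<Longrightarrow>
       integrable (gaussian ?K) (\<lambda>g. lin_form ?K s g * \<tau> g) \<and> (\<integral>g. lin_form ?K s g * \<tau> g \<partial>gaussian ?K) = 0"
  proof (rule gaussian_operator_norm[OF K, of m n "\<lambda>i j. ?q (r+i) (r+j)"])
    fix i j i' j' assume "i < m" "j < n" "i' < m" "j' < n"
    then show "(\<Sum>k\<in>?K. ?q (r+i) (r+j) k * ?q (r+i') (r+j') k) = (if i = i' \<and> j = j' then 1 else 0)"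
      by (subst rot_coeff_orthonormal[OF U V]) (auto simp: m_def n_def)
  qed (rule that)
  \<comment> \<open>The scale \<tau> / c is the smallest t for which a block of operator norm \<tau>
    meets the requirement t c >= \<tau> of the dual bound.\<close>
  define \<Gamma> where "\<Gamma> G i j = (if r \<le> i \<and> r \<le> j then H i j G else 0)
      + (if i = j \<and> i < r then \<tau> G / c * \<theta> $ i else 0)" for G i j
  define Q where "Q G = (\<Sum>i<d. \<Sum>j<p. if r \<le> i \<and> r \<le> j then 0 else (H i j G)\<^sup>2)" for G
  define L where "L G = (\<Sum>i<r. \<theta> $ i * (H i i G * \<tau> G))" for G
  define s where "s = (\<Sum>i<r. (\<theta> $ i)\<^sup>2)"
  define W where "W G = Q G - 2 / c * L G + s / c\<^sup>2 * (\<tau> G)\<^sup>2" for G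
  \<comment> \<open>Inside the block the difference vanishes, and outside it \<Gamma> is supported
    on the first \<open>r\<close> diagonal places, so the cross terms are those collected in
    \<open>L\<close>.\<close>
  have W: "(\<Sum>i<d. \<Sum>j<p. (H i j G - \<Gamma> G i j)\<^sup>2) = W G" for G
  proof -
    have "(H i j G - \<Gamma> G i j)\<^sup>2 = (if r \<le> i \<and> r \<le> j then 0 else (H i j G)\<^sup>2)
        - 2 / c * (if i = j \<and> i < r then \<theta> $ i * (H i j G * \<tau> G) else 0)
        + (\<tau> G)\<^sup>2 / c\<^sup>2 * (if i = j \<and> i < r then (\<theta> $ i)\<^sup>2 else 0)" for i j
      by (auto simp: \<Gamma>_def power2_diff power_mult_distrib power_divide) (simp add: power2_eq_square)
    then have "(\<Sum>i<d. \<Sum>j<p. (H i j G - \<Gamma> G i j)\<^sup>2) = Q G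
        - 2 / c * (\<Sum>i<d. \<Sum>j<p. if i = j \<and> i < r then \<theta> $ i * (H i j G * \<tau> G) else 0)
        + (\<tau> G)\<^sup>2 / c\<^sup>2 * (\<Sum>i<d. \<Sum>j<p. if i = j \<and> i < r then (\<theta> $ i)\<^sup>2 else 0)"
      unfolding Q_def by (simp only: sum.distrib sum_subtractf sum_distrib_left)
    then show ?thesis unfolding sum_upper_diagonal[OF r(1) dp] by (simp add: W_def L_def s_def)
  qed
  have \<Gamma>_le: "(\<Sum>i<d. \<Sum>j<p. \<Gamma> G i j * A $$ (i,j)) \<le> 0"
    if Z: "Z \<in> err_cone d p R \<Theta>" and A: "A = U\<^sup>T * Z * V\<^sup>T" for G Z A
  proof -
    have "\<Gamma> G i j * A $$ (i,j) = (if r \<le> i \<and> r \<le> j then H i j G * A $$ (i,j) else 0)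
       + (if i = j \<and> i < r then \<tau> G / c * (\<theta> $ i * A $$ (i,j)) else 0)" for i j
      by (auto simp: \<Gamma>_def)
    then have "(\<Sum>i<d. \<Sum>j<p. \<Gamma> G i j * A $$ (i,j))
       = (\<Sum>i<d. \<Sum>j<p. if r \<le> i \<and> r \<le> j then H i j G * A $$ (i,j) else 0)
         + (\<Sum>i<d. \<Sum>j<p. if i = j \<and> i < r then \<tau> G / c * (\<theta> $ i * A $$ (i,j)) else 0)"
      by (simp only: sum.distrib)
    also have "\<dots> = (\<Sum>i<d-r. \<Sum>j<p-r. H (r+i) (r+j) G * A $$ (r+i,r+j)) + \<tau> G / c * (\<Sum>i<r. \<theta> $ i * A $$ (i,i))"
      unfolding sum_upper_diagonal[OF r(1) dp] sum_lower_block[OF r(1) order_trans[OF r(1) dp]]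
      by (simp only: sum_distrib_left)
    also have "\<dots> = \<tau> G / c * (\<Sum>i<r. \<theta> $ i * A $$ (i,i)) + (\<Sum>i<d-r. \<Sum>j<p-r. H (r+i) (r+j) G * A $$ (r+i,r+j))"
      by (rule add.commute)
    also have "\<dots> \<le> 0"
      unfolding A
    proof (rule err_cone_dual[OF dp inv f R sub \<sigma> c(2) U V r(1)])
      show "0 \<le> \<tau> G / c" using \<tau> c(1) by simp
      show "(\<Sum>i<d-r. \<Sum>j<p-r. u i * v j * H (r+i) (r+j) G) \<le> \<tau> G / c * c * (euclid_norm (d-r) u * euclid_norm (p-r) v)" for u v
        using op[of u v G] c(1) by (simp add: H_def m_def n_def)
      show "Z \<in> err_cone d p R (U * rect_diag d p \<sigma> * V)" using Z by (simp only: \<Theta>)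
    qed
    finally show ?thesis .
  qed
  have intH: "integrable (gaussian ?K) (\<lambda>G. (H i j G)\<^sup>2)" for i j
    unfolding H_def by (rule gaussian_lin_form_square(1)[OF K(1)])
  have intQi: "integrable (gaussian ?K) (\<lambda>G. if r \<le> i \<and> r \<le> j then 0 else (H i j G)\<^sup>2)" for i j
    by (cases "r \<le> i \<and> r \<le> j") (simp_all only: if_True if_False simp_thms intH integrable_zero)
  \<comment> \<open>The first \<open>r\<close> diagonal places lie outside the block, so their
    coefficient vectors are orthogonal to those from which \<tau> is built.\<close>
  have crossH: "integrable (gaussian ?K) (\<lambda>G. H i i G * \<tau> G) \<and> (\<integral>G. H i i G * \<tau> G \<partial>gaussian ?K) = 0" if i: "i < r" for i
    unfolding H_def
  proof (rule cross, intro allI impI)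
    fix i' j' assume "i' < m" "j' < n"
    then show "(\<Sum>k\<in>?K. ?q i i k * ?q (r+i') (r+j') k) = 0"
      using i r dp by (subst rot_coeff_orthonormal[OF U V]) (auto simp: m_def n_def)
  qed
  have intQ: "integrable (gaussian ?K) Q"
    unfolding Q_def by (intro Bochner_Integration.integrable_sum intQi)
  have intL: "integrable (gaussian ?K) L"
    unfolding L_def using crossH by (intro Bochner_Integration.integrable_sum integrable_mult_right) simp
  \<comment> \<open>Each entry outside the block has variance one, and their number is d p - (d - r)
    (p - r) = r (d + p - r).\<close>
  have EQ: "(\<integral>G. Q G \<partial>gaussian ?K) = (real d + real p - real r) * real r"
  proof -
    have "(\<integral>G. Q G \<partial>gaussian ?K) = (\<Sum>i<d. \<Sum>j<p. \<integral>G. (if r \<le> i \<and> r \<le> j then 0 else (H i j G)\<^sup>2) \<partial>gaussian ?K)"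
      unfolding Q_def using intQi by (simp add: Bochner_Integration.integral_sum)
    also have "\<dots> = (\<Sum>i<d. \<Sum>j<p. 1 - (if r \<le> i \<and> r \<le> j then 1 else 0))"
    proof (intro sum.cong refl)
      fix i j assume "i \<in> {..<d}" "j \<in> {..<p}"
      then have ij: "i < d" "j < p" by auto
      have "(\<integral>G. (H i j G)\<^sup>2 \<partial>gaussian ?K) = (\<Sum>k\<in>?K. ?q i j k * ?q i j k)"
        unfolding H_def gaussian_lin_form_square(2)[OF K(1)] by (simp only: power2_eq_square)
      also have "\<dots> = 1" using rot_coeff_orthonormal[OF U V ij ij] by simp
      finally have one: "(\<integral>G. (H i j G)\<^sup>2 \<partial>gaussian ?K) = 1" .
      show "(\<integral>G. (if r \<le> i \<and> r \<le> j then 0 else (H i j G)\<^sup>2) \<partial>gaussian ?K) = 1 - (if r \<le> i \<and> r \<le> j then 1 else 0)"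
        by (cases "r \<le> i \<and> r \<le> j")
           (simp_all only: if_True if_False simp_thms one Bochner_Integration.integral_zero diff_self diff_zero)
    qed
    also have "\<dots> = real d * real p - real m * real n"
      unfolding sum_subtractf sum_lower_block[OF r(1) order_trans[OF r(1) dp]] by (simp add: m_def n_def)
    also have "\<dots> = (real d + real p - real r) * real r" unfolding dims by (simp add: algebra_simps)
    finally show ?thesis .
  qed
  have EL: "(\<integral>G. L G \<partial>gaussian ?K) = 0"
  proof -
    have "(\<integral>G. L G \<partial>gaussian ?K) = (\<Sum>i<r. \<integral>G. \<theta> $ i * (H i i G * \<tau> G) \<partial>gaussian ?K)"
      unfolding L_def using crossH by (intro Bochner_Integration.integral_sum integrable_mult_right) simp
    also have "\<dots> = 0" using crossH by (intro sum.neutral ballI) simp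
    finally show ?thesis .
  qed
  have s: "s \<le> real r * b\<^sup>2"
  proof -
    have "s \<le> (\<Sum>i<r. b\<^sup>2)" unfolding s_def
    proof (rule sum_mono, rule power_mono)
      fix i assume "i \<in> {..<r}"
      then have "i < d" using r by simp
      then show "\<theta> $ i \<le> b" "0 \<le> \<theta> $ i" using b[of i] c(2)[of i] c(1) by auto
    qed
    then show ?thesis by simp
  qed
  have s0: "0 \<le> s" unfolding s_def by (intro sum_nonneg) simp
  show ?thesis
  proof (rule gaussian_width_le_sqrt[OF S, where W=W])
    show "0 < (2 * (b / c)\<^sup>2 + 1) * (real d + real p - real r) * real r"
      using r dp by (intro mult_pos_pos add_nonneg_pos) auto
    show "0 \<le> W G" for G unfolding W[symmetric] by (intro sum_nonneg) simp
    show "integrable (gauss_mat d p) W"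
      unfolding gauss_mat_eq W_def
      by (intro Bochner_Integration.integrable_add Bochner_Integration.integrable_diff integrable_mult_right intQ intL int\<tau>)
    have "(\<integral>G. W G \<partial>gauss_mat d p) = (\<integral>G. Q G \<partial>gaussian ?K) - 2 / c * (\<integral>G. L G \<partial>gaussian ?K)
        + s / c\<^sup>2 * (\<integral>G. (\<tau> G)\<^sup>2 \<partial>gaussian ?K)"
      unfolding gauss_mat_eq W_def using intQ intL int\<tau> by simp
    also have "\<dots> = (real d + real p - real r) * real r + s / c\<^sup>2 * (\<integral>G. (\<tau> G)\<^sup>2 \<partial>gaussian ?K)"
      by (simp add: EQ EL)
    \<comment> \<open>Chevet gives 2 (d + p - 2 r); it is relaxed to 2 (d + p - r) so that both
      summands share the factor r (d + p - r).\<close>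
    also have "\<dots> \<le> (real d + real p - real r) * real r + (real r * b\<^sup>2) / c\<^sup>2 * (2 * (real d + real p - real r))"
    proof (intro add_left_mono mult_mono divide_right_mono s)
      show "(\<integral>G. (\<tau> G)\<^sup>2 \<partial>gaussian ?K) \<le> 2 * (real d + real p - real r)"
        using E\<tau> unfolding dims by simp
    qed (use s0 in simp_all)
    also have "\<dots> = (2 * (b / c)\<^sup>2 + 1) * (real d + real p - real r) * real r"
    proof -
      have e: "(real r * b\<^sup>2) / c\<^sup>2 = real r * (b / c)\<^sup>2" by (simp add: power_divide)
      have "x * y + y * z * (2 * x) = (2 * z + 1) * x * y" for x y z :: real
        by (simp add: algebra_simps)
      then show ?thesis unfolding e .
    qed
    finally show "(\<integral>G. W G \<partial>gauss_mat d p) \<le> (2 * (b / c)\<^sup>2 + 1) * (real d + real p - real r) * real r" .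
    fix G :: "nat \<times> nat \<Rightarrow> real" and Z assume "Z \<in> A_set d p R \<Theta>"
    then have Z: "Z \<in> carrier_mat d p" "frob_norm Z = 1" "Z \<in> err_cone d p R \<Theta>"
      by (auto simp: A_set_def)
    define A where "A = U\<^sup>T * Z * V\<^sup>T"
    note rot = inner_rotate[OF U V Z(1), folded A_def]
    have A1: "(\<Sum>i<d. \<Sum>j<p. (A $$ (i,j))\<^sup>2) = 1" using rot(2) frob_norm_eq_1D[OF Z(1,2)] by simp
    have "(\<Sum>i<d. \<Sum>j<p. G (i,j) * Z $$ (i,j)) = (\<Sum>i<d. \<Sum>j<p. H i j G * A $$ (i,j))"
      unfolding H_def by (rule rot(1))
    also have "\<dots> = (\<Sum>i<d. \<Sum>j<p. (H i j G - \<Gamma> G i j) * A $$ (i,j)) + (\<Sum>i<d. \<Sum>j<p. \<Gamma> G i j * A $$ (i,j))"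
      by (simp add: left_diff_distrib sum_subtractf)
    also have "\<dots> \<le> (\<Sum>i<d. \<Sum>j<p. (H i j G - \<Gamma> G i j) * A $$ (i,j))"
      using \<Gamma>_le[OF Z(3) A_def] by simp
    also have "\<dots> \<le> sqrt (\<Sum>i<d. \<Sum>j<p. (H i j G - \<Gamma> G i j)\<^sup>2)" by (rule frobenius_inner_le[OF A1])
    finally show "(\<Sum>i<d. \<Sum>j<p. G (i,j) * Z $$ (i,j)) \<le> sqrt (W G)" by (simp only: W)
  qed
qed

text \<open>The minimum becomes two separate bounds, and the convention that \<rho> is infinite for
  a zero smallest entry becomes the premise of the second. As \<theta> is sorted, its extreme
  entries sit at the indices 0 and d - 1, and \<open>r \<ge> 1\<close> forces \<open>d\<close> to be
  positive.\<close>

theorem theorem5: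
  fixes d p r :: nat and R :: "real mat \<Rightarrow> real" and f :: "real vec \<Rightarrow> real"
    and \<Theta> :: "real mat" and \<theta> :: "real vec"
  assumes "d \<le> p"
    and "unitarily_invariant d p R"
    and "symmetric_gauge d f"
    and "\<forall>A\<in>carrier_mat d p. R A = f (sing_vals d p A)"
    and "\<Theta> \<in> carrier_mat d p"
    and "vec_space.rank d \<Theta> = r" and "r \<ge> 1"
    and "is_subgradient d f (sing_vals d p \<Theta>) \<theta>"
    and "\<forall>i<d. 0 \<le> \<theta> $ i"
    and "\<forall>i j. i \<le> j \<and> j < d \<longrightarrow> \<theta> $ j \<le> \<theta> $ i"
  shows "gaussian_width d p (A_set d p R \<Theta>) \<le> sqrt (real d * real p)
    \<and> (\<theta> $ (d - 1) > 0 \<longrightarrow>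
         (let \<rho> = \<theta> $ 0 / \<theta> $ (d - 1) in
          gaussian_width d p (A_set d p R \<Theta>)
            \<le> sqrt ((2 * \<rho>\<^sup>2 + 1) * (real d + real p - real r) * real r)))"
proof -
  have rd: "r \<le> d" using vec_space.rank_le_n[OF assms(5)] assms(6) by simp
  then have d: "0 < d" "0 < p" using assms(1,7) by auto
  have "\<Theta> \<noteq> 0\<^sub>m d p"
    using assms(6,7) vec_space.rank_0I[of d p, where ?'a=real] by auto
  then have S: "A_set d p R \<Theta> \<noteq> {}" by (rule A_set_nonempty[OF assms(2,5)])
  note sv = sing_vals_svd[OF assms(5,1)]
  obtain U V where U: "orth_mat d U" and V: "orth_mat p V"
    and \<Theta>: "\<Theta> = U * rect_diag d p (sing_vals d p \<Theta>) * V" using sv(4) by blast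
  have z: "sing_vals d p \<Theta> $ i = 0" if "r \<le> i" "i < d" for i
    by (rule rank_singular_values_zero[OF U V assms(1) sv(2,3)]) (use that assms(6) \<Theta> in simp_all)
  have "gaussian_width d p (A_set d p R \<Theta>) \<le> sqrt (real d * real p)"
    by (rule gaussian_width_A_set_le_dim[OF S d])
  moreover have "gaussian_width d p (A_set d p R \<Theta>)
       \<le> sqrt ((2 * (\<theta> $ 0 / \<theta> $ (d - 1))\<^sup>2 + 1) * (real d + real p - real r) * real r)"
    if pos: "\<theta> $ (d - 1) > 0"
  proof (rule gaussian_width_A_set_le_rank[OF assms(1-4,8) sv(1) z pos _ _ U V rd assms(7) \<Theta> S])
    show "\<theta> $ (d - 1) \<le> \<theta> $ i" if "i < d" for i using assms(10) that by simp
    show "\<theta> $ i \<le> \<theta> $ 0" if "i < d" for i using assms(10) that by simp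
  qed
  ultimately show ?thesis by (simp add: Let_def)
qed

end
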